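(* Let $k\ge1$ be an integer. The set $$\left\{F^{\ell}\theta_2^{4(k-\ell)+2}:0\le\ell\le k-1\right\}\cup\left\{F^{2k-\ell}F_2^{\ell-k}\theta_2^{2}:k\le\ell\le2k\right\}\cup\left\{\frac{FF_2^{k}}{\theta_2^{2}}\right\}$$ forms a basis for $M_{2k+1}(8,\chi_{-4})$. That is, every $g\in M_{2k+1}(8,\chi_{-4})$ can be uniquely written as $$g(\tau)=\sum_{\ell=0}^{k-1}\alpha_k(\ell)F(\tau)^\ell\theta(2\tau)^{4(k-\ell)+2}+\sum_{\ell=k}^{2k}\beta_k(\ell)F(\tau)^{2k-\ell}F(2\tau)^{\ell-k}\theta(2\tau)^2+\gamma_k\frac{F(\tau)F(2\tau)^k}{\theta(2\tau)^2}$$ with $\alpha_k(r),\beta_k(s),\gamma_k\in\mathbb{C}$ for $0\le r\le k-1$, $k\le s\le2k$. Furthermore, if $g$ is a cusp form, then these coefficients satisfy 1. $\alpha_k(0)=0=\gamma_k$; 2. $\displaystyle\sum_{\ell=0}^{k-1}\frac{\alpha_k(\ell)}{4^\ell}+\sum_{\ell=k}^{2k}\frac{\beta_k(\ell)}{4^\ell}+\frac{\gamma_k}{2^{4k+3}}=0$; 3. $\displaystyle\sum_{\ell=0}^{k-1}(-1)^\ell\frac{\alpha_k(\ell)}{4^\ell}+\sum_{\ell=k}^{2k}(-1)^\ell\frac{\beta_k(\ell)}{4^\ell}-\frac{\gamma_k}{2^{4k+2}}=0$.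
   Context: Here $\tau$ lies in the upper half-plane, $q=e^{2\pi i\tau}$, $\eta(\tau)=q^{1/24}\prod_{n\ge1}(1-q^n)$, and $$F(\tau)=\frac{\eta(4\tau)^8}{\eta(2\tau)^4},\quad \theta(\tau)=\sum_{n=-\infty}^\infty q^{n^2}=\frac{\eta(2\tau)^5}{\eta(\tau)^2\eta(4\tau)^2},\quad F_2(\tau)=F(2\tau),\quad\theta_2(\tau)=\theta(2\tau).$$ $\chi_{-4}=\left(\frac{-4}{\cdot}\right)$ is the nontrivial Dirichlet character mod $4$, and $M_k(N,\chi)$ is the complex vector space of holomorphic modular forms of weight $k$ on $\Gamma_0(N)$ with Nebentypus $\chi$. *)

theory Defs
  imports "HOL-Complex_Analysis.Complex_Analysis" "HOL-Library.Function_Algebras"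
begin

definition uhp :: "complex set"
  where "uhp = {\<tau>. Im \<tau> > 0}"


section \<open>Modular forms with Nebentypus\<close>

text \<open>The quadruple \<open>(a, b, c, d)\<close> stands for the matrix with rows \<open>(a, b)\<close> and \<open>(c, d)\<close>.\<close>

type_synonym mat2 = "int \<times> int \<times> int \<times> int"

definition SL2Z :: "mat2 set"
  where "SL2Z = {(a, b, c, d). a * d - b * c = 1}"

definition Gamma0 :: "nat \<Rightarrow> mat2 set"
  where "Gamma0 N = {(a, b, c, d). a * d - b * c = 1 \<and> int N dvd c}"

fun moebius_act :: "mat2 \<Rightarrow> complex \<Rightarrow> complex"
  where "moebius_act (a, b, c, d) \<tau> = (of_int a * \<tau> + of_int b) / (of_int c * \<tau> + of_int d)"

fun slash :: "int \<Rightarrow> (complex \<Rightarrow> complex) \<Rightarrow> mat2 \<Rightarrow> complex \<Rightarrow> complex"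
  where "slash k f (a, b, c, d) \<tau> =
           (of_int c * \<tau> + of_int d) powi (- k) * f (moebius_act (a, b, c, d) \<tau>)"

text \<open>\<open>f\<close> has on the upper half-plane the Fourier expansion
  \<open>f(\<tau>) = \<Sum>\<^sub>n\<^sub>\<ge>\<^sub>0 u(n) e\<^sup>2\<^sup>\<pi>\<^sup>i\<^sup>n\<^sup>\<tau>\<^sup>/\<^sup>h\<close>, without negative exponents.\<close>

definition has_fourier_expansion :: "(complex \<Rightarrow> complex) \<Rightarrow> nat \<Rightarrow> (nat \<Rightarrow> complex) \<Rightarrow> bool"
  where "has_fourier_expansion f h u \<longleftrightarrow> h > 0 \<and>
           (\<forall>\<tau>\<in>uhp. (\<lambda>n. u n * exp (2 * of_real pi * \<i> * of_nat n * \<tau> / of_nat h)) sums f \<tau>)"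

text \<open>Modular forms are functions on the upper half-plane; they are represented by functions
  on \<open>\<complex>\<close> that vanish elsewhere, so that equality of forms is equality of functions.
  Every cusp has the form \<open>\<gamma>(\<infinity>)\<close> with \<open>\<gamma>\<close> in \<open>SL2Z\<close>, so the conditions at all cusps are
  conditions on the Fourier expansions of all the functions \<open>slash k f \<gamma>\<close>.\<close>

definition modular_forms :: "int \<Rightarrow> nat \<Rightarrow> (int \<Rightarrow> complex) \<Rightarrow> (complex \<Rightarrow> complex) set"
  where "modular_forms k N \<psi> = {f.
           f holomorphic_on uhp \<and>
           (\<forall>\<tau>. \<tau> \<notin> uhp \<longrightarrow> f \<tau> = 0) \<and>
           (\<forall>(a, b, c, d) \<in> Gamma0 N. \<forall>\<tau>\<in>uhp.
              f (moebius_act (a, b, c, d) \<tau>) = \<psi> d * (of_int c * \<tau> + of_int d) powi k * f \<tau>) \<and>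
           (\<forall>\<gamma>\<in>SL2Z. \<exists>h u. has_fourier_expansion (slash k f \<gamma>) h u)}"

definition cusp_forms :: "int \<Rightarrow> nat \<Rightarrow> (int \<Rightarrow> complex) \<Rightarrow> (complex \<Rightarrow> complex) set"
  where "cusp_forms k N \<psi> = {f \<in> modular_forms k N \<psi>.
           \<forall>\<gamma>\<in>SL2Z. \<exists>h u. has_fourier_expansion (slash k f \<gamma>) h u \<and> u 0 = 0}"

definition chi_minus4 :: "int \<Rightarrow> complex"
  where "chi_minus4 d = (if even d then 0 else if d mod 4 = 1 then 1 else - 1)"


section \<open>The complex vector space of functions\<close>

definition cfun_scale :: "complex \<Rightarrow> (complex \<Rightarrow> complex) \<Rightarrow> (complex \<Rightarrow> complex)"
  where "cfun_scale c f = (\<lambda>\<tau>. c * f \<tau>)"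

global_interpretation cfun: vector_space cfun_scale
  by unfold_locales (simp_all add: cfun_scale_def fun_eq_iff algebra_simps)

definition is_basis_of :: "(complex \<Rightarrow> complex) set \<Rightarrow> (complex \<Rightarrow> complex) set \<Rightarrow> bool"
  where "is_basis_of B V \<longleftrightarrow> cfun.independent B \<and> cfun.span B = V"


section \<open>The functions in the statement\<close>

definition eta :: "complex \<Rightarrow> complex"
  where "eta \<tau> = (if \<tau> \<in> uhp
           then exp (2 * of_real pi * \<i> * \<tau> / 24) *
                (\<Prod>n. 1 - exp (2 * of_real pi * \<i> * \<tau>) ^ Suc n)
           else 0)"

definition theta :: "complex \<Rightarrow> complex"
  where "theta \<tau> = (if \<tau> \<in> uhp
           then (\<Sum>\<^sub>\<infinity>n::int. exp (2 * of_real pi * \<i> * \<tau>) powi (n\<^sup>2))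
           else 0)"

definition F :: "complex \<Rightarrow> complex"
  where "F \<tau> = eta (4 * \<tau>) ^ 8 / eta (2 * \<tau>) ^ 4"

definition theta2 :: "complex \<Rightarrow> complex"
  where "theta2 \<tau> = theta (2 * \<tau>)"

definition F2 :: "complex \<Rightarrow> complex"
  where "F2 \<tau> = F (2 * \<tau>)"

definition basis_expansion ::
    "nat \<Rightarrow> (nat \<Rightarrow> complex) \<Rightarrow> (nat \<Rightarrow> complex) \<Rightarrow> complex \<Rightarrow> complex \<Rightarrow> complex"
  where "basis_expansion k \<alpha> \<beta> \<gamma> \<tau> =
           (\<Sum>l = 0..k - 1. \<alpha> l * F \<tau> ^ l * theta (2 * \<tau>) ^ (4 * (k - l) + 2)) +
           (\<Sum>l = k..2 * k. \<beta> l * F \<tau> ^ (2 * k - l) * F (2 * \<tau>) ^ (l - k) * theta (2 * \<tau>) ^ 2) +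
           \<gamma> * (F \<tau> * F (2 * \<tau>) ^ k / theta (2 * \<tau>) ^ 2)"

end

theory Submission
  imports Defs "HOL-Real_Asymp.Real_Asymp"
begin

text \<open>
  Write \<open>\<theta>\<^sub>2, \<theta>\<^sub>3, \<theta>\<^sub>4\<close> for the Jacobi theta functions. The two forms
  \<open>U(\<tau>) = \<theta>\<^sub>3(4\<tau>)\<^sup>2\<close> and \<open>Z(\<tau>) = \<theta>\<^sub>2(4\<tau>)\<^sup>2/4\<close> (\<open>form_U\<close>, \<open>form_Z\<close>) have weight one, and Gauss'
  product formulas give \<open>\<theta>(2\<tau>)\<^sup>2 = U\<close>, \<open>F(\<tau>) = UZ\<close> and \<open>F(2\<tau>) = Z\<^sup>2\<close>. Hence the functions
  of the theorem are the monomials \<open>U\<^bsup>2k+1-l\<^esup>Z\<^bsup>l\<^esup>\<close> with \<open>0 \<le> l \<le> 2k+1\<close>. Inversion of the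
  theta functions, which follows from Polya's argument with binomial sums over roots of unity,
  gives the transformation laws of \<open>U\<close> and \<open>Z\<close> under \<open>\<Gamma>\<^sub>0(8)\<close> and their values
  at the four cusps.

  The form \<open>Z\<close> vanishes only at \<open>\<infinity>\<close>, where it has a simple zero. Given a modular form \<open>g\<close> of
  weight \<open>n = 2k+1\<close>, subtract a combination of monomials that cancels the first \<open>n+1\<close> Fourier
  coefficients; the quotient of the difference by \<open>Z\<^sup>n\<close> is invariant under \<open>\<Gamma>\<^sub>0(8)\<close>,
  regular at all cusps and zero at \<open>\<infinity>\<close>, so it vanishes by the maximum principle. The relations for
  cusp forms express the vanishing of the homogeneous polynomial at the values of \<open>(U, Z)\<close> at
  the cusps.
\<close>

section \<open>Products for the theta series\<close>

text \<open>The maximum principle takes the place of a valence formula or a dimension count. It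
  needs a denominator without zeros in the half-plane, and this is read off the same infinite
  products that identify \<open>U\<close> and \<open>Z\<close> with eta quotients. Squares of theta
  constants keep the weight integral, so neither eighth roots of unity nor branches of the square
  root survive. Only \<open>th3\<close> has to be inverted analytically: \<open>th2\<close> and
  \<open>th4\<close> are combinations of \<open>th3\<close> at arguments scaled by 4, and their laws
  follow algebraically. The ratio Z/U takes the values 0, 1/4, -1/4 and infinity at the cusps
  infinity, 0, 1/2 and 1/4. This is the origin of the powers of 4 and of the signs in the cusp form
  relations, and of the vanishing of the two extreme coefficients. The definition of modular forms
  leaves the width of every Fourier expansion open. Hence values at cusps must first be shown
  independent of the width, and an expansion of width one must be extracted before monomials can be
  subtracted.\<close>

definition qfact :: "complex \<Rightarrow> nat \<Rightarrow> complex"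
  where "qfact x n = (\<Prod>i<n. 1 - x ^ Suc i)"

definition euler_prod :: "complex \<Rightarrow> complex"
  where "euler_prod x = (\<Prod>n. 1 - x ^ Suc n)"

text \<open>Gaussian binomial coefficients by a q-Pascal rule. Being free of division, it makes
  sense for every \<open>x\<close>; the quotient of q-factorials appears in \<open>qbin_eq\<close>,
  inside the unit disc.\<close>

fun qbin :: "complex \<Rightarrow> nat \<Rightarrow> nat \<Rightarrow> complex"
  where
    "qbin x n 0 = 1"
  | "qbin x 0 (Suc k) = 0"
  | "qbin x (Suc n) (Suc k) = qbin x n (Suc k) + x ^ (n - k) * qbin x n k"

text \<open>\<open>phi\<close> and \<open>psi\<close> are Ramanujan's theta functions: the sum of
  x^(n^2) over all integers n, folded at n = 0, and the sum of x^(n(n+1)/2) over the triangular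
  numbers.\<close>

definition phi :: "complex \<Rightarrow> complex"
  where "phi x = 1 + 2 * (\<Sum>n. x ^ (Suc n)\<^sup>2)"

definition psi :: "complex \<Rightarrow> complex"
  where "psi x = (\<Sum>n. x ^ (Suc n choose 2))"

lemma power_Suc_neq_1:
  assumes "norm (x::complex) < 1"
  shows "x ^ Suc n \<noteq> 1"
proof
  assume "x ^ Suc n = 1"
  then have "norm x ^ Suc n = 1" by (metis norm_power norm_one)
  moreover have "norm x ^ Suc n < 1" using assms by (subst power_less_one_iff) auto
  ultimately show False by simp
qed

lemma qfact_nonzero: "norm x < 1 \<Longrightarrow> qfact x n \<noteq> 0"
  using power_Suc_neq_1[of x] by (auto simp: qfact_def)

lemma convergent_prod_euler:
  assumes "norm (x::complex) < 1"
  shows "convergent_prod (\<lambda>n. 1 - x ^ Suc n)"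
proof -
  have "summable (\<lambda>n. norm x ^ Suc n)"
    using assms by (simp add: summable_mult)
  then show ?thesis
    by (intro abs_convergent_prod_imp_convergent_prod summable_imp_abs_convergent_prod)
       (simp_all add: norm_power norm_mult del: power_Suc)
qed

lemma qfact_tendsto: "norm x < 1 \<Longrightarrow> qfact x \<longlonglongrightarrow> euler_prod x"
  using convergent_prod_LIMSEQ[OF convergent_prod_euler, of x]
  unfolding qfact_def euler_prod_def lessThan_Suc_atMost[symmetric]
  by (subst (asm) filterlim_sequentially_Suc)

lemma euler_prod_nonzero: "norm x < 1 \<Longrightarrow> euler_prod x \<noteq> 0"
  unfolding euler_prod_def
  using power_Suc_neq_1[of x] by (intro prodinf_nonzero convergent_prod_euler) auto

lemma qbin_eq_0: "n < k \<Longrightarrow> qbin x n k = 0"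
  by (induction x n k rule: qbin.induct) auto

lemma Suc_choose_two: "Suc k choose 2 = k + (k choose 2)"
  by (simp add: numeral_2_eq_2)

text \<open>The q-binomial theorem: multiplication by the factor 1 + z x^n reproduces the q-Pascal
  rule because x^n = x^(n-k) x^k.\<close>

lemma gauss_binomial:
  "(\<Prod>k<n. 1 + z * x ^ k) = (\<Sum>k\<le>n. qbin x n k * x ^ (k choose 2) * z ^ k)"
proof (induction n)
  case 0
  then show ?case by (simp add: numeral_2_eq_2)
next
  case (Suc n)
  let ?f = "\<lambda>k. qbin x n k * x ^ (k choose 2) * z ^ k"
  have "(\<Sum>k\<le>Suc n. qbin x (Suc n) k * x ^ (k choose 2) * z ^ k)
      = 1 + (\<Sum>k\<le>n. qbin x (Suc n) (Suc k) * x ^ (Suc k choose 2) * z ^ Suc k)"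
    by (subst sum.atMost_Suc_shift) (simp add: numeral_2_eq_2)
  also have "(\<Sum>k\<le>n. qbin x (Suc n) (Suc k) * x ^ (Suc k choose 2) * z ^ Suc k)
      = (\<Sum>k\<le>n. ?f (Suc k) + z * x ^ n * ?f k)"
  proof (rule sum.cong, goal_cases)
    case (2 k)
    then have "x ^ n = x ^ (n - k) * x ^ k" by (simp flip: power_add)
    then show ?case
      by (simp add: Suc_choose_two power_add algebra_simps)
  qed simp
  also have "\<dots> = (\<Sum>k\<le>n. ?f (Suc k)) + z * x ^ n * (\<Sum>k\<le>n. ?f k)"
    by (simp add: sum.distrib sum_distrib_left)
  also have "1 + \<dots> = (1 + (\<Sum>k\<le>n. ?f (Suc k))) + z * x ^ n * (\<Sum>k\<le>n. ?f k)"
    by (simp only: add.assoc)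
  also have "1 + (\<Sum>k\<le>n. ?f (Suc k)) = (\<Sum>k\<le>Suc n. ?f k)"
    by (subst sum.atMost_Suc_shift) (simp add: numeral_2_eq_2)
  also have "\<dots> = (\<Sum>k\<le>n. ?f k)"
    by (simp add: qbin_eq_0)
  finally show ?case
    by (simp only: prod.lessThan_Suc Suc.IH) (simp add: algebra_simps)
qed

text \<open>The quotient formula cleared of denominators, so that the induction needs no
  non-vanishing. The two terms of the Pascal rule combine through (1 - x^(n-k)) + x^(n-k) (1 -
  x^(k+1)) = 1 - x^(n+1).\<close>

lemma qbin_qfact:
  assumes "k \<le> n"
  shows "qbin x n k * (qfact x k * qfact x (n - k)) = qfact x n"
  using assms
proof (induction x n k rule: qbin.induct)
  case (1 x n)
  then show ?case by (simp add: qfact_def)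
next
  case (2 x k)
  then show ?case by simp
next
  case (3 x n k)
  show ?case
  proof (cases "k = n")
    case True
    have [simp]: "qfact x 0 = 1" by (simp add: qfact_def)
    show ?thesis using 3 True by (simp add: qbin_eq_0) (auto simp: qfact_def)
  next
    case False
    then have k: "k < n" using 3 by simp
    then have s: "n - k = Suc (n - Suc k)" by simp
    have q: "qfact x (n - k) = (1 - x ^ (n - k)) * qfact x (n - Suc k)"
      unfolding s by (simp add: qfact_def)
    have "qbin x (Suc n) (Suc k) * (qfact x (Suc k) * qfact x (Suc n - Suc k))
       = (qbin x n (Suc k) * (qfact x (Suc k) * qfact x (n - Suc k))) * (1 - x ^ (n - k))
        + x ^ (n - k) * (1 - x ^ Suc k) * (qbin x n k * (qfact x k * qfact x (n - k)))"
      by (simp add: q algebra_simps) (simp add: qfact_def algebra_simps)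
    also have "\<dots> = qfact x n * (1 - x ^ (n - k) * x ^ Suc k)"
      using 3 k by (simp add: algebra_simps)
    also have "x ^ (n - k) * x ^ Suc k = x ^ Suc n"
      using k by (simp flip: power_add)
    finally show ?thesis by (simp add: qfact_def)
  qed
qed

lemma qbin_eq:
  assumes "norm x < 1" "k \<le> n"
  shows "qbin x n k = qfact x n / (qfact x k * qfact x (n - k))"
  using qbin_qfact[OF assms(2), of x] qfact_nonzero[OF assms(1)]
  by (simp add: field_simps)

lemma sum_atMost_centre_even:
  fixes f :: "nat \<Rightarrow> 'a::comm_monoid_add"
  shows "(\<Sum>k\<le>2 * n. f k) = f n + (\<Sum>j<n. f (n - Suc j) + f (n + Suc j))"
proof -
  have "(\<Sum>k\<le>2 * n. f k) = (\<Sum>k<n. f k) + (\<Sum>k\<in>{n..<Suc (2 * n)}. f k)"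
    unfolding lessThan_Suc_atMost[symmetric] lessThan_atLeast0
    by (rule sum.atLeastLessThan_concat[symmetric]) auto
  also have "(\<Sum>k<n. f k) = (\<Sum>j<n. f (n - Suc j))"
    by (rule sum.nat_diff_reindex[symmetric])
  also have "(\<Sum>k\<in>{n..<Suc (2 * n)}. f k) = f n + (\<Sum>k\<in>{Suc n..<Suc (2 * n)}. f k)"
    by (subst sum.atLeast_Suc_lessThan) auto
  also have "(\<Sum>k\<in>{Suc n..<Suc (2 * n)}. f k) = (\<Sum>j<n. f (n + Suc j))"
    by (rule sum.reindex_bij_witness[of _ "\<lambda>j. n + Suc j" "\<lambda>k. k - Suc n"]) auto
  finally show ?thesis by (simp add: sum.distrib ac_simps)
qed

lemma sum_atMost_centre_odd:
  fixes f :: "nat \<Rightarrow> 'a::comm_monoid_add"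
  shows "(\<Sum>k\<le>2 * n + 1. f k) = (\<Sum>j\<le>n. f (n - j) + f (n + 1 + j))"
proof -
  have "(\<Sum>k\<le>2 * n + 1. f k) = (\<Sum>k<Suc n. f k) + (\<Sum>k\<in>{Suc n..<Suc (2 * n + 1)}. f k)"
    unfolding lessThan_Suc_atMost[symmetric] lessThan_atLeast0
    by (rule sum.atLeastLessThan_concat[symmetric]) auto
  also have "(\<Sum>k<Suc n. f k) = (\<Sum>j<Suc n. f (n - j))"
    by (subst sum.nat_diff_reindex[symmetric]) simp
  also have "(\<Sum>k\<in>{Suc n..<Suc (2 * n + 1)}. f k) = (\<Sum>j<Suc n. f (n + 1 + j))"
    by (rule sum.reindex_bij_witness[of _ "\<lambda>j. n + 1 + j" "\<lambda>k. k - Suc n"]) auto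
  finally show ?thesis by (simp add: sum.distrib lessThan_Suc_atMost)
qed

text \<open>Centring the sum in the q-binomial theorem at its middle term, for a suitable negative power
  \<open>z\<close> of the base, gives finite forms of Gauss' identities without negative exponents.\<close>

lemma gauss_phi_finite:
  assumes "x \<noteq> 0" "norm x < 1"
  shows "(\<Prod>j<n. 1 + x ^ (2 * j + 1))\<^sup>2
       = qbin (x\<^sup>2) (2 * n) n + 2 * (\<Sum>j<n. qbin (x\<^sup>2) (2 * n) (n - Suc j) * x ^ (Suc j)\<^sup>2)"
proof -
  \<comment> \<open>This is x^(1-2n): the exponents 2k + 1 - 2n then run through the odd numbers
    from 1 - 2n to 2n - 1, symmetrically about 0.\<close>
  define z where "z = x / x ^ (2 * n)"
  have x2: "norm (x\<^sup>2) < 1" using assms by (simp add: norm_power power_less_one_iff)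
  have cs: "2 * (k choose 2) + k = k\<^sup>2" for k :: nat
    by (induction k) (auto simp: Suc_choose_two power2_eq_square numeral_2_eq_2)
  have "(\<Prod>k<2 * n. 1 + z * (x\<^sup>2) ^ k) = (\<Prod>k<n. 1 + z * (x\<^sup>2) ^ k) * (\<Prod>k\<in>{n..<2 * n}. 1 + z * (x\<^sup>2) ^ k)"
    unfolding lessThan_atLeast0
    by (rule prod.atLeastLessThan_concat[symmetric]) auto
  also have "(\<Prod>k<n. 1 + z * (x\<^sup>2) ^ k) = (\<Prod>j<n. 1 + z * (x\<^sup>2) ^ (n - Suc j))"
    by (rule prod.nat_diff_reindex[symmetric])
  also have "\<dots> = (\<Prod>j<n. (1 + x ^ (2 * j + 1)) / x ^ (2 * j + 1))"
  proof (rule prod.cong, goal_cases)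
    case (2 j)
    then have "2 * (n - Suc j) + (2 * j + 2) = 2 * n" by auto
    then have "x ^ (2 * n) = (x\<^sup>2) ^ (n - Suc j) * x ^ (2 * j + 2)"
      by (metis power_mult power_add)
    then show ?case using assms by (simp add: z_def field_simps)
  qed simp
  also have "(\<Prod>k\<in>{n..<2 * n}. 1 + z * (x\<^sup>2) ^ k) = (\<Prod>j<n. 1 + z * (x\<^sup>2) ^ (n + j))"
    by (rule prod.reindex_bij_witness[of _ "\<lambda>j. n + j" "\<lambda>k. k - n"]) auto
  also have "\<dots> = (\<Prod>j<n. 1 + x ^ (2 * j + 1))"
    using assms
    by (intro prod.cong refl)
       (simp add: z_def distrib_left power_add flip: power_mult)
  also have "(\<Prod>j<n. (1 + x ^ (2 * j + 1)) / x ^ (2 * j + 1)) * (\<Prod>j<n. 1 + x ^ (2 * j + 1))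
     = (\<Prod>j<n. 1 + x ^ (2 * j + 1))\<^sup>2 / (\<Prod>j<n. x ^ (2 * j + 1))"
    by (simp add: prod_dividef power2_eq_square)
  also have "(\<Prod>j<n. x ^ (2 * j + 1)) = x ^ n\<^sup>2"
    by (induction n) (auto simp: power2_eq_square algebra_simps power_add mult_2_right)
  finally have "(\<Prod>j<n. 1 + x ^ (2 * j + 1))\<^sup>2
      = x ^ n\<^sup>2 * (\<Sum>k\<le>2 * n. qbin (x\<^sup>2) (2 * n) k * (x\<^sup>2) ^ (k choose 2) * z ^ k)"
    using assms(1) unfolding gauss_binomial by simp
  also have "\<dots> = (\<Sum>k\<le>2 * n. qbin (x\<^sup>2) (2 * n) k * (x ^ n\<^sup>2 * x ^ k\<^sup>2 / x ^ (2 * n * k)))"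
    unfolding sum_distrib_left
    by (intro sum.cong refl)
       (simp add: z_def power_divide flip: cs power_mult, simp add: power_add power_mult)
  also have "\<dots> = qbin (x\<^sup>2) (2 * n) n + (\<Sum>j<n. 2 * (qbin (x\<^sup>2) (2 * n) (n - Suc j) * x ^ (Suc j)\<^sup>2))"
    unfolding sum_atMost_centre_even
  proof (intro arg_cong2[where f = "(+)"] sum.cong refl, goal_cases)
    case 1
    have "x ^ n\<^sup>2 * x ^ n\<^sup>2 = x ^ (2 * n * n)"
      by (simp flip: power_add add: power2_eq_square mult_2 distrib_right)
    then show ?case using assms(1) by simp
  next
    case (2 j)
    then have j: "Suc j \<le> n" by simp
    have sym: "qbin (x\<^sup>2) (2 * n) (n + Suc j) = qbin (x\<^sup>2) (2 * n) (n - Suc j)"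
      using j by (simp add: qbin_eq[OF x2] mult.commute)
    have "n\<^sup>2 + (n + Suc j)\<^sup>2 = (Suc j)\<^sup>2 + 2 * n * (n + Suc j)"
      by (simp add: power2_eq_square algebra_simps)
    then have "x ^ n\<^sup>2 * x ^ (n + Suc j)\<^sup>2 = x ^ (Suc j)\<^sup>2 * x ^ (2 * n * (n + Suc j))"
      by (metis power_add)
    moreover have "x ^ n\<^sup>2 * x ^ (n - Suc j)\<^sup>2 = x ^ (Suc j)\<^sup>2 * x ^ (2 * n * (n - Suc j))"
    proof -
      obtain i where i: "n = Suc j + i" using j le_Suc_ex by blast
      have "(Suc j + i)\<^sup>2 + i\<^sup>2 = (Suc j)\<^sup>2 + 2 * (Suc j + i) * i"
        by (simp add: power2_eq_square algebra_simps)
      then have "n\<^sup>2 + (n - Suc j)\<^sup>2 = (Suc j)\<^sup>2 + 2 * n * (n - Suc j)"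
        unfolding i by simp
      then show ?thesis by (metis power_add)
    qed
    ultimately show ?case using assms(1) by (simp add: sym del: add_Suc_right)
  qed
  finally show ?thesis by (simp add: sum_distrib_left)
qed

lemma gauss_psi_finite:
  assumes "x \<noteq> 0" "norm x < 1"
  shows "(\<Prod>j<n. 1 + x ^ Suc j)\<^sup>2 = (\<Sum>j\<le>n. qbin x (2 * n + 1) (n - j) * x ^ (Suc j choose 2))"
proof -
  \<comment> \<open>The exponents k - n now run from -n to n. The exponent 0 contributes a factor 2,
    which cancels the doubling of the sum on the right.\<close>
  define z where "z = 1 / x ^ n"
  have cs: "2 * (Suc k choose 2) = k * (k + 1)" for k :: nat
    by (induction k) (auto simp: Suc_choose_two numeral_2_eq_2)
  have "(\<Prod>k<2 * n + 1. 1 + z * x ^ k) = (\<Prod>k<n. 1 + z * x ^ k) * (\<Prod>k\<in>{n..<2 * n + 1}. 1 + z * x ^ k)"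
    unfolding lessThan_atLeast0
    by (rule prod.atLeastLessThan_concat[symmetric]) auto
  also have "(\<Prod>k<n. 1 + z * x ^ k) = (\<Prod>j<n. 1 + z * x ^ (n - Suc j))"
    by (rule prod.nat_diff_reindex[symmetric])
  also have "\<dots> = (\<Prod>j<n. (1 + x ^ Suc j) / x ^ Suc j)"
  proof (rule prod.cong, goal_cases)
    case (2 j)
    then have "x ^ n = x ^ (n - Suc j) * x ^ Suc j"
      by (simp flip: power_add del: power_Suc)
    then show ?case using assms by (simp add: z_def field_simps)
  qed simp
  also have "(\<Prod>k\<in>{n..<2 * n + 1}. 1 + z * x ^ k) = (\<Prod>j<Suc n. 1 + z * x ^ (n + j))"
    by (rule prod.reindex_bij_witness[of _ "\<lambda>j. n + j" "\<lambda>k. k - n"]) auto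
  also have "\<dots> = (\<Prod>j<Suc n. 1 + x ^ j)"
    using assms by (intro prod.cong) (auto simp: z_def power_add)
  also have "\<dots> = 2 * (\<Prod>j<n. 1 + x ^ Suc j)"
    by (subst prod.lessThan_Suc_shift) simp
  also have "(\<Prod>j<n. (1 + x ^ Suc j) / x ^ Suc j) * (2 * (\<Prod>j<n. 1 + x ^ Suc j))
     = 2 * (\<Prod>j<n. 1 + x ^ Suc j)\<^sup>2 / (\<Prod>j<n. x ^ Suc j)"
    by (simp add: prod_dividef power2_eq_square)
  also have "(\<Prod>j<n. x ^ Suc j) = x ^ (Suc n choose 2)"
    by (induction n) (auto simp: Suc_choose_two power_add numeral_2_eq_2)
  finally have "2 * (\<Prod>j<n. 1 + x ^ Suc j)\<^sup>2
      = x ^ (Suc n choose 2) * (\<Sum>k\<le>2 * n + 1. qbin x (2 * n + 1) k * x ^ (k choose 2) * z ^ k)"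
    using assms(1) unfolding gauss_binomial by (simp add: field_simps)
  also have "\<dots> = (\<Sum>k\<le>2 * n + 1. qbin x (2 * n + 1) k * (x ^ ((Suc n choose 2) + (k choose 2)) / x ^ (n * k)))"
    unfolding sum_distrib_left
    by (intro sum.cong refl) (simp add: z_def power_divide power_add power_mult)
  also have "\<dots> = (\<Sum>j\<le>n. 2 * (qbin x (2 * n + 1) (n - j) * x ^ (Suc j choose 2)))"
    unfolding sum_atMost_centre_odd
  proof (intro sum.cong refl, goal_cases)
    case (1 j)
    then have j: "j \<le> n" by simp
    then obtain i where i: "n = i + j" by (metis le_Suc_ex add.commute)
    have sym: "qbin x (2 * n + 1) (n + 1 + j) = qbin x (2 * n + 1) (n - j)"
      using j by (simp add: qbin_eq[OF assms(2)] mult.commute Suc_diff_le del: qbin.simps)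
    have "2 * ((Suc n choose 2) + (n + 1 + j choose 2)) = 2 * ((Suc j choose 2) + n * (n + 1 + j))"
      using cs[of n] cs[of "n + j"] cs[of j] by (simp add: algebra_simps)
    then have e1: "(Suc n choose 2) + (n + 1 + j choose 2) = (Suc j choose 2) + n * (n + 1 + j)"
      by (subst (asm) mult_cancel1) simp
    have "2 * ((Suc n choose 2) + (i choose 2)) = 2 * ((Suc j choose 2) + n * i)"
      using cs[of n] cs[of i] cs[of j] Suc_choose_two[of i] unfolding i by (simp add: algebra_simps)
    then have e2: "(Suc n choose 2) + (n - j choose 2) = (Suc j choose 2) + n * (n - j)"
      using i by simp
    show ?case unfolding sym e1 e2 using assms(1) by (simp add: power_add)
  qed
  finally show ?thesis by (simp flip: sum_distrib_left)
qed

section \<open>Passage to the limit in Gauss' identities\<close>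

lemma qbin_bounded:
  assumes "norm x < 1"
  obtains B where "\<And>n k. k \<le> n \<Longrightarrow> norm (qbin x n k) \<le> B" "B > 0"
proof -
  \<comment> \<open>The q-factorials converge to a nonzero limit, so they and their inverses are
    bounded. The resulting bound is uniform in \<open>n\<close> and \<open>k\<close>, as a majorant
    for Tannery's theorem must be.\<close>
  have "Bseq (qfact x)"
    using qfact_tendsto[OF assms] by (intro convergent_imp_Bseq convergentI)
  then obtain K where K: "K > 0" "\<And>n. norm (qfact x n) \<le> K" by (auto simp: Bseq_def)
  have "(\<lambda>n. inverse (qfact x n)) \<longlonglongrightarrow> inverse (euler_prod x)"
    by (intro tendsto_inverse qfact_tendsto assms euler_prod_nonzero)
  then have "Bseq (\<lambda>n. inverse (qfact x n))"
    by (intro convergent_imp_Bseq convergentI)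
  then obtain L where L: "L > 0" "\<And>n. norm (inverse (qfact x n)) \<le> L" by (auto simp: Bseq_def)
  show ?thesis
  proof (rule that[of "K * (L * L)"])
    fix n k :: nat
    assume "k \<le> n"
    then have "qbin x n k = qfact x n * (inverse (qfact x k) * inverse (qfact x (n - k)))"
      by (simp add: qbin_eq[OF assms] divide_inverse)
    also have "norm \<dots> = norm (qfact x n) * (norm (inverse (qfact x k)) * norm (inverse (qfact x (n - k))))"
      by (simp only: norm_mult)
    also have "\<dots> \<le> K * (L * L)"
      using K L by (intro mult_mono) auto
    finally show "norm (qbin x n k) \<le> K * (L * L)" .
  qed (use K L in auto)
qed

lemma qbin_tendsto:
  assumes x: "norm x < 1" and f: "filterlim f at_top sequentially" and g: "filterlim g at_top sequentially"
  shows "(\<lambda>n. qbin x (f n + g n) (f n)) \<longlonglongrightarrow> inverse (euler_prod x)"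
proof -
  have fg: "filterlim (\<lambda>n. f n + g n) at_top sequentially"
    by (rule filterlim_at_top_mono[OF f]) auto
  note L = filterlim_compose[OF qfact_tendsto[OF x]]
  have "(\<lambda>n. qfact x (f n + g n) / (qfact x (f n) * qfact x (g n)))
          \<longlonglongrightarrow> euler_prod x / (euler_prod x * euler_prod x)"
    using euler_prod_nonzero[OF x] by (intro tendsto_intros L f g fg) auto
  also have "euler_prod x / (euler_prod x * euler_prod x) = inverse (euler_prod x)"
    using euler_prod_nonzero[OF x] by (simp add: field_simps)
  finally show ?thesis by (simp add: qbin_eq[OF x])
qed

lemma summable_lacunary:
  fixes x :: "'a :: {real_normed_field, banach}"
  assumes "norm x < 1" "\<And>n. n \<le> e n"
  shows "summable (\<lambda>n. x ^ e n)"
proof (rule summable_comparison_test')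
  show "summable (\<lambda>n. norm x ^ n)" using assms by simp
  show "norm (x ^ e n) \<le> norm x ^ n" for n
    using assms by (simp add: norm_power power_decreasing)
qed

lemma le_Suc_choose_two: "n \<le> Suc n choose 2"
  by (simp add: Suc_choose_two)

lemma le_Suc_power2: "n \<le> (Suc n)\<^sup>2"
  by (simp add: power2_eq_square)

lemma prod_one_plus_power:
  assumes "norm x < 1"
  shows "(\<Prod>j<n. 1 + x ^ Suc j) = qfact (x\<^sup>2) n / qfact x n"
proof -
  have "(\<Prod>j<n. 1 + x ^ Suc j) * qfact x n = qfact (x\<^sup>2) n"
    unfolding qfact_def prod.distrib[symmetric]
    by (intro prod.cong refl) (simp add: algebra_simps power2_eq_square power_mult_distrib)
  then show ?thesis using qfact_nonzero[OF assms] by (simp add: field_simps)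
qed

lemma prod_one_plus_power_tendsto:
  assumes "norm x < 1"
  shows "(\<lambda>n. \<Prod>j<n. 1 + x ^ Suc j) \<longlonglongrightarrow> euler_prod (x\<^sup>2) / euler_prod x"
proof -
  have "norm (x\<^sup>2) < 1" using assms by (simp add: norm_power power_less_one_iff)
  then show ?thesis
    unfolding prod_one_plus_power[OF assms]
    by (intro tendsto_divide qfact_tendsto euler_prod_nonzero assms)
qed

text \<open>The limit of \<open>gauss_phi_finite\<close>. The product over odd exponents is the
  quotient of the product over all exponents by the one over even exponents, and
  \<open>prod_one_plus_power_tendsto\<close> evaluates both.\<close>

theorem phi_product:
  assumes "x \<noteq> 0" "norm x < 1"
  shows "phi x = euler_prod (x\<^sup>2) ^ 5 / (euler_prod x ^ 2 * euler_prod (x ^ 4) ^ 2)"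
proof -
  let ?E = euler_prod
  have x2: "norm (x\<^sup>2) < 1" and x4: "norm (x ^ 4) < 1"
    using assms by (simp_all add: norm_power power_less_one_iff)
  obtain B where B: "\<And>n k. k \<le> n \<Longrightarrow> norm (qbin (x\<^sup>2) n k) \<le> B" "B > 0"
    using qbin_bounded[OF x2] by blast
  \<comment> \<open>Extension by zero turns the finite sums into series over all \<open>k\<close>,
    the form that Tannery's theorem asks for.\<close>
  define a where "a = (\<lambda>k n. if k < n then qbin (x\<^sup>2) (2 * n) (n - Suc k) * x ^ (Suc k)\<^sup>2 else 0)"
  have "(\<lambda>n. \<Sum>k. a k n) \<longlonglongrightarrow> (\<Sum>k. inverse (?E (x\<^sup>2)) * x ^ (Suc k)\<^sup>2)"
  proof (rule conjunct2[OF conjunct2[OF tannerys_theorem]])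
    show "eventually (\<lambda>(k, n). norm (a k n) \<le> B * norm x ^ (Suc k)\<^sup>2) (at_top \<times>\<^sub>F sequentially)"
      using B by (intro always_eventually) (auto simp: a_def norm_mult norm_power intro!: mult_right_mono)
    show "summable (\<lambda>k. B * norm x ^ (Suc k)\<^sup>2)"
      using assms by (intro summable_mult summable_lacunary le_Suc_power2) auto
    show "(\<lambda>n. a k n) \<longlonglongrightarrow> inverse (?E (x\<^sup>2)) * x ^ (Suc k)\<^sup>2" for k
    proof (rule Lim_transform_eventually)
      show "(\<lambda>n. qbin (x\<^sup>2) ((n - Suc k) + (n + Suc k)) (n - Suc k) * x ^ (Suc k)\<^sup>2) \<longlonglongrightarrow> inverse (?E (x\<^sup>2)) * x ^ (Suc k)\<^sup>2"
        by (intro tendsto_intros qbin_tendsto x2 filterlim_minus_const_nat_at_top filterlim_add_const_nat_at_top)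
      show "eventually (\<lambda>n. qbin (x\<^sup>2) ((n - Suc k) + (n + Suc k)) (n - Suc k) * x ^ (Suc k)\<^sup>2 = a k n) sequentially"
        using eventually_gt_at_top[of k] by eventually_elim (auto simp: a_def mult_2)
    qed
  qed simp
  moreover have "(\<Sum>k. a k n) = (\<Sum>j<n. qbin (x\<^sup>2) (2 * n) (n - Suc j) * x ^ (Suc j)\<^sup>2)" for n
    by (subst suminf_finite[of "{..<n}"]) (auto simp: a_def)
  ultimately have "(\<lambda>n. \<Sum>j<n. qbin (x\<^sup>2) (2 * n) (n - Suc j) * x ^ (Suc j)\<^sup>2) \<longlonglongrightarrow> (\<Sum>k. inverse (?E (x\<^sup>2)) * x ^ (Suc k)\<^sup>2)"
    by simp
  moreover have "(\<lambda>n. qbin (x\<^sup>2) (2 * n) n) \<longlonglongrightarrow> inverse (?E (x\<^sup>2))"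
    using qbin_tendsto[OF x2 filterlim_ident filterlim_ident] by (simp add: mult_2)
  ultimately have "(\<lambda>n. (\<Prod>j<n. 1 + x ^ (2 * j + 1))\<^sup>2) \<longlonglongrightarrow>
      inverse (?E (x\<^sup>2)) + 2 * (\<Sum>k. inverse (?E (x\<^sup>2)) * x ^ (Suc k)\<^sup>2)"
    unfolding gauss_phi_finite[OF assms] by (intro tendsto_intros)
  also have "inverse (?E (x\<^sup>2)) + 2 * (\<Sum>k. inverse (?E (x\<^sup>2)) * x ^ (Suc k)\<^sup>2) = phi x / ?E (x\<^sup>2)"
    using summable_lacunary[OF assms(2) le_Suc_power2]
    by (simp add: phi_def suminf_mult divide_inverse algebra_simps)
  finally have 1: "(\<lambda>n. (\<Prod>j<n. 1 + x ^ (2 * j + 1))\<^sup>2) \<longlonglongrightarrow> phi x / ?E (x\<^sup>2)" .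
  have eq: "(\<Prod>j<n. 1 + x ^ (2 * j + 1)) = (\<Prod>j<2 * n. 1 + x ^ Suc j) / (\<Prod>j<n. 1 + (x\<^sup>2) ^ Suc j)" for n
  proof -
    have "(\<Prod>j<2 * n. 1 + x ^ Suc j) = (\<Prod>j<n. 1 + x ^ (2 * j + 1)) * (\<Prod>j<n. 1 + (x\<^sup>2) ^ Suc j)"
      by (induction n) (auto simp: algebra_simps power_add power_mult power2_eq_square power_mult_distrib)
    moreover have "(\<Prod>j<n. 1 + (x\<^sup>2) ^ Suc j) \<noteq> 0"
      using qfact_nonzero[OF x2] qfact_nonzero[OF x4]
      by (subst prod_one_plus_power[OF x2]) (simp flip: power_mult)
    ultimately show ?thesis by (simp add: field_simps)
  qed
  have "filterlim (\<lambda>n. 2 * n) at_top sequentially"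
    by (rule filterlim_at_top_mono[OF filterlim_ident]) auto
  note L = filterlim_compose[OF prod_one_plus_power_tendsto[OF assms(2)] this]
  have "(\<lambda>n. (\<Prod>j<n. 1 + x ^ (2 * j + 1))\<^sup>2) \<longlonglongrightarrow>
      ((?E (x\<^sup>2) / ?E x) / (?E ((x\<^sup>2)\<^sup>2) / ?E (x\<^sup>2)))\<^sup>2"
    unfolding eq using euler_prod_nonzero[OF x2] euler_prod_nonzero[OF x4]
    by (intro tendsto_intros prod_one_plus_power_tendsto L x2) (auto simp flip: power_mult)
  from LIMSEQ_unique[OF 1 this]
  show ?thesis
    using euler_prod_nonzero[OF x2] euler_prod_nonzero[OF x4] euler_prod_nonzero[OF assms(2)]
    by (simp add: field_simps power2_eq_square flip: power_mult) (simp add: eval_nat_numeral algebra_simps)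
qed

text \<open>The limit of \<open>gauss_psi_finite\<close>: with E = \<open>euler_prod\<close>, the
  product on the left tends to E(x^2)/E(x) and every q-binomial coefficient on the right to
  1/E(x).\<close>

theorem psi_product:
  assumes "x \<noteq> 0" "norm x < 1"
  shows "psi x = euler_prod (x\<^sup>2) ^ 2 / euler_prod x"
proof -
  let ?E = euler_prod
  obtain B where B: "\<And>n k. k \<le> n \<Longrightarrow> norm (qbin x n k) \<le> B" "B > 0"
    using qbin_bounded[OF assms(2)] by blast
  define a where "a = (\<lambda>k n. if k \<le> n then qbin x (2 * n + 1) (n - k) * x ^ (Suc k choose 2) else 0)"
  have "(\<lambda>n. \<Sum>k. a k n) \<longlonglongrightarrow> (\<Sum>k. inverse (?E x) * x ^ (Suc k choose 2))"
  proof (rule conjunct2[OF conjunct2[OF tannerys_theorem]])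
    show "eventually (\<lambda>(k, n). norm (a k n) \<le> B * norm x ^ (Suc k choose 2)) (at_top \<times>\<^sub>F sequentially)"
      using B by (intro always_eventually) (auto simp: a_def norm_mult norm_power intro!: mult_right_mono)
    show "summable (\<lambda>k. B * norm x ^ (Suc k choose 2))"
      using assms by (intro summable_mult summable_lacunary le_Suc_choose_two) auto
    show "(\<lambda>n. a k n) \<longlonglongrightarrow> inverse (?E x) * x ^ (Suc k choose 2)" for k
    proof (rule Lim_transform_eventually)
      show "(\<lambda>n. qbin x ((n - k) + (n + Suc k)) (n - k) * x ^ (Suc k choose 2)) \<longlonglongrightarrow> inverse (?E x) * x ^ (Suc k choose 2)"
        by (intro tendsto_intros qbin_tendsto assms filterlim_minus_const_nat_at_top filterlim_add_const_nat_at_top)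
      show "eventually (\<lambda>n. qbin x ((n - k) + (n + Suc k)) (n - k) * x ^ (Suc k choose 2) = a k n) sequentially"
        using eventually_ge_at_top[of k] by eventually_elim (auto simp: a_def mult_2)
    qed
  qed simp
  moreover have "(\<Sum>k. a k n) = (\<Sum>j\<le>n. qbin x (2 * n + 1) (n - j) * x ^ (Suc j choose 2))" for n
    by (subst suminf_finite[of "{..n}"]) (auto simp: a_def)
  ultimately have "(\<lambda>n. (\<Prod>j<n. 1 + x ^ Suc j)\<^sup>2) \<longlonglongrightarrow> (\<Sum>k. inverse (?E x) * x ^ (Suc k choose 2))"
    by (simp only: gauss_psi_finite[OF assms])
  also have "(\<Sum>k. inverse (?E x) * x ^ (Suc k choose 2)) = psi x / ?E x"
    using summable_lacunary[OF assms(2) le_Suc_choose_two]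
    by (simp add: psi_def suminf_mult divide_inverse)
  finally have 1: "(\<lambda>n. (\<Prod>j<n. 1 + x ^ Suc j)\<^sup>2) \<longlonglongrightarrow> psi x / ?E x" .
  have "(\<lambda>n. (\<Prod>j<n. 1 + x ^ Suc j)\<^sup>2) \<longlonglongrightarrow> (?E (x\<^sup>2) / ?E x)\<^sup>2"
    by (intro tendsto_intros prod_one_plus_power_tendsto assms)
  from LIMSEQ_unique[OF 1 this]
  show ?thesis
    using euler_prod_nonzero[OF assms(2)]
    by (simp add: field_simps power2_eq_square)
qed

section \<open>Inversion of the Gaussian theta series\<close>

lemma sum_cis_roots_of_unity:
  fixes d :: int and L :: nat
  assumes "L > 0"
  shows "(\<Sum>v<L. cis (2 * pi * d * v / L)) = (if int L dvd d then of_nat L else 0)"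
proof (cases "int L dvd d")
  case True
  then obtain e where e: "d = int L * e" by auto
  have "cis (2 * pi * d * v / L) = 1" for v :: nat
  proof -
    have "2 * pi * d * v / L = 2 * pi * of_int (e * int v)"
      using assms by (simp add: e)
    then show ?thesis by (simp only:) (rule cis_multiple_2pi, simp)
  qed
  then show ?thesis using True by simp
next
  case False
  define r where "r = cis (2 * pi * d / L)"
  have "r \<noteq> 1"
  proof
    assume "r = 1"
    then have "cos (2 * pi * d / L) = 1" by (simp add: r_def complex_eq_iff)
    then obtain n :: int where "2 * pi * d / L = of_int n * 2 * pi" unfolding cos_one_2pi_int by blast
    then have "real_of_int d = real_of_int (n * int L)" using assms by (simp add: field_simps)
    then have "d = n * int L" by linarith
    with False show False by simp
  qed
  have "r ^ L = cis (2 * pi * d)" using assms by (simp add: r_def Complex.DeMoivre)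
  also have "\<dots> = 1" by (rule cis_multiple_2pi) simp
  finally have rL: "r ^ L = 1" .
  have "(\<Sum>v<L. cis (2 * pi * d * v / L)) = (\<Sum>v<L. r ^ v)"
    by (intro sum.cong refl) (simp add: r_def Complex.DeMoivre mult_ac)
  also have "\<dots> = 0" using geometric_sum[OF \<open>r \<noteq> 1\<close>, of L] rL by simp
  finally show ?thesis using False by simp
qed

text \<open>Expanding (e^(ia) + e^(-ia))^(2m) at a = pi v / L gives the frequencies 2(j - m); the
  sum over \<open>v\<close> retains only those \<open>j\<close> congruent to \<open>m\<close> modulo
  \<open>L\<close>.\<close>

lemma sum_cos_power:
  assumes "L > 0"
  shows "(\<Sum>v<L. (2 * cos (pi * real v / real L)) ^ (2 * m))
       = real L * (\<Sum>j\<le>2 * m. if int L dvd int j - int m then real (2 * m choose j) else 0)"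
proof -
  have "complex_of_real (\<Sum>v<L. (2 * cos (pi * real v / real L)) ^ (2 * m))
      = (\<Sum>v<L. \<Sum>j\<le>2 * m. of_nat (2 * m choose j) * cis (2 * pi * (int j - int m) * v / L))"
  proof (subst of_real_sum, intro sum.cong refl)
    fix v :: nat
    let ?a = "pi * real v / real L"
    have "complex_of_real ((2 * cos ?a) ^ (2 * m)) = (cis ?a + cis (- ?a)) ^ (2 * m)"
      by (simp add: complex_eq_iff)
    also have "\<dots> = (\<Sum>j\<le>2 * m. of_nat (2 * m choose j) * cis ?a ^ j * cis (- ?a) ^ (2 * m - j))"
      by (rule binomial_ring)
    also have "\<dots> = (\<Sum>j\<le>2 * m. of_nat (2 * m choose j) * cis (2 * pi * (int j - int m) * v / L))"
    proof (intro sum.cong refl)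
      fix j assume "j \<in> {..2 * m}"
      then have "real j * ?a + real (2 * m - j) * (- ?a) = 2 * pi * (int j - int m) * v / L"
        by (simp add: of_nat_diff diff_divide_distrib algebra_simps)
      then show "of_nat (2 * m choose j) * cis ?a ^ j * cis (- ?a) ^ (2 * m - j)
          = of_nat (2 * m choose j) * cis (2 * pi * (int j - int m) * v / L)"
        by (simp only: Complex.DeMoivre mult.assoc cis_mult)
    qed
    finally show "complex_of_real ((2 * cos ?a) ^ (2 * m))
       = (\<Sum>j\<le>2 * m. of_nat (2 * m choose j) * cis (2 * pi * (int j - int m) * v / L))" .
  qed
  also have "\<dots> = (\<Sum>j\<le>2 * m. of_nat (2 * m choose j) * (\<Sum>v<L. cis (2 * pi * (int j - int m) * v / L)))"
    by (subst sum.swap) (simp add: sum_distrib_left)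
  also have "\<dots> = (\<Sum>j\<le>2 * m. of_nat (2 * m choose j) * (if int L dvd int j - int m then of_nat L else 0))"
    by (simp only: sum_cis_roots_of_unity[OF assms])
  also have "\<dots> = complex_of_real (real L * (\<Sum>j\<le>2 * m. if int L dvd int j - int m then real (2 * m choose j) else 0))"
    by (auto simp: sum_distrib_left if_distrib intro!: sum.cong)
  finally show ?thesis by (simp only: of_real_eq_iff)
qed

text \<open>For odd \<open>L\<close> the reflection v -> L - v pairs all residues except 0, and on
  the right j = m + r is paired with j = m - r. Both sides thereby take the shape 1 + 2(...) of a
  folded theta series.\<close>

lemma sum_cos_power_symmetric:
  fixes p m :: nat
  defines "L \<equiv> 2 * p + 1"
  shows "1 + 2 * (\<Sum>v<p. cos (pi * real (Suc v) / real L) ^ (2 * m))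
       = real L * real (2 * m choose m) / 4 ^ m *
         (1 + 2 * (\<Sum>k<m. if Suc k * L \<le> m then real (2 * m choose (m + Suc k * L)) / real (2 * m choose m) else 0))"
proof -
  define c where "c = (\<lambda>v. cos (pi * real v / real L) ^ (2 * m))"
  define g where "g = (\<lambda>r. if r \<le> m then real (2 * m choose (m + r)) else 0)"
  have L: "L > 0" by (simp add: L_def)
  have crefl: "c (L - Suc v) = c (Suc v)" if "v < p" for v
  proof -
    have "pi * real (L - Suc v) / real L = pi - pi * real (Suc v) / real L"
      using that L by (simp add: L_def of_nat_diff field_simps)
    then show ?thesis by (simp add: c_def)
  qed
  have "(\<Sum>v<L. c v) = c 0 + (\<Sum>v<2 * p. c (Suc v))"
    unfolding L_def Suc_eq_plus1[symmetric] by (rule sum.lessThan_Suc_shift)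
  also have "(\<Sum>v<2 * p. c (Suc v)) = (\<Sum>v<p. c (Suc v)) + (\<Sum>v\<in>{p..<2 * p}. c (Suc v))"
    unfolding lessThan_atLeast0 by (rule sum.atLeastLessThan_concat[symmetric]) auto
  also have "(\<Sum>v\<in>{p..<2 * p}. c (Suc v)) = (\<Sum>v<p. c (L - Suc v))"
    by (rule sum.reindex_bij_witness[of _ "\<lambda>v. 2 * p - Suc v" "\<lambda>v. 2 * p - Suc v"])
       (auto simp: L_def Suc_diff_Suc)
  also have "\<dots> = (\<Sum>v<p. c (Suc v))"
    by (intro sum.cong refl crefl) auto
  finally have lhs: "(\<Sum>v<L. c v) = 1 + 2 * (\<Sum>v<p. c (Suc v))"
    by (simp add: c_def)
  have "(\<Sum>v<L. (2 * cos (pi * real v / real L)) ^ (2 * m)) = 4 ^ m * (\<Sum>v<L. c v)"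
    by (simp add: c_def power_mult_distrib power_mult sum_distrib_left)
  then have 1: "4 ^ m * (1 + 2 * (\<Sum>v<p. c (Suc v)))
     = real L * (\<Sum>j\<le>2 * m. if int L dvd int j - int m then real (2 * m choose j) else 0)"
    using sum_cos_power[OF L, of m] by (simp add: lhs)
  have dec: "\<exists>q. Suc i = Suc q * L \<and> Suc i div L = Suc q" if "L dvd Suc i" for i
  proof -
    from that obtain q where q: "Suc i = L * q" by blast
    then obtain q' where "q = Suc q'" by (cases q) auto
    then show ?thesis using q L by (intro exI[of _ q']) (simp del: mult_Suc mult_Suc_right add: mult.commute)
  qed
  have "(\<Sum>j\<le>2 * m. if int L dvd int j - int m then real (2 * m choose j) else 0)
     = real (2 * m choose m) + (\<Sum>i<m. 2 * (if L dvd Suc i then g (Suc i) else 0))"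
    unfolding sum_atMost_centre_even
  proof (intro arg_cong2[where f = "(+)"] sum.cong refl, goal_cases)
    case (2 i)
    then have i: "Suc i \<le> m" by simp
    have "int (m - Suc i) - int m = - int (Suc i)" "int (m + Suc i) - int m = int (Suc i)"
      using i by (simp_all add: of_nat_diff)
    then have "int L dvd int (m - Suc i) - int m \<longleftrightarrow> L dvd Suc i"
      "int L dvd int (m + Suc i) - int m \<longleftrightarrow> L dvd Suc i"
      by (simp_all only: dvd_minus_iff int_dvd_int_iff)
    moreover have "2 * m choose (m - Suc i) = 2 * m choose (m + Suc i)"
      using i by (subst binomial_symmetric) (auto simp: mult_2)
    ultimately show ?case using i by (simp add: g_def)
  qed simp
  also have "(\<Sum>i<m. 2 * (if L dvd Suc i then g (Suc i) else 0)) = 2 * (\<Sum>i<m. if L dvd Suc i then g (Suc i) else 0)"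
    by (simp add: sum_distrib_left)
  also have "(\<Sum>i<m. if L dvd Suc i then g (Suc i) else 0) = (\<Sum>i\<in>{i. i < m \<and> L dvd Suc i}. g (Suc i))"
    by (subst sum.inter_filter[symmetric]) (auto intro!: sum.cong)
  \<comment> \<open>Only multiples of \<open>L\<close> contribute, written as
    \<open>Suc i = Suc k * L\<close>. The bound k < m follows from \<open>Suc k * L \<le> m\<close>;
    stating it keeps the index set visibly finite.\<close>
  also have "\<dots> = (\<Sum>k\<in>{k. k < m \<and> Suc k * L \<le> m}. g (Suc k * L))"
  proof (rule sum.reindex_bij_witness[of _ "\<lambda>k. Suc k * L - 1" "\<lambda>i. Suc i div L - 1"], goal_cases)
    case (1 i)
    then show ?case using dec[of i] by auto
  next
    case (2 i)
    then obtain q where q: "Suc i = Suc q * L" using dec by auto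
    then have "Suc i div L = Suc q" using L by (metis nonzero_mult_div_cancel_right not_less0)
    moreover have "Suc q \<le> Suc q * L" using L by (cases L) auto
    ultimately show ?case using 2 q by auto
  next
    case (3 k)
    then show ?case using L by (simp del: mult_Suc)
  next
    case (4 k)
    then show ?case using L by (auto simp del: mult_Suc)
  next
    case (5 i)
    then show ?case using dec[of i] by auto
  qed
  also have "\<dots> = (\<Sum>k<m. if Suc k * L \<le> m then g (Suc k * L) else 0)"
    by (subst sum.inter_filter[symmetric]) (auto intro!: sum.cong)
  also have "\<dots> = real (2 * m choose m) * (\<Sum>k<m. if Suc k * L \<le> m then real (2 * m choose (m + Suc k * L)) / real (2 * m choose m) else 0)"
    unfolding sum_distrib_left
    by (intro sum.cong refl) (auto simp: g_def)
  finally have 2: "(\<Sum>j\<le>2 * m. if int L dvd int j - int m then real (2 * m choose j) else 0)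
     = real (2 * m choose m) * (1 + 2 * (\<Sum>k<m. if Suc k * L \<le> m then real (2 * m choose (m + Suc k * L)) / real (2 * m choose m) else 0))"
    by (simp add: algebra_simps)
  show ?thesis using 1 unfolding 2 by (simp add: c_def field_simps)
qed

section \<open>Gaussian estimates for cosine powers and binomial coefficients\<close>

lemma x_cos_le_sin:
  fixes x :: real
  assumes "0 \<le> x" "x \<le> pi"
  shows "x * cos x \<le> sin x"
proof -
  have "sin 0 - 0 * cos 0 \<le> sin x - x * cos x"
  proof (rule DERIV_nonneg_imp_nondecreasing[OF assms(1)])
    fix y assume y: "0 \<le> y" "y \<le> x"
    have "((\<lambda>x. sin x - x * cos x) has_real_derivative y * sin y) (at y)"
      by (auto intro!: derivative_eq_intros)
    moreover have "y * sin y \<ge> 0" using y assms by (intro mult_nonneg_nonneg sin_ge_zero) auto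
    ultimately show "\<exists>z. ((\<lambda>x. sin x - x * cos x) has_real_derivative z) (at y) \<and> 0 \<le> z" by blast
  qed
  then show ?thesis by simp
qed

text \<open>From x cos x <= sin x one gets (1 + x^2) cos^2 x <= 1, and Bernoulli's inequality
  replaces (1 + x^2)^m by 1 + m x^2. This weak decay already gives a summable majorant of order
  1/v^2.\<close>

lemma cos_power_bound:
  assumes "0 \<le> x" "x \<le> pi / 2"
  shows "cos x ^ (2 * m) \<le> inverse (1 + real m * x\<^sup>2)"
proof -
  have "0 \<le> cos x" using assms by (intro cos_ge_zero) auto
  then have "x\<^sup>2 * (cos x)\<^sup>2 \<le> (sin x)\<^sup>2"
    using power_mono[OF x_cos_le_sin[of x], of 2] assms by (simp add: power_mult_distrib)
  then have "(1 + x\<^sup>2) * (cos x)\<^sup>2 \<le> 1"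
    using sin_cos_squared_add[of x] unfolding distrib_right by linarith
  then have "((1 + x\<^sup>2) * (cos x)\<^sup>2) ^ m \<le> 1"
    by (intro power_le_one) auto
  then have "(1 + x\<^sup>2) ^ m * cos x ^ (2 * m) \<le> 1"
    by (simp add: power_mult_distrib power_mult)
  moreover have "1 + real m * x\<^sup>2 \<le> (1 + x\<^sup>2) ^ m"
    by (rule Bernoulli_inequality) (auto intro: order_trans[of _ 0])
  moreover have "0 \<le> cos x ^ (2 * m)" by (simp add: power_mult)
  ultimately have "(1 + real m * x\<^sup>2) * cos x ^ (2 * m) \<le> 1"
    by (meson mult_right_mono order_trans)
  then show ?thesis by (simp add: field_simps add_pos_nonneg)
qed

lemma binomial_ratio_Suc:
  assumes "j < m"
  shows "real (2 * m choose (m + Suc j)) = real (2 * m choose (m + j)) * (1 - real (2 * j + 1) / real (m + j + 1))"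
proof -
  have "Suc (m + j) * (2 * m choose Suc (m + j)) = (2 * m - (m + j)) * (2 * m choose (m + j))"
    using binomial_absorption[of "m + j" "2 * m"] binomial_absorb_comp[of "2 * m" "m + j"] by simp
  then have "real (m + j + 1) * real (2 * m choose (m + Suc j)) = real (m - j) * real (2 * m choose (m + j))"
    by (metis add_Suc_right mult_2 diff_add_inverse diff_diff_left of_nat_mult Suc_eq_plus1)
  then show ?thesis using assms by (simp add: field_simps of_nat_diff)
qed

text \<open>Consecutive coefficients have the ratio 1 - (2j+1)/(m+j+1), whose inverse is 1 +
  (2j+1)/(m-j). Both are estimated by exponentials with a denominator independent of
  \<open>j\<close>, and the first r odd numbers add up to r^2.\<close>

lemma binomial_ratio_bounds:
  assumes "r \<le> m"
  shows "real (2 * m choose (m + r)) / real (2 * m choose m) \<le> exp (- (real r)\<^sup>2 / real (m + r))"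
    and "exp (- (real r)\<^sup>2 / real (m + 1 - r)) \<le> real (2 * m choose (m + r)) / real (2 * m choose m)"
proof -
  let ?C = "real (2 * m choose m)"
  have C: "?C > 0" by simp
  have *: "j \<le> r \<Longrightarrow> real (2 * m choose (m + j)) \<le> ?C * exp (- (real j)\<^sup>2 / real (m + r)) \<and>
     ?C * exp (- (real j)\<^sup>2 / real (m + 1 - r)) \<le> real (2 * m choose (m + j))" for j
  proof (induction j)
    case (Suc j)
    then have j: "j < m" "j < r" and IH: "real (2 * m choose (m + j)) \<le> ?C * exp (- (real j)\<^sup>2 / real (m + r))"
      "?C * exp (- (real j)\<^sup>2 / real (m + 1 - r)) \<le> real (2 * m choose (m + j))"
      using assms by auto
    let ?t = "real (2 * j + 1)"
    have sq: "(real (Suc j))\<^sup>2 = (real j)\<^sup>2 + ?t" by (simp add: power2_eq_square algebra_simps)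
    have e: "exp (- (real (Suc j))\<^sup>2 / d) = exp (- (real j)\<^sup>2 / d) * exp (- ?t / d)" for d :: real
      by (simp only: sq flip: exp_add) (simp add: add_divide_distrib diff_divide_distrib)
    have n0: "0 \<le> 1 - ?t / real (m + j + 1)" using j by (simp add: field_simps)
    have "1 - ?t / real (m + j + 1) \<le> exp (- ?t / real (m + j + 1))"
      unfolding diff_conv_add_uminus minus_divide_left by (rule exp_ge_add_one_self)
    also have "\<dots> \<le> exp (- ?t / real (m + r))"
      using j by (auto intro!: divide_left_mono simp: divide_simps)
    finally have u: "1 - ?t / real (m + j + 1) \<le> exp (- ?t / real (m + r))" .
    have "1 + ?t / real (m - j) \<le> exp (?t / real (m - j))" by (rule exp_ge_add_one_self)
    also have "\<dots> \<le> exp (?t / real (m + 1 - r))"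
      using j assms by (simp add: frac_le)
    finally have "inverse (exp (?t / real (m + 1 - r))) \<le> inverse (1 + ?t / real (m - j))"
      using j by (intro le_imp_inverse_le add_pos_nonneg) auto
    also have "inverse (1 + ?t / real (m - j)) = 1 - ?t / real (m + j + 1)"
      using j by (simp add: field_simps of_nat_diff)
    finally have l: "exp (- ?t / real (m + 1 - r)) \<le> 1 - ?t / real (m + j + 1)"
      by (simp only: exp_minus minus_divide_left[symmetric])
    show ?case
      unfolding binomial_ratio_Suc[OF j(1)] e mult.assoc[symmetric]
      using IH u l n0 C by (intro conjI mult_mono) auto
  qed simp
  from *[of r] show "real (2 * m choose (m + r)) / real (2 * m choose m) \<le> exp (- (real r)\<^sup>2 / real (m + r))"
    and "exp (- (real r)\<^sup>2 / real (m + 1 - r)) \<le> real (2 * m choose (m + r)) / real (2 * m choose m)"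
    using C by (simp_all add: field_simps)
qed

text \<open>The expression is the reciprocal of the m-th partial Wallis product, since both change
  by the same factor from \<open>m\<close> to \<open>Suc m\<close>.\<close>

lemma central_binomial_wallis:
  "(\<lambda>m. (real (2 * m choose m) / 4 ^ m)\<^sup>2 * real (2 * m + 1)) \<longlonglongrightarrow> 2 / pi"
proof -
  have "(real (2 * m choose m) / 4 ^ m)\<^sup>2 * real (2 * m + 1) = inverse (\<Prod>k=1..m. (4 * real k^2) / (4 * real k^2 - 1))" for m
  proof (induction m)
    case (Suc m)
    have "Suc m * (2 * Suc m choose Suc m) = 2 * ((2 * m + 1) * (2 * m choose m))"
    proof -
      have "Suc m * (Suc (Suc (2 * m)) choose Suc m) = Suc (Suc (2 * m)) * (Suc (2 * m) choose m)"
        by (rule Suc_times_binomial_eq[symmetric, unfolded mult.commute[of _ "Suc _"]])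
      moreover have "Suc m * (Suc (2 * m) choose m) = Suc (2 * m) * (2 * m choose m)"
        using binomial_absorb_comp[of "Suc (2 * m)" m] by (simp del: binomial_Suc_Suc)
      ultimately show ?thesis by simp
    qed
    then have "real (Suc m) * real (2 * Suc m choose Suc m) = 2 * (real (2 * m + 1) * real (2 * m choose m))"
      by (metis of_nat_mult of_nat_numeral)
    then have s: "real (2 * Suc m choose Suc m) = 2 * (real (2 * m + 1) * real (2 * m choose m)) / real (Suc m)"
      by (simp add: field_simps)
    have "(real (2 * Suc m choose Suc m) / 4 ^ Suc m)\<^sup>2 * real (2 * Suc m + 1)
        = ((real (2 * m choose m) / 4 ^ m)\<^sup>2 * real (2 * m + 1)) * ((4 * real (Suc m)^2 - 1) / (4 * real (Suc m)^2))"
      unfolding s by (simp add: power2_eq_square divide_simps) (simp add: algebra_simps)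
    also have "\<dots> = inverse ((\<Prod>k=1..m. (4 * real k^2) / (4 * real k^2 - 1)) * ((4 * real (Suc m)^2) / (4 * real (Suc m)^2 - 1)))"
      unfolding Suc.IH by (simp only: inverse_mult_distrib inverse_divide)
    also have "\<dots> = inverse (\<Prod>k=1..Suc m. (4 * real k^2) / (4 * real k^2 - 1))"
      by (subst prod.nat_ivl_Suc') (simp_all add: mult.commute)
    finally show ?case .
  qed simp
  moreover have "(\<lambda>m. inverse (\<Prod>k=1..m. (4 * real k^2) / (4 * real k^2 - 1))) \<longlonglongrightarrow> inverse (pi / 2)"
    by (intro tendsto_inverse wallis) simp
  ultimately show ?thesis by simp
qed

text \<open>The limit of the prefactor in \<open>sum_cos_power_symmetric\<close>: its square is the
  Wallis expression divided by (2M+1)/L^2, which tends to 2t.\<close>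

lemma wallis_sequence:
  assumes "t > 0" and M: "(\<lambda>p. real (M p) / real (2 * p + 1) ^ 2) \<longlonglongrightarrow> t"
    and Minf: "filterlim M at_top sequentially"
  shows "(\<lambda>p. real (2 * p + 1) * real (2 * M p choose M p) / 4 ^ M p) \<longlonglongrightarrow> inverse (sqrt (pi * t))"
proof -
  have "(\<lambda>p. (real (2 * M p choose M p) / 4 ^ M p)\<^sup>2 * real (2 * M p + 1)
         / (2 * (real (M p) / real (2 * p + 1) ^ 2) + 1 / real (2 * p + 1) ^ 2)) \<longlonglongrightarrow> (2 / pi) / (2 * t + 0)"
    using \<open>t > 0\<close>
    by (intro tendsto_intros filterlim_compose[OF central_binomial_wallis Minf] M) (simp_all, real_asymp)
  then have "(\<lambda>p. sqrt ((real (2 * M p choose M p) / 4 ^ M p)\<^sup>2 * real (2 * M p + 1)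
         / (2 * (real (M p) / real (2 * p + 1) ^ 2) + 1 / real (2 * p + 1) ^ 2))) \<longlonglongrightarrow> sqrt ((2 / pi) / (2 * t + 0))"
    by (rule tendsto_real_sqrt)
  also have "(\<lambda>p. sqrt ((real (2 * M p choose M p) / 4 ^ M p)\<^sup>2 * real (2 * M p + 1)
         / (2 * (real (M p) / real (2 * p + 1) ^ 2) + 1 / real (2 * p + 1) ^ 2)))
      = (\<lambda>p. real (2 * p + 1) * real (2 * M p choose M p) / 4 ^ M p)"
  proof
    fix p
    have "2 * (real (M p) / real (2 * p + 1) ^ 2) + 1 / real (2 * p + 1) ^ 2 = real (2 * M p + 1) / real (2 * p + 1) ^ 2"
      by (simp add: add_divide_distrib)
    then have "(real (2 * M p choose M p) / 4 ^ M p)\<^sup>2 * real (2 * M p + 1)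
         / (2 * (real (M p) / real (2 * p + 1) ^ 2) + 1 / real (2 * p + 1) ^ 2)
         = (real (2 * p + 1) * real (2 * M p choose M p) / 4 ^ M p)\<^sup>2"
      by (simp add: power_divide power_mult_distrib)
    then show "sqrt ((real (2 * M p choose M p) / 4 ^ M p)\<^sup>2 * real (2 * M p + 1)
         / (2 * (real (M p) / real (2 * p + 1) ^ 2) + 1 / real (2 * p + 1) ^ 2))
         = real (2 * p + 1) * real (2 * M p choose M p) / 4 ^ M p" by simp
  qed
  also have "sqrt ((2 / pi) / (2 * t + 0)) = inverse (sqrt (pi * t))"
    by (simp add: real_sqrt_mult real_sqrt_divide field_simps)
  finally show ?thesis .
qed

text \<open>Polya's proof: divide the finite identity \<open>sum_cos_power_symmetric\<close> by \<open>4\<^sup>m\<close> and let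
  \<open>m, L \<rightarrow> \<infinity>\<close> with \<open>m / L\<^sup>2 \<rightarrow> t\<close>; both sides converge termwise with summable majorants.\<close>

lemma gaussian_theta_inversion:
  fixes t :: real
  assumes t: "t > 0"
  shows "1 + 2 * (\<Sum>v. exp (- (pi\<^sup>2 * t * real (Suc v) ^ 2)))
       = inverse (sqrt (pi * t)) * (1 + 2 * (\<Sum>k. exp (- (real (Suc k) ^ 2 / t))))"
proof -
  \<comment> \<open>\<open>L\<close> is odd, as the symmetric cosine sum demands, and
    \<open>M\<close> is chosen to make M/L^2 tend to t.\<close>
  define L where "L = (\<lambda>p::nat. 2 * p + 1)"
  define M where "M = (\<lambda>p. nat \<lfloor>t * real (L p) ^ 2\<rfloor>)"
  have Lpos: "real (L p) > 0" for p by (simp add: L_def)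
  have Mlim: "(\<lambda>p. real (M p) / real (L p) ^ 2) \<longlonglongrightarrow> t"
    unfolding M_def L_def using t by real_asymp
  have Minf: "filterlim M at_top sequentially"
    unfolding M_def L_def using t by real_asymp
  have Linf: "filterlim (\<lambda>p. real (L p)) at_top sequentially"
    unfolding L_def by real_asymp
  have Mev: "eventually (\<lambda>p. t / 2 < real (M p) / real (L p) ^ 2 \<and> real (M p) / real (L p) ^ 2 < 2 * t) sequentially"
    using t by (intro eventually_conj order_tendstoD[OF Mlim]) auto
  have summ: "summable (\<lambda>k. C * inverse (real (Suc k) ^ 2))" for C
    using inverse_power_summable[of 2, where ?'a = real] by (intro summable_mult) (subst summable_Suc_iff, simp)
  define a where "a = (\<lambda>v p. if v < p then cos (pi * real (Suc v) / real (L p)) ^ (2 * M p) else 0)"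
  have "(\<lambda>p. \<Sum>v. a v p) \<longlonglongrightarrow> (\<Sum>v. exp (- (pi\<^sup>2 * t * real (Suc v) ^ 2)))"
  proof (rule conjunct2[OF conjunct2[OF tannerys_theorem]])
    have "norm (a v p) \<le> (2 / (t * pi\<^sup>2)) * inverse (real (Suc v) ^ 2)"
      if p: "t / 2 < real (M p) / real (L p) ^ 2" for v p
    proof (cases "v < p")
      case True
      let ?x = "pi * real (Suc v) / real (L p)"
      have "real (Suc v) / real (L p) \<le> 1 / 2" using True by (simp add: L_def field_simps)
      from mult_left_mono[OF this, of pi] have x: "0 \<le> ?x" "?x \<le> pi / 2" by simp_all
      have "norm (a v p) = cos ?x ^ (2 * M p)" using True by (simp add: a_def power_mult)
      also have "\<dots> \<le> inverse (1 + real (M p) * ?x\<^sup>2)" by (rule cos_power_bound[OF x])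
      also have "\<dots> \<le> inverse (t / 2 * (pi * real (Suc v))\<^sup>2)"
      proof (rule le_imp_inverse_le)
        have "t / 2 * (pi * real (Suc v))\<^sup>2 \<le> real (M p) / real (L p) ^ 2 * (pi * real (Suc v))\<^sup>2"
          using p by (intro mult_right_mono) auto
        then show "t / 2 * (pi * real (Suc v))\<^sup>2 \<le> 1 + real (M p) * ?x\<^sup>2"
          by (simp add: power_divide)
        show "0 < t / 2 * (pi * real (Suc v))\<^sup>2" using t by simp
      qed
      also have "\<dots> = (2 / (t * pi\<^sup>2)) * inverse (real (Suc v) ^ 2)"
        using t by (simp add: power_mult_distrib field_simps del: of_nat_Suc)
      finally show ?thesis .
    qed (use t in \<open>simp add: a_def\<close>)
    then show "eventually (\<lambda>(v, p). norm (a v p) \<le> (2 / (t * pi\<^sup>2)) * inverse (real (Suc v) ^ 2)) (at_top \<times>\<^sub>F sequentially)"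
      unfolding eventually_prod_filter
      by (intro exI[of _ "\<lambda>_. True"] exI[of _ "\<lambda>p. t / 2 < real (M p) / real (L p) ^ 2 \<and> real (M p) / real (L p) ^ 2 < 2 * t"]) (use Mev in auto)
    show "summable (\<lambda>v. (2 / (t * pi\<^sup>2)) * inverse (real (Suc v) ^ 2))" by (rule summ)
    fix v
    define c where "c = pi * real (Suc v)"
    have c: "c > 0" by (simp add: c_def)
    \<comment> \<open>The cosine power is exp(M ln(cos^2)), and M is asymptotic to t L^2, so this
      limit of the logarithm produces exp(-t c^2).\<close>
    have "((\<lambda>x. x\<^sup>2 * ln ((cos (c / x))\<^sup>2)) \<longlongrightarrow> - c\<^sup>2) at_top"
      using c unfolding power2_eq_square by real_asymp
    from filterlim_compose[OF this Linf]
    have "(\<lambda>p. real (M p) / real (L p) ^ 2 * (real (L p) ^ 2 * ln ((cos (c / real (L p)))\<^sup>2))) \<longlonglongrightarrow> t * - c\<^sup>2"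
      by (intro tendsto_mult Mlim)
    then have "(\<lambda>p. exp (real (M p) / real (L p) ^ 2 * (real (L p) ^ 2 * ln ((cos (c / real (L p)))\<^sup>2)))) \<longlonglongrightarrow> exp (t * - c\<^sup>2)"
      by (rule tendsto_exp)
    moreover have "eventually (\<lambda>p. exp (real (M p) / real (L p) ^ 2 * (real (L p) ^ 2 * ln ((cos (c / real (L p)))\<^sup>2))) = a v p) sequentially"
      using eventually_gt_at_top[of v]
    proof eventually_elim
      case (elim p)
      have "real (Suc v) / real (L p) < 1 / 2" using elim by (simp add: L_def field_simps)
      from mult_strict_left_mono[OF this, of pi] have "c / real (L p) < pi / 2" "0 < c / real (L p)"
        using c Lpos[of p] by (simp_all add: c_def)
      then have "cos (c / real (L p)) > 0" by (intro cos_gt_zero) auto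
      then show ?case using Lpos[of p] elim
        by (simp add: a_def c_def exp_of_nat_mult power_mult del: of_nat_Suc)
    qed
    ultimately have "(\<lambda>p. a v p) \<longlonglongrightarrow> exp (t * - c\<^sup>2)"
      by (rule Lim_transform_eventually)
    then show "(\<lambda>p. a v p) \<longlonglongrightarrow> exp (- (pi\<^sup>2 * t * real (Suc v) ^ 2))"
      by (simp add: c_def power_mult_distrib mult_ac del: of_nat_Suc)
  qed simp
  moreover have "(\<Sum>v. a v p) = (\<Sum>v<p. cos (pi * real (Suc v) / real (L p)) ^ (2 * M p))" for p
    by (subst suminf_finite[of "{..<p}"]) (auto simp: a_def)
  ultimately have A: "(\<lambda>p. 1 + 2 * (\<Sum>v<p. cos (pi * real (Suc v) / real (L p)) ^ (2 * M p)))
      \<longlonglongrightarrow> 1 + 2 * (\<Sum>v. exp (- (pi\<^sup>2 * t * real (Suc v) ^ 2)))"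
    by (intro tendsto_intros) simp
  define b where "b = (\<lambda>k p. if k < M p \<and> Suc k * L p \<le> M p then real (2 * M p choose (M p + Suc k * L p)) / real (2 * M p choose M p) else 0)"
  have "(\<lambda>p. \<Sum>k. b k p) \<longlonglongrightarrow> (\<Sum>k. exp (- (real (Suc k) ^ 2 / t)))"
  proof (rule conjunct2[OF conjunct2[OF tannerys_theorem]])
    have "norm (b k p) \<le> (4 * t) * inverse (real (Suc k) ^ 2)"
      if p: "real (M p) / real (L p) ^ 2 < 2 * t" for k p
    proof (cases "k < M p \<and> Suc k * L p \<le> M p")
      case True
      define r where "r = Suc k * L p"
      have r: "0 < r" "r \<le> M p" using True by (simp_all add: r_def L_def)
      have "norm (b k p) \<le> exp (- (real r)\<^sup>2 / real (M p + r))"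
        using binomial_ratio_bounds(1)[OF r(2)] True by (simp add: b_def r_def)
      also have "\<dots> = inverse (exp ((real r)\<^sup>2 / real (M p + r)))"
        by (simp add: exp_minus[symmetric])
      \<comment> \<open>The inequality exp(-y) <= 1/y trades the Gaussian for quadratic decay. Then
        r <= M bounds M + r by 2M, and the powers of \<open>L\<close> combine to M/L^2, which is
        below 2t.\<close>
      also have "\<dots> \<le> inverse ((real r)\<^sup>2 / real (M p + r))"
        using exp_ge_add_one_self[of "(real r)\<^sup>2 / real (M p + r)"] r
        by (intro le_imp_inverse_le) (linarith, simp)
      also have "\<dots> = real (M p + r) / (real r)\<^sup>2" by simp
      also have "\<dots> \<le> 2 * real (M p) / (real r)\<^sup>2"
        using r by (intro divide_right_mono) auto
      also have "\<dots> = 2 * (real (M p) / real (L p) ^ 2) * inverse (real (Suc k) ^ 2)"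
        unfolding r_def of_nat_mult power_mult_distrib by (simp add: field_simps del: of_nat_Suc)
      also have "\<dots> \<le> 2 * (2 * t) * inverse (real (Suc k) ^ 2)"
        using p by (intro mult_right_mono mult_left_mono) auto
      finally show ?thesis by simp
    qed (use t in \<open>auto simp: b_def\<close>)
    then show "eventually (\<lambda>(k, p). norm (b k p) \<le> (4 * t) * inverse (real (Suc k) ^ 2)) (at_top \<times>\<^sub>F sequentially)"
      unfolding eventually_prod_filter
      by (intro exI[of _ "\<lambda>_. True"] exI[of _ "\<lambda>p. t / 2 < real (M p) / real (L p) ^ 2 \<and> real (M p) / real (L p) ^ 2 < 2 * t"]) (use Mev in auto)
    show "summable (\<lambda>k. (4 * t) * inverse (real (Suc k) ^ 2))" by (rule summ)
    fix k
    have L0: "(\<lambda>p. real (Suc k) / real (L p)) \<longlonglongrightarrow> 0" "(\<lambda>p. 1 / real (L p) ^ 2) \<longlonglongrightarrow> 0"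
      unfolding L_def by real_asymp+
    have "(\<lambda>p. real (M p) / real (L p) ^ 2 - real (Suc k) / real (L p)) \<longlonglongrightarrow> t - 0"
      by (intro tendsto_intros Mlim L0)
    then have "eventually (\<lambda>p. real (M p) / real (L p) ^ 2 - real (Suc k) / real (L p) > 0) sequentially"
      using t by (intro order_tendstoD) auto
    then have ev: "eventually (\<lambda>p. Suc k * L p \<le> M p \<and> k < M p) sequentially"
    proof eventually_elim
      case (elim p)
      then have "real (Suc k * L p) < real (M p)"
        using Lpos[of p] unfolding of_nat_mult by (simp add: field_simps power2_eq_square del: of_nat_Suc)
      then have "Suc k * L p < M p" by (simp only: of_nat_less_iff)
      moreover have "Suc k \<le> Suc k * L p" by (simp add: L_def)
      ultimately show ?case by linarith
    qed
    \<comment> \<open>With r = (k+1)L the two bounds have the exponents -r^2/(M+1-r) and -r^2/(M+r).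
      Both tend to -(k+1)^2/t because r/L^2 tends to 0.\<close>
    show "(\<lambda>p. b k p) \<longlonglongrightarrow> exp (- (real (Suc k) ^ 2 / t))"
    proof (rule tendsto_sandwich)
      show "eventually (\<lambda>p. exp (- (real (Suc k * L p))\<^sup>2 / real (M p + 1 - Suc k * L p)) \<le> b k p) sequentially"
        using ev
      proof eventually_elim
        case (elim p)
        with binomial_ratio_bounds(2)[of "Suc k * L p" "M p"] show ?case
          by (simp add: b_def del: mult_Suc of_nat_mult of_nat_diff)
      qed
      show "eventually (\<lambda>p. b k p \<le> exp (- (real (Suc k * L p))\<^sup>2 / real (M p + Suc k * L p))) sequentially"
        using ev
      proof eventually_elim
        case (elim p)
        with binomial_ratio_bounds(1)[of "Suc k * L p" "M p"] show ?case
          by (simp add: b_def del: mult_Suc of_nat_mult)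
      qed
      have "(\<lambda>p. exp (- (real (Suc k) ^ 2 / (real (M p) / real (L p) ^ 2 + 1 / real (L p) ^ 2 - real (Suc k) / real (L p))))) \<longlonglongrightarrow> exp (- (real (Suc k) ^ 2 / (t + 0 - 0)))"
        using t by (intro tendsto_intros Mlim L0) auto
      moreover have "eventually (\<lambda>p. exp (- (real (Suc k) ^ 2 / (real (M p) / real (L p) ^ 2 + 1 / real (L p) ^ 2 - real (Suc k) / real (L p))))
          = exp (- (real (Suc k * L p))\<^sup>2 / real (M p + 1 - Suc k * L p))) sequentially"
        using ev
      proof eventually_elim
        case (elim p)
        have "real (M p) / real (L p) ^ 2 + 1 / real (L p) ^ 2 - real (Suc k) / real (L p) = real (M p + 1 - Suc k * L p) / real (L p) ^ 2"
          using elim Lpos[of p] by (simp add: of_nat_diff field_simps power2_eq_square)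
        then show ?case unfolding of_nat_mult power_mult_distrib by (simp del: of_nat_Suc mult_Suc of_nat_diff)
      qed
      ultimately have "(\<lambda>p. exp (- (real (Suc k * L p))\<^sup>2 / real (M p + 1 - Suc k * L p))) \<longlonglongrightarrow> exp (- (real (Suc k) ^ 2 / (t + 0 - 0)))"
        by (rule Lim_transform_eventually)
      then show "(\<lambda>p. exp (- (real (Suc k * L p))\<^sup>2 / real (M p + 1 - Suc k * L p))) \<longlonglongrightarrow> exp (- (real (Suc k) ^ 2 / t))"
        by simp
      have "(\<lambda>p. exp (- (real (Suc k) ^ 2 / (real (M p) / real (L p) ^ 2 + real (Suc k) / real (L p))))) \<longlonglongrightarrow> exp (- (real (Suc k) ^ 2 / (t + 0)))"
        using t by (intro tendsto_intros Mlim L0) auto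
      moreover have "exp (- (real (Suc k) ^ 2 / (real (M p) / real (L p) ^ 2 + real (Suc k) / real (L p))))
          = exp (- (real (Suc k * L p))\<^sup>2 / real (M p + Suc k * L p))" for p
      proof -
        have "real (M p) / real (L p) ^ 2 + real (Suc k) / real (L p) = real (M p + Suc k * L p) / real (L p) ^ 2"
          using Lpos[of p] by (simp add: field_simps power2_eq_square)
        then show ?thesis unfolding of_nat_mult power_mult_distrib by (simp del: of_nat_Suc mult_Suc)
      qed
      ultimately show "(\<lambda>p. exp (- (real (Suc k * L p))\<^sup>2 / real (M p + Suc k * L p))) \<longlonglongrightarrow> exp (- (real (Suc k) ^ 2 / t))"
        by simp
    qed
  qed simp
  moreover have "(\<Sum>k. b k p) = (\<Sum>k<M p. if Suc k * L p \<le> M p then real (2 * M p choose (M p + Suc k * L p)) / real (2 * M p choose M p) else 0)" for p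
    by (subst suminf_finite[of "{..<M p}"]) (auto simp: b_def intro!: sum.cong)
  ultimately have B: "(\<lambda>p. real (L p) * real (2 * M p choose M p) / 4 ^ M p *
      (1 + 2 * (\<Sum>k<M p. if Suc k * L p \<le> M p then real (2 * M p choose (M p + Suc k * L p)) / real (2 * M p choose M p) else 0)))
      \<longlonglongrightarrow> inverse (sqrt (pi * t)) * (1 + 2 * (\<Sum>k. exp (- (real (Suc k) ^ 2 / t))))"
    using wallis_sequence[OF t Mlim[unfolded L_def] Minf] unfolding L_def by (intro tendsto_intros) simp_all
  show ?thesis
    using A B unfolding L_def sum_cos_power_symmetric by (rule LIMSEQ_unique)
qed

section \<open>Theta functions on the upper half-plane\<close>

text \<open>Filling the gaps with zero coefficients gives an ordinary power series, from which
  holomorphy follows.\<close>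

lemma sums_powser_lacunary:
  fixes x :: complex
  assumes "strict_mono e" "norm x < 1"
  shows "(\<lambda>n. (if n \<in> range e then 1 else 0) * x ^ n) sums (\<Sum>n. x ^ e n)"
proof -
  have "(\<lambda>n. x ^ e n) sums (\<Sum>n. x ^ e n)"
    using assms(2) strict_mono_imp_increasing[OF assms(1)] by (intro summable_sums summable_lacunary) auto
  then have "(\<lambda>n. (if e n \<in> range e then 1 else 0) * x ^ e n) sums (\<Sum>n. x ^ e n)"
    by simp
  then show ?thesis
    by (subst (asm) sums_mono_reindex[OF assms(1)]) auto
qed

lemma holomorphic_lacunary:
  assumes "strict_mono (e :: nat \<Rightarrow> nat)"
  shows "(\<lambda>x::complex. \<Sum>n. x ^ e n) holomorphic_on ball 0 1"
  using sums_powser_lacunary[OF assms] by (intro power_series_holomorphic) auto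

lemma phi_holomorphic: "phi holomorphic_on ball 0 1"
proof -
  have "strict_mono (\<lambda>n. (Suc n)\<^sup>2)"
    by (intro strict_monoI power_strict_mono) auto
  from holomorphic_lacunary[OF this] show ?thesis
    unfolding phi_def by (intro holomorphic_intros)
qed

lemma psi_holomorphic: "psi holomorphic_on ball 0 1"
proof -
  have "strict_mono (\<lambda>n. Suc n choose 2)"
    unfolding strict_mono_Suc_iff by (auto simp: Suc_choose_two)
  from holomorphic_lacunary[OF this] show ?thesis
    unfolding psi_def .
qed

lemma phi_0 [simp]: "phi 0 = 1"
proof -
  have "(\<lambda>n. (0::complex) ^ (Suc n)\<^sup>2) = (\<lambda>_. 0)" by (simp add: fun_eq_iff)
  then show ?thesis unfolding phi_def by simp
qed

lemma psi_0 [simp]: "psi 0 = 1"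
proof -
  have "(\<lambda>n. (0::complex) ^ (Suc n choose 2)) = (\<lambda>n. if n = 0 then 1 else 0)"
    by (auto simp: fun_eq_iff Suc_choose_two numeral_2_eq_2 power_0_left)
  then show ?thesis
    unfolding psi_def using suminf_finite[of "{0}" "\<lambda>n. if n = 0 then 1 else (0::complex)"] by simp
qed

text \<open>The product formula excludes zeros away from x = 0, where the value is 1. This and
  \<open>psi_nonzero\<close> are why \<open>form_U\<close> and \<open>form_Z\<close> have no zeros
  in the half-plane.\<close>

lemma phi_nonzero: "norm x < 1 \<Longrightarrow> phi x \<noteq> 0"
  using phi_product[of x] euler_prod_nonzero[of x] euler_prod_nonzero[of "x\<^sup>2"] euler_prod_nonzero[of "x ^ 4"]
  by (cases "x = 0") (auto simp: norm_power power_less_one_iff)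

lemma psi_nonzero: "norm x < 1 \<Longrightarrow> psi x \<noteq> 0"
  using psi_product[of x] euler_prod_nonzero[of x] euler_prod_nonzero[of "x\<^sup>2"]
  by (cases "x = 0") (auto simp: norm_power power_less_one_iff)

text \<open>Odd squares are 8T + 1 with T triangular, even squares are 4n^2. The identity expresses
  the other two theta constants through \<open>th3\<close>.\<close>

lemma phi_bisect:
  assumes "norm x < 1"
  shows "phi x = phi (x ^ 4) + 2 * x * psi (x ^ 8)"
proof -
  let ?f = "\<lambda>n. x ^ (Suc n)\<^sup>2"
  have x4: "norm (x ^ 4) < 1" and x8: "norm (x ^ 8) < 1"
    using assms by (simp_all add: norm_power power_less_one_iff)
  have cs: "8 * (Suc n choose 2) + 1 = (2 * n + 1)\<^sup>2" for n :: nat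
    by (induction n) (auto simp: Suc_choose_two numeral_2_eq_2 algebra_simps)
  have "?f sums (\<Sum>n. ?f n)"
    by (intro summable_sums summable_lacunary assms le_Suc_power2)
  then have "(\<lambda>n. sum ?f {n * 2..<n * 2 + 2}) sums (\<Sum>n. ?f n)"
    by (rule sums_group) simp
  also have "(\<lambda>n. sum ?f {n * 2..<n * 2 + 2}) = (\<lambda>n. x * (x ^ 8) ^ (Suc n choose 2) + (x ^ 4) ^ (Suc n)\<^sup>2)"
  proof
    fix n :: nat
    have "{n * 2..<n * 2 + 2} = {n * 2, n * 2 + 1}" by auto
    then have "sum ?f {n * 2..<n * 2 + 2} = x ^ (2 * n + 1)\<^sup>2 + x ^ (2 * Suc n)\<^sup>2"
      by (simp add: mult.commute)
    also have "x ^ (2 * n + 1)\<^sup>2 = x * (x ^ 8) ^ (Suc n choose 2)"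
      unfolding cs[symmetric] by (simp add: power_mult)
    also have "x ^ (2 * Suc n)\<^sup>2 = (x ^ 4) ^ (Suc n)\<^sup>2"
      unfolding power_mult_distrib by (simp add: power_mult)
    finally show "sum ?f {n * 2..<n * 2 + 2} = x * (x ^ 8) ^ (Suc n choose 2) + (x ^ 4) ^ (Suc n)\<^sup>2" .
  qed
  finally have 1: "(\<lambda>n. x * (x ^ 8) ^ (Suc n choose 2) + (x ^ 4) ^ (Suc n)\<^sup>2) sums (\<Sum>n. ?f n)" .
  have "(\<lambda>n. x * (x ^ 8) ^ (Suc n choose 2) + (x ^ 4) ^ (Suc n)\<^sup>2) sums (x * psi (x ^ 8) + (\<Sum>n. (x ^ 4) ^ (Suc n)\<^sup>2))"
    unfolding psi_def
    by (intro sums_add sums_mult summable_sums summable_lacunary x4 x8 le_Suc_power2 le_Suc_choose_two)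
  from sums_unique2[OF 1 this] show ?thesis
    unfolding phi_def[of x] phi_def[of "x ^ 4"] by (simp add: algebra_simps)
qed

section \<open>Jacobi theta constants and their inversion\<close>

definition th2 :: "complex \<Rightarrow> complex"
  where "th2 s = 2 * exp (of_real pi * \<i> * s / 4) * psi (exp (2 * of_real pi * \<i> * s))"

definition th3 :: "complex \<Rightarrow> complex"
  where "th3 s = phi (exp (of_real pi * \<i> * s))"

definition th4 :: "complex \<Rightarrow> complex"
  where "th4 s = phi (- exp (of_real pi * \<i> * s))"

lemma norm_exp_pi_i: "norm (exp (of_real pi * \<i> * s)) = exp (- pi * Im s)"
  by (simp add: norm_exp_eq_Re)

lemma norm_exp_pi_i_less_1: "s \<in> uhp \<Longrightarrow> norm (exp (of_real pi * \<i> * s)) < 1"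
  unfolding norm_exp_pi_i uhp_def by simp

lemma norm_exp_2pi_i_less_1: "s \<in> uhp \<Longrightarrow> norm (exp (2 * of_real pi * \<i> * s)) < 1"
  by (simp add: norm_exp_eq_Re uhp_def)

lemma exp_of_pi_i: "exp (of_real pi * \<i>) = -1"
  by (metis exp_pi_i mult.commute)

lemma th3_plus_1: "th3 (s + 1) = th4 s"
  by (simp add: th3_def th4_def distrib_left exp_add exp_of_pi_i)

lemma th4_plus_1: "th4 (s + 1) = th3 s"
  by (simp add: th3_def th4_def distrib_left exp_add exp_of_pi_i)

text \<open>Translation multiplies \<open>th2\<close> by an eighth root of unity, coming from the
  prefactor exp(pi i s/4); squaring turns it into the factor i.\<close>

lemma th2_plus_1: "th2 (s + 1) ^ 2 = \<i> * th2 s ^ 2"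
proof -
  have "exp (2 * of_real pi * \<i> * (s + 1)) = exp (2 * of_real pi * \<i> * s)"
    by (simp add: distrib_left exp_add exp_two_pi_i[unfolded mult.commute[of "2::complex"]] mult_ac)
  moreover have "exp (of_real pi * \<i> * (s + 1) / 4) ^ 2 = \<i> * exp (of_real pi * \<i> * s / 4) ^ 2"
  proof -
    have "exp (of_real pi * \<i> * (s + 1) / 4) ^ 2 = exp (of_real pi * \<i> * s / 4) ^ 2 * exp (\<i> * of_real (pi / 2))"
      by (simp add: power2_eq_square distrib_left add_divide_distrib ac_simps flip: exp_add)
    moreover have "exp (\<i> * of_real (pi / 2)) = \<i>"
      by (simp only: cis_conv_exp[symmetric] cis_pi_half)
    ultimately show ?thesis by simp
  qed
  ultimately show ?thesis by (simp add: th2_def power_mult_distrib)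
qed

text \<open>\<open>phi_bisect\<close> at x = exp(pi i s/4), where x^4 and x^8 are the arguments of
  \<open>th3 s\<close> and of the series in \<open>th2 s\<close>.\<close>

lemma th2_conv_th3:
  assumes "s \<in> uhp"
  shows "th2 s = th3 (s / 4) - th3 s"
proof -
  let ?x = "exp (of_real pi * \<i> * (s / 4))"
  have "norm ?x < 1" using assms by (intro norm_exp_pi_i_less_1) (simp add: uhp_def)
  from phi_bisect[OF this] have "phi ?x = phi (?x ^ 4) + 2 * ?x * psi (?x ^ 8)" .
  moreover have "?x ^ 4 = exp (of_real pi * \<i> * s)" "?x ^ 8 = exp (2 * of_real pi * \<i> * s)"
    by (simp_all add: mult_ac flip: exp_of_nat_mult)
  ultimately show ?thesis by (simp add: th2_def th3_def)
qed

text \<open>Adding \<open>phi_bisect\<close> at x and at -x cancels the odd part.\<close>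

lemma th4_conv_th3:
  assumes "s \<in> uhp"
  shows "th4 s = 2 * th3 (4 * s) - th3 s"
proof -
  let ?x = "exp (of_real pi * \<i> * s)"
  have "norm ?x < 1" using assms by (rule norm_exp_pi_i_less_1)
  then have "phi ?x + phi (- ?x) = 2 * phi (?x ^ 4)"
    using phi_bisect[of ?x] phi_bisect[of "- ?x"] by simp
  moreover have "?x ^ 4 = exp (of_real pi * \<i> * (4 * s))"
    by (simp flip: exp_of_nat_mult add: mult_ac)
  ultimately show ?thesis by (simp add: th4_def th3_def algebra_simps)
qed

lemma th3_imaginary:
  assumes "y > 0"
  shows "th3 (\<i> * of_real y) = of_real (1 + 2 * (\<Sum>n. exp (- (pi * y * real (Suc n) ^ 2))))"
proof -
  have e: "exp (of_real pi * \<i> * (\<i> * of_real y)) = complex_of_real (exp (- (pi * y)))"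
    by (simp add: algebra_simps exp_of_real[symmetric])
  have s: "summable (\<lambda>n. exp (- (pi * y)) ^ (Suc n)\<^sup>2)"
    using assms by (intro summable_lacunary le_Suc_power2) simp
  have "exp (- (pi * y)) ^ (Suc n)\<^sup>2 = exp (- (pi * y * real (Suc n) ^ 2))" for n
    by (simp add: mult_ac flip: exp_of_nat_mult)
  then have "(\<Sum>n. exp (- (pi * y * real (Suc n) ^ 2))) = (\<Sum>n. exp (- (pi * y)) ^ (Suc n)\<^sup>2)"
    by simp
  then show ?thesis
    unfolding th3_def e phi_def by (simp add: suminf_of_real[OF s] flip: of_real_power)
qed

lemma th3_inversion_imaginary:
  assumes "y > 0"
  shows "th3 (\<i> / of_real y) = of_real (sqrt y) * th3 (\<i> * of_real y)"
proof -
  \<comment> \<open>The choice t = y/pi makes pi^2 t = pi y, 1/t = pi/y and pi t = y.\<close>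
  have "1 + 2 * (\<Sum>v. exp (- (pi * y * real (Suc v) ^ 2)))
       = inverse (sqrt y) * (1 + 2 * (\<Sum>k. exp (- (pi * inverse y * real (Suc k) ^ 2))))"
    using gaussian_theta_inversion[of "y / pi"] assms
    by (simp add: power2_eq_square divide_inverse mult_ac del: of_nat_Suc)
  then have "complex_of_real (1 + 2 * (\<Sum>k. exp (- (pi * inverse y * real (Suc k) ^ 2))))
      = of_real (sqrt y * (1 + 2 * (\<Sum>v. exp (- (pi * y * real (Suc v) ^ 2)))))"
    using assms by (simp del: of_nat_Suc)
  then show ?thesis
    using th3_imaginary[OF assms] th3_imaginary[of "inverse y"] assms
    by (simp add: divide_inverse)
qed

lemma open_uhp: "open uhp"
  unfolding uhp_def by (simp add: open_halfspace_Im_gt)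

lemma connected_uhp: "connected uhp"
  unfolding uhp_def by (intro convex_connected convex_halfspace_Im_gt)

lemma th3_holomorphic: "th3 holomorphic_on uhp"
  unfolding th3_def
  by (rule holomorphic_on_compose_gen[OF _ phi_holomorphic, unfolded o_def])
     (auto intro!: holomorphic_intros simp: norm_exp_pi_i_less_1 simp del: norm_exp_eq_Re)

lemma th2_holomorphic: "th2 holomorphic_on uhp"
proof -
  have "(\<lambda>s. psi (exp (2 * of_real pi * \<i> * s))) holomorphic_on uhp"
    by (rule holomorphic_on_compose_gen[OF _ psi_holomorphic, unfolded o_def])
       (auto intro!: holomorphic_intros simp: norm_exp_2pi_i_less_1 simp del: norm_exp_eq_Re)
  then show ?thesis unfolding th2_def by (intro holomorphic_intros) auto
qed

lemma uhp_nonzero: "s \<in> uhp \<Longrightarrow> s \<noteq> 0"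
  by (auto simp: uhp_def)

lemma zero_notin_uhp [simp]: "0 \<notin> uhp"
  by (simp add: uhp_def)

lemma uhp_inversion: "s \<in> uhp \<Longrightarrow> - 1 / s \<in> uhp"
  using complex_neq_0[of s] by (auto simp: uhp_def Im_divide divide_neg_pos)

text \<open>The law on the imaginary axis extends by the identity theorem. For \<open>s\<close> in
  the upper half-plane -is has positive real part, so the principal square root is holomorphic
  there.\<close>

theorem th3_inversion:
  assumes "s \<in> uhp"
  shows "th3 (- 1 / s) = csqrt (- \<i> * s) * th3 s"
proof -
  let ?h = "\<lambda>s. th3 (- 1 / s) - csqrt (- \<i> * s) * th3 s"
  have "?h s = 0"
  proof (rule analytic_continuation[of ?h uhp "(\<lambda>y. \<i> * of_real y) ` {0<..}" \<i>])
    have "(\<lambda>s. th3 (- 1 / s)) holomorphic_on uhp"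
      by (rule holomorphic_on_compose_gen[OF _ th3_holomorphic, unfolded o_def])
         (auto intro!: holomorphic_intros uhp_inversion[simplified] dest: uhp_nonzero)
    moreover have "(\<lambda>s. csqrt (- \<i> * s)) holomorphic_on uhp"
      by (intro holomorphic_intros) (auto simp: uhp_def complex_nonpos_Reals_iff)
    ultimately show "?h holomorphic_on uhp"
      by (intro holomorphic_on_diff holomorphic_on_mult th3_holomorphic)
    show "\<i> islimpt (\<lambda>y. \<i> * of_real y) ` {0<..}"
      unfolding islimpt_approachable
    proof (intro allI impI)
      fix e :: real assume "e > 0"
      then show "\<exists>x'\<in>(\<lambda>y. \<i> * of_real y) ` {0<..}. x' \<noteq> \<i> \<and> dist x' \<i> < e"
        by (intro bexI[of _ "\<i> * of_real (1 + e / 2)"] imageI)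
           (auto simp: dist_norm algebra_simps norm_mult)
    qed
    fix z assume "z \<in> (\<lambda>y. \<i> * of_real y) ` {0<..}"
    then obtain y where y: "y > 0" "z = \<i> * of_real y" by auto
    have eq1: "- 1 / z = \<i> / of_real y" using y by (simp add: field_simps)
    have "- \<i> * z = of_real y" using y by (simp add: field_simps)
    then have eq2: "csqrt (- \<i> * z) = of_real (sqrt y)"
      using y(1) by (simp only: csqrt_of_real less_imp_le)
    have "th3 (- 1 / z) = of_real (sqrt y) * th3 (\<i> * of_real y)"
      unfolding eq1 by (rule th3_inversion_imaginary[OF y(1)])
    then have "th3 (- 1 / z) = csqrt (- \<i> * z) * th3 z"
      by (simp only: eq2 y(2)[symmetric])
    then show "?h z = 0" by (simp only: diff_self)
  qed (use assms open_uhp connected_uhp in \<open>auto simp: uhp_def\<close>)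
  then show ?thesis by simp
qed

lemma th3_sq_inversion: "s \<in> uhp \<Longrightarrow> th3 (- 1 / s) ^ 2 = - \<i> * s * th3 s ^ 2"
  unfolding th3_inversion power_mult_distrib by simp

text \<open>Writing th2(-1/s) as th3(-1/(4s)) - th3(-1/s) and inverting both terms leaves the common
  root times 2 th3(4s) - th3(s), which is th4(s).\<close>

lemma th2_sq_inversion:
  assumes "s \<in> uhp"
  shows "th2 (- 1 / s) ^ 2 = - \<i> * s * th4 s ^ 2"
proof -
  have s4: "4 * s \<in> uhp" using assms by (simp add: uhp_def)
  have csq: "csqrt (- \<i> * (4 * s)) = 2 * csqrt (- \<i> * s)"
    using csqrt_principal[of "- \<i> * s"]
    by (intro csqrt_unique) (auto simp: power_mult_distrib simp del: csqrt.simps)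
  have "th2 (- 1 / s) = th3 (- 1 / (4 * s)) - th3 (- 1 / s)"
    using th2_conv_th3[OF uhp_inversion[OF assms]] by (simp add: mult.commute)
  also have "\<dots> = csqrt (- \<i> * s) * th4 s"
    unfolding th3_inversion[OF s4] th3_inversion[OF assms] th4_conv_th3[OF assms]
    using csq by (simp add: algebra_simps)
  finally show ?thesis by (simp add: power_mult_distrib)
qed

section \<open>The congruence subgroups\<close>

lemma th4_sq_inversion:
  assumes "s \<in> uhp"
  shows "th4 (- 1 / s) ^ 2 = - \<i> * s * th2 s ^ 2"
proof -
  have "- 1 / (- 1 / s) = s" by simp
  then have "th2 s ^ 2 = - \<i> * (- 1 / s) * th4 (- 1 / s) ^ 2"
    using th2_sq_inversion[OF uhp_inversion[OF assms]] by metis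
  moreover have "s \<noteq> 0" using assms by auto
  ultimately show ?thesis by (simp add: field_simps)
qed

section \<open>Transformation laws under the group of matrices with even off-diagonal
  entries\<close>

definition sgn_parity :: "int \<Rightarrow> complex"
  where "sgn_parity n = (if even n then 1 else -1)"

lemma sgn_parity_add: "sgn_parity (m + n) = sgn_parity m * sgn_parity n"
  by (auto simp: sgn_parity_def)

lemma sgn_parity_mult_odd: "odd a \<Longrightarrow> sgn_parity (j * a) = sgn_parity j"
  by (auto simp: sgn_parity_def)

lemma th3_plus_even: "th3 (s + 2 * of_int j) = th3 s"
proof -
  have "exp (of_real pi * \<i> * (s + 2 * of_int j)) = exp (of_real pi * \<i> * s) * exp ((2 * of_int j * pi) * \<i>)"
    by (simp add: algebra_simps exp_add)
  also have "exp ((2 * of_int j * pi) * \<i>) = 1" by (rule exp_integer_2pi) auto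
  finally show ?thesis by (simp add: th3_def)
qed

lemma th4_plus_even: "th4 (s + 2 * of_int j) = th4 s"
  using th3_plus_even[of "s + 1" j] by (simp add: th3_plus_1[symmetric] ac_simps)

lemma th2_sq_plus_even: "th2 (s + 2 * of_int j) ^ 2 = sgn_parity j * th2 s ^ 2"
proof (induction j arbitrary: s rule: int_induct[where k = 0])
  case (step1 j)
  have "th2 (s + 2 * of_int (j + 1)) ^ 2 = th2 ((s + 2 * of_int j + 1) + 1) ^ 2"
    by (simp add: algebra_simps)
  also have "\<dots> = \<i> * (\<i> * th2 (s + 2 * of_int j) ^ 2)" by (simp only: th2_plus_1)
  finally show ?case using step1 by (simp add: sgn_parity_add) (simp add: sgn_parity_def)
next
  case (step2 j)
  have "th2 (s + 2 * of_int j) ^ 2 = th2 ((s + 2 * of_int (j - 1) + 1) + 1) ^ 2"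
    by (simp add: algebra_simps)
  also have "\<dots> = \<i> * (\<i> * th2 (s + 2 * of_int (j - 1)) ^ 2)" by (simp only: th2_plus_1)
  finally have "th2 (s + 2 * of_int (j - 1)) ^ 2 = - (th2 (s + 2 * of_int j) ^ 2)"
    by (simp add: mult.assoc[symmetric])
  then show ?case using step2 by (auto simp: sgn_parity_def)
qed (simp add: sgn_parity_def)

lemma Im_moebius:
  fixes a b c d :: int
  assumes "a * d - b * c = 1" "s \<in> uhp"
  shows "of_int c * s + of_int d \<noteq> (0 :: complex)"
    and "Im (moebius_act (a, b, c, d) s) = Im s / norm (of_int c * s + of_int d) ^ 2"
    and "moebius_act (a, b, c, d) s \<in> uhp"
proof -
  show nz: "of_int c * s + of_int d \<noteq> (0 :: complex)"
  proof
    assume eq: "of_int c * s + of_int d = (0 :: complex)"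
    then have "Im (of_int c * s + of_int d) = 0" by simp
    then have "c = 0" using assms(2) by (simp add: uhp_def)
    with eq assms(1) show False by auto
  qed
  have r: "real_of_int a * real_of_int d - real_of_int b * real_of_int c = 1"
    using assms(1) by (metis of_int_1 of_int_diff of_int_mult)
  have "Im (moebius_act (a, b, c, d) s)
      = Im ((of_int a * s + of_int b) * cnj (of_int c * s + of_int d)) / norm (of_int c * s + of_int d) ^ 2"
    unfolding moebius_act.simps by (subst complex_div_cnj) (simp only: Im_divide_of_real flip: of_real_power)
  also have "Im ((of_int a * s + of_int b) * cnj (of_int c * s + of_int d))
      = (real_of_int a * real_of_int d - real_of_int b * real_of_int c) * Im s"
    by (simp add: algebra_simps)
  finally show im: "Im (moebius_act (a, b, c, d) s) = Im s / norm (of_int c * s + of_int d) ^ 2"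
    by (simp add: r)
  show "moebius_act (a, b, c, d) s \<in> uhp"
    using assms(2) nz im by (simp add: uhp_def)
qed

text \<open>The lower unipotent matrix is the conjugate of an even translation by the inversion.
  Squared, \<open>th2\<close> becomes \<open>th4\<close> under inversion, and \<open>th4\<close> is
  invariant under even translations; therefore no sign appears, in contrast to
  \<open>th2_sq_plus_even\<close>.\<close>

lemma theta_V:
  fixes i :: int
  assumes "s \<in> uhp"
  defines "v \<equiv> s / (2 * of_int i * s + 1)"
  shows "v \<in> uhp" "2 * of_int i * s + 1 \<noteq> 0"
    "th3 v ^ 2 = (2 * of_int i * s + 1) * th3 s ^ 2"
    "th2 v ^ 2 = (2 * of_int i * s + 1) * th2 s ^ 2"
proof -
  define w where "w = - 1 / s + 2 * of_int (- i)"
  have s0: "s \<noteq> 0" using assms by auto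
  have u: "- 1 / s \<in> uhp" using assms(1) by (rule uhp_inversion)
  then have w: "w \<in> uhp" by (simp add: w_def uhp_def)
  then have w0: "w \<noteq> 0" by auto
  have ws: "w * s = - (2 * of_int i * s + 1)" using s0 by (simp add: w_def field_simps)
  with w0 s0 show nz: "2 * of_int i * s + 1 \<noteq> 0" by (metis mult_eq_0_iff neg_equal_0_iff_equal)
  have v: "v = - 1 / w"
    unfolding v_def using w0 s0 nz ws by (simp add: field_simps)
  show "v \<in> uhp" unfolding v by (rule uhp_inversion[OF w])
  have "th3 v ^ 2 = - \<i> * w * th3 (- 1 / s) ^ 2"
    unfolding v th3_sq_inversion[OF w] unfolding w_def th3_plus_even ..
  also have "\<dots> = - (w * s) * th3 s ^ 2"
    unfolding th3_sq_inversion[OF assms(1)] by (simp add: algebra_simps)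
  finally show "th3 v ^ 2 = (2 * of_int i * s + 1) * th3 s ^ 2" by (simp add: ws)
  have "th2 v ^ 2 = - \<i> * w * th4 (- 1 / s) ^ 2"
    unfolding v th2_sq_inversion[OF w] unfolding w_def th4_plus_even ..
  also have "\<dots> = - (w * s) * th2 s ^ 2"
    unfolding th4_sq_inversion[OF assms(1)] by (simp add: algebra_simps)
  finally show "th2 v ^ 2 = (2 * of_int i * s + 1) * th2 s ^ 2" by (simp add: ws)
qed

text \<open>The law is a predicate of the matrix so that it can be carried along multiplication by
  generators. Besides the character of \<open>d\<close>, the square of \<open>th2\<close> picks up
  the sign (-1)^(b/2).\<close>

definition Gamma2_law :: "int \<Rightarrow> int \<Rightarrow> int \<Rightarrow> int \<Rightarrow> bool"
  where "Gamma2_law a b c d \<longleftrightarrow> (\<forall>s\<in>uhp.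
    th3 (moebius_act (a, b, c, d) s) ^ 2 = chi_minus4 d * (of_int c * s + of_int d) * th3 s ^ 2 \<and>
    th2 (moebius_act (a, b, c, d) s) ^ 2
      = chi_minus4 d * sgn_parity (b div 2) * (of_int c * s + of_int d) * th2 s ^ 2)"

lemma chi_minus4_add_4: "chi_minus4 (d + 4 * n) = chi_minus4 d"
proof -
  have "(d + 4 * n) mod 4 = d mod 4" by simp
  then show ?thesis by (simp add: chi_minus4_def)
qed

text \<open>Right multiplication by the translation by 2j. As \<open>c\<close> is even,
  \<open>d\<close> keeps its class modulo 4; as \<open>a\<close> is odd, b/2 changes parity exactly
  as \<open>j\<close> does.\<close>

lemma Gamma2_law_T:
  assumes law: "Gamma2_law a b c d" and "even b" "even c" "a * d - b * c = 1"
  shows "Gamma2_law a (b + 2 * j * a) c (d + 2 * j * c)"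
  unfolding Gamma2_law_def
proof (intro ballI)
  fix s assume s: "s \<in> uhp"
  let ?s = "s + 2 * of_int j"
  have s': "?s \<in> uhp" using s by (simp add: uhp_def)
  have m: "moebius_act (a, b + 2 * j * a, c, d + 2 * j * c) s = moebius_act (a, b, c, d) ?s"
    by (simp add: algebra_simps)
  have "odd a"
  proof
    assume "even a"
    then have "even (a * d - b * c)" using \<open>even b\<close> by simp
    then show False using assms(4) by simp
  qed
  obtain c' where "c = 2 * c'" using \<open>even c\<close> by auto
  then have chi: "chi_minus4 (d + 2 * j * c) = chi_minus4 d"
    using chi_minus4_add_4[of d "j * c'"] by (simp add: mult_ac)
  have "(b + 2 * j * a) div 2 = b div 2 + j * a" using \<open>even b\<close> by auto
  then have par: "sgn_parity ((b + 2 * j * a) div 2) = sgn_parity (b div 2) * sgn_parity j"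
    using \<open>odd a\<close> by (simp add: sgn_parity_add sgn_parity_mult_odd)
  have j: "of_int c * s + of_int (d + 2 * j * c) = of_int c * ?s + (of_int d :: complex)"
    by (simp add: algebra_simps)
  show "th3 (moebius_act (a, b + 2 * j * a, c, d + 2 * j * c) s) ^ 2
      = chi_minus4 (d + 2 * j * c) * (of_int c * s + of_int (d + 2 * j * c)) * th3 s ^ 2 \<and>
    th2 (moebius_act (a, b + 2 * j * a, c, d + 2 * j * c) s) ^ 2
      = chi_minus4 (d + 2 * j * c) * sgn_parity ((b + 2 * j * a) div 2) * (of_int c * s + of_int (d + 2 * j * c)) * th2 s ^ 2"
    unfolding m chi par j
    using law[unfolded Gamma2_law_def, rule_format, OF s'] by (simp add: th3_plus_even th2_sq_plus_even)
qed

text \<open>Right multiplication by a lower unipotent matrix. It leaves \<open>b\<close> and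
  \<open>d\<close> alone, hence both characters, and the automorphy factors multiply.\<close>

lemma Gamma2_law_V:
  assumes law: "Gamma2_law a b c d"
  shows "Gamma2_law (a + 2 * i * b) b (c + 2 * i * d) d"
  unfolding Gamma2_law_def
proof (intro ballI)
  fix s assume s: "s \<in> uhp"
  define v where "v = s / (2 * of_int i * s + 1)"
  define n where "n = 2 * of_int i * s + 1"
  note V = theta_V[OF s, of i, folded v_def, folded n_def]
  have vn: "v * n = s" using V(2) by (simp add: v_def n_def)
  have eqs: "of_int (a + 2 * i * b) * s + of_int b = (of_int a * v + of_int b) * n"
    "of_int (c + 2 * i * d) * s + of_int d = (of_int c * v + of_int d) * n"
    unfolding distrib_right mult.assoc vn by (simp_all add: n_def algebra_simps)
  have m: "moebius_act (a + 2 * i * b, b, c + 2 * i * d, d) s = moebius_act (a, b, c, d) v"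
    using V(2) by (simp only: moebius_act.simps eqs) simp
  show "th3 (moebius_act (a + 2 * i * b, b, c + 2 * i * d, d) s) ^ 2
      = chi_minus4 d * (of_int (c + 2 * i * d) * s + of_int d) * th3 s ^ 2 \<and>
    th2 (moebius_act (a + 2 * i * b, b, c + 2 * i * d, d) s) ^ 2
      = chi_minus4 d * sgn_parity (b div 2) * (of_int (c + 2 * i * d) * s + of_int d) * th2 s ^ 2"
    unfolding m eqs
    using law[unfolded Gamma2_law_def, rule_format, OF V(1)] V(3,4) by simp
qed

text \<open>Division with remainder of least absolute value modulo 2|c|; the factor
  \<open>sgn c\<close> in the witness converts |c| into \<open>c\<close>.\<close>

lemma even_reduction:
  fixes c d :: int
  assumes "c \<noteq> 0"
  obtains j where "\<bar>d + 2 * j * c\<bar> \<le> \<bar>c\<bar>"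
proof -
  define r where "r = d mod (2 * \<bar>c\<bar>)"
  have r: "0 \<le> r" "r < 2 * \<bar>c\<bar>" using assms by (simp_all add: r_def)
  define q where "q = d div (2 * \<bar>c\<bar>)"
  have d: "d = 2 * \<bar>c\<bar> * q + r" by (simp add: q_def r_def)
  show ?thesis
  proof (cases "r \<le> \<bar>c\<bar>")
    case True
    have "d + 2 * (- q * sgn c) * c = r" unfolding d by (simp add: abs_sgn mult_ac)
    then show ?thesis using that[of "- q * sgn c"] r True by simp
  next
    case False
    have "d + 2 * (- (q + 1) * sgn c) * c = r - 2 * \<bar>c\<bar>" unfolding d by (simp add: abs_sgn algebra_simps)
    then show ?thesis using that[of "- (q + 1) * sgn c"] r False by simp
  qed
qed

text \<open>The group \<open>\<Gamma>(2)\<close> is generated by \<open>-1\<close> and the two unipotent matrices of the preceding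
  lemmas: the Euclidean algorithm with even quotients, applied to the bottom row, strictly
  decreases because its entries have different parity.\<close>

lemma Gamma2_law:
  assumes "a * d - b * c = 1" "even b" "even c"
  shows "Gamma2_law a b c d"
  using assms
proof (induction "nat \<bar>c\<bar>" arbitrary: a b c d rule: less_induct)
  case less
  show ?case
  proof (cases "c = 0")
    case True
    then have "a * d = 1" using less.prems by simp
    \<comment> \<open>In the case a = d = -1 the map is translation by -b, b/2 keeps its parity
      under negation, and the character value -1 cancels against the automorphy factor -1.\<close>
    then have "a = 1 \<and> d = 1 \<or> a = -1 \<and> d = -1" by (simp add: zmult_eq_1_iff)
    moreover obtain b' where b': "b = 2 * b'" using less.prems by auto
    moreover have "sgn_parity (- b') = sgn_parity b'" by (simp add: sgn_parity_def)
    ultimately show ?thesis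
      using th3_plus_even[of _ b'] th2_sq_plus_even[of _ b'] th3_plus_even[of _ "- b'"] th2_sq_plus_even[of _ "- b'"]
      by (auto simp: Gamma2_law_def True chi_minus4_def)
  next
    case False
    obtain j where j: "\<bar>d + 2 * j * c\<bar> \<le> \<bar>c\<bar>" using even_reduction[OF False] .
    define d' where "d' = d + 2 * j * c"
    define b' where "b' = b + 2 * j * a"
    have "odd d"
    proof
      assume "even d"
      then have "even (a * d - b * c)" using less.prems(2) by simp
      with less.prems(1) show False by (metis odd_one)
    qed
    then have d'_odd: "odd d'" using less.prems by (simp add: d'_def)
    then have d': "d' \<noteq> 0" "\<bar>d'\<bar> < \<bar>c\<bar>"
      using j less.prems(3) d'_odd unfolding d'_def[symmetric] by (auto simp: le_less) (metis dvd_abs_iff)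
    have det': "a * d' - b' * c = 1" using less.prems by (simp add: d'_def b'_def algebra_simps)
    obtain i where i: "\<bar>c + 2 * i * d'\<bar> \<le> \<bar>d'\<bar>" using even_reduction[OF d'(1)] .
    define c' where "c' = c + 2 * i * d'"
    define a' where "a' = a + 2 * i * b'"
    have "Gamma2_law a' b' c' d'"
    proof (rule less.hyps)
      show "nat \<bar>c'\<bar> < nat \<bar>c\<bar>" using i d' False by (simp add: c'_def)
      show "a' * d' - b' * c' = 1" using det' by (simp add: a'_def c'_def algebra_simps)
      show "even b'" "even c'" using less.prems by (simp_all add: b'_def c'_def)
    qed
    from Gamma2_law_V[OF this, of "- i"] have "Gamma2_law a b' c d'"
      by (simp add: a'_def c'_def)
    moreover have "even b'" using less.prems by (simp add: b'_def)
    ultimately have "Gamma2_law a (b' + 2 * (- j) * a) c (d' + 2 * (- j) * c)"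
      using less.prems det' by (intro Gamma2_law_T) auto
    then show ?thesis by (simp add: b'_def d'_def)
  qed
qed

section \<open>The weight one forms and their behaviour at the cusps\<close>

definition form_U :: "complex \<Rightarrow> complex"
  where "form_U \<tau> = (if \<tau> \<in> uhp then th3 (4 * \<tau>) ^ 2 else 0)"

text \<open>The factor 1/4 normalises the expansion to begin with q. The value 0 off the half-plane
  agrees with the representation of modular forms.\<close>

definition form_Z :: "complex \<Rightarrow> complex"
  where "form_Z \<tau> = (if \<tau> \<in> uhp then th2 (4 * \<tau>) ^ 2 / 4 else 0)"

text \<open>Scaling by 4 conjugates a matrix with c = 8e to one with off-diagonal entries 4b and 2e.
  The sign of \<open>th2\<close> disappears because half of 4b is even.\<close>

lemma UZ_Gamma0_8:
  assumes "(a, b, c, d) \<in> Gamma0 8" "\<tau> \<in> uhp"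
  shows "form_U (moebius_act (a, b, c, d) \<tau>) = chi_minus4 d * (of_int c * \<tau> + of_int d) * form_U \<tau>"
    and "form_Z (moebius_act (a, b, c, d) \<tau>) = chi_minus4 d * (of_int c * \<tau> + of_int d) * form_Z \<tau>"
proof -
  from assms obtain e where e: "c = 8 * e" and det: "a * d - b * c = 1"
    by (auto simp: Gamma0_def)
  have t: "4 * \<tau> \<in> uhp" using assms by (simp add: uhp_def)
  have "Gamma2_law a (4 * b) (2 * e) d"
    using det by (intro Gamma2_law) (auto simp: e)
  note L = this[unfolded Gamma2_law_def, rule_format, OF t]
  have m: "moebius_act (a, 4 * b, 2 * e, d) (4 * \<tau>) = 4 * moebius_act (a, b, c, d) \<tau>"
    by (simp add: e algebra_simps)
  have p: "sgn_parity (4 * b div 2) = 1" by (simp add: sgn_parity_def)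
  have j: "of_int (2 * e) * (4 * \<tau>) + of_int d = of_int c * \<tau> + (of_int d :: complex)"
    by (simp add: e)
  have i: "moebius_act (a, b, c, d) \<tau> \<in> uhp" using Im_moebius(3)[OF det assms(2)] .
  show "form_U (moebius_act (a, b, c, d) \<tau>) = chi_minus4 d * (of_int c * \<tau> + of_int d) * form_U \<tau>"
    and "form_Z (moebius_act (a, b, c, d) \<tau>) = chi_minus4 d * (of_int c * \<tau> + of_int d) * form_Z \<tau>"
    using L unfolding m p j form_U_def form_Z_def if_P[OF i] if_P[OF assms(2)] by simp_all
qed

lemma UZ_S:
  assumes "\<tau> \<in> uhp"
  shows "form_U (- 1 / \<tau>) = \<tau> * (- \<i> / 4 * th3 (\<tau> / 4) ^ 2)"
    and "form_Z (- 1 / \<tau>) = \<tau> * (- \<i> / 16 * th4 (\<tau> / 4) ^ 2)"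
proof -
  have t: "\<tau> / 4 \<in> uhp" using assms by (simp add: uhp_def)
  have e: "4 * (- 1 / \<tau>) = - 1 / (\<tau> / 4)" by simp
  show "form_U (- 1 / \<tau>) = \<tau> * (- \<i> / 4 * th3 (\<tau> / 4) ^ 2)"
    unfolding form_U_def if_P[OF uhp_inversion[OF assms]] e th3_sq_inversion[OF t] by simp
  show "form_Z (- 1 / \<tau>) = \<tau> * (- \<i> / 16 * th4 (\<tau> / 4) ^ 2)"
    unfolding form_Z_def if_P[OF uhp_inversion[OF assms]] e th2_sq_inversion[OF t] by simp
qed

lemma UZ_plus_half:
  assumes "\<tau> \<in> uhp"
  shows "form_U (\<tau> + 1 / 2) = form_U \<tau>" "form_Z (\<tau> + 1 / 2) = - form_Z \<tau>"
proof -
  have i: "\<tau> + 1 / 2 \<in> uhp" using assms by (simp add: uhp_def)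
  have e: "4 * (\<tau> + 1 / 2) = 4 * \<tau> + 2 * of_int 1" by simp
  show "form_U (\<tau> + 1 / 2) = form_U \<tau>"
    unfolding form_U_def if_P[OF assms] if_P[OF i] e th3_plus_even ..
  show "form_Z (\<tau> + 1 / 2) = - form_Z \<tau>"
    unfolding form_Z_def if_P[OF assms] if_P[OF i] e th2_sq_plus_even by (simp add: sgn_parity_def)
qed

text \<open>The cusp \<open>1/2\<close> is the image of the cusp \<open>0\<close> under the translation by \<open>1/2\<close>.\<close>

lemma UZ_cusp_half:
  assumes "\<tau> \<in> uhp"
  shows "form_U (moebius_act (1, 0, 2, 1) \<tau>) = (2 * \<tau> + 1) * (- \<i> / 2 * th3 (\<tau> + 1 / 2) ^ 2)"
    and "form_Z (moebius_act (1, 0, 2, 1) \<tau>) = (2 * \<tau> + 1) * (\<i> / 8 * th4 (\<tau> + 1 / 2) ^ 2)"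
proof -
  \<comment> \<open>With this s one has \<tau>/(2\<tau>+1) = 1/2 - 1/s, and s = 2(2\<tau>+1)
    supplies the automorphy factor together with an extra 2.\<close>
  define s where "s = 4 * \<tau> + 2"
  have s: "s \<in> uhp" using assms by (simp add: s_def uhp_def)
  note s' = uhp_inversion[OF s]
  have s4: "s / 4 = \<tau> + 1 / 2" by (simp add: s_def add_divide_distrib)
  have nz: "2 * \<tau> + 1 \<noteq> 0" using Im_moebius(1)[of 1 1 0 2 \<tau>] assms by simp
  have s0: "s \<noteq> 0" using s by auto
  have s2: "s = 2 * (2 * \<tau> + 1)" by (simp add: s_def)
  have m: "moebius_act (1, 0, 2, 1) \<tau> = - 1 / s + 1 / 2"
  proof -
    have "moebius_act (1, 0, 2, 1) \<tau> = \<tau> / (2 * \<tau> + 1)" by simp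
    also have "\<dots> = (4 * \<tau>) / (4 * (2 * \<tau> + 1))"
      by (rule mult_divide_mult_cancel_left[symmetric]) simp
    also have "\<dots> = (s - 2) / (2 * s)" by (simp add: s_def)
    also have "\<dots> = - 1 / s + 1 / 2" using s0 by (simp add: field_simps)
    finally show ?thesis .
  qed
  show "form_U (moebius_act (1, 0, 2, 1) \<tau>) = (2 * \<tau> + 1) * (- \<i> / 2 * th3 (\<tau> + 1 / 2) ^ 2)"
    unfolding m UZ_plus_half(1)[OF s'] UZ_S(1)[OF s] s4 unfolding s2 by simp
  show "form_Z (moebius_act (1, 0, 2, 1) \<tau>) = (2 * \<tau> + 1) * (\<i> / 8 * th4 (\<tau> + 1 / 2) ^ 2)"
    unfolding m UZ_plus_half(2)[OF s'] UZ_S(2)[OF s] s4 unfolding s2 by simp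
qed

text \<open>In the variable 4\<tau> the matrix is an odd translation between two inversions. The odd
  translation exchanges \<open>th3\<close> and \<open>th4\<close>, so the net effect exchanges
  \<open>th3\<close> and \<open>th2\<close>, that is, U and 4Z.\<close>

lemma UZ_cusp_quarter:
  assumes "\<tau> \<in> uhp"
  shows "form_U (moebius_act (1, 0, 4, 1) \<tau>) = (4 * \<tau> + 1) * (4 * form_Z \<tau>)"
    and "form_Z (moebius_act (1, 0, 4, 1) \<tau>) = (4 * \<tau> + 1) * (form_U \<tau> / 4)"
proof -
  define s where "s = 4 * \<tau>"
  have s: "s \<in> uhp" using assms by (simp add: s_def uhp_def)
  note s' = uhp_inversion[OF s]
  define w where "w = - 1 / s - 1"
  have w: "w \<in> uhp" using s' by (simp add: w_def uhp_def)
  have nz: "s + 1 \<noteq> 0" using Im_moebius(1)[of 1 1 0 4 \<tau>] assms by (simp add: s_def)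
  have s0: "s \<noteq> 0" using s by auto
  have ws: "w * s = - (s + 1)" using s0 by (simp add: w_def field_simps)
  have w0: "w \<noteq> 0" using w by auto
  have m: "4 * moebius_act (1, 0, 4, 1) \<tau> = - 1 / w"
  proof -
    have "4 * moebius_act (1, 0, 4, 1) \<tau> = s / (s + 1)" by (simp add: s_def)
    also have "\<dots> = s / - (w * s)" by (simp add: ws)
    also have "\<dots> = - 1 / w" using s0 w0 by (simp add: field_simps)
    finally show ?thesis .
  qed
  have i: "moebius_act (1, 0, 4, 1) \<tau> \<in> uhp" using Im_moebius(3)[of 1 1 0 4 \<tau>] assms by simp
  have t3: "th3 w = th4 (- 1 / s)" using th4_plus_1[of w] by (simp add: w_def)
  have t4: "th4 w = th3 (- 1 / s)" using th3_plus_1[of w] by (simp add: w_def)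
  have "th3 (- 1 / w) ^ 2 = - (w * s) * th2 s ^ 2"
    unfolding th3_sq_inversion[OF w] t3 th4_sq_inversion[OF s] by (simp add: algebra_simps)
  then show "form_U (moebius_act (1, 0, 4, 1) \<tau>) = (4 * \<tau> + 1) * (4 * form_Z \<tau>)"
    unfolding form_U_def form_Z_def if_P[OF i] if_P[OF assms] m ws by (simp add: s_def)
  have "th2 (- 1 / w) ^ 2 = - (w * s) * th3 s ^ 2"
    unfolding th2_sq_inversion[OF w] t4 th3_sq_inversion[OF s] by (simp add: algebra_simps)
  then show "form_Z (moebius_act (1, 0, 4, 1) \<tau>) = (4 * \<tau> + 1) * (form_U \<tau> / 4)"
    unfolding form_U_def form_Z_def if_P[OF i] if_P[OF assms] m ws by (simp add: s_def)
qed

section \<open>The forms in terms of theta functions\<close>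

text \<open>The unordered sum over the integers splits into n = 0 and two halves that agree since n
  and -n have the same square.\<close>

lemma theta_eq_phi:
  assumes "\<tau> \<in> uhp"
  shows "theta \<tau> = phi (exp (2 * of_real pi * \<i> * \<tau>))"
proof -
  define q where "q = exp (2 * of_real pi * \<i> * \<tau>)"
  define f where "f = (\<lambda>n::int. q powi (n\<^sup>2))"
  define S where "S = (\<Sum>n. q ^ (Suc n)\<^sup>2)"
  have q: "norm q < 1" unfolding q_def by (rule norm_exp_2pi_i_less_1[OF assms])
  have fS: "f (int n) = q ^ n\<^sup>2" "f (- int n) = q ^ n\<^sup>2" for n
    unfolding f_def by (simp_all flip: of_nat_power)
  have "summable (\<lambda>n. norm (q ^ (Suc n)\<^sup>2))"
    unfolding norm_power using q by (intro summable_lacunary le_Suc_power2) simp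
  moreover have "(\<lambda>n. q ^ (Suc n)\<^sup>2) sums S"
    unfolding S_def using q by (intro summable_sums summable_lacunary le_Suc_power2)
  ultimately have "((\<lambda>n. q ^ (Suc n)\<^sup>2) has_sum S) UNIV"
    by (rule norm_summable_imp_has_sum)
  then have pos: "(f has_sum S) (range (\<lambda>n. int (Suc n)))" and neg: "(f has_sum S) (range (\<lambda>n. - int (Suc n)))"
    by (subst has_sum_reindex; simp add: inj_on_def o_def fS del: of_nat_Suc)+
  have zero: "(f has_sum 1) {0}"
    using has_sum_finite[of "{0}" f] by (simp add: f_def)
  have "(f has_sum (1 + (S + S))) ({0} \<union> (range (\<lambda>n. int (Suc n)) \<union> range (\<lambda>n. - int (Suc n))))"
    by (intro has_sum_Un_disjoint zero pos neg) auto
  also have "{0} \<union> (range (\<lambda>n. int (Suc n)) \<union> range (\<lambda>n. - int (Suc n))) = UNIV"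
  proof -
    have "n \<in> {0} \<union> (range (\<lambda>n. int (Suc n)) \<union> range (\<lambda>n. - int (Suc n)))" for n
      by (cases n rule: int_cases3) (auto simp: image_iff gr0_conv_Suc)
    then show ?thesis by blast
  qed
  finally have "infsum f UNIV = 1 + (S + S)" by (rule infsumI)
  then show ?thesis
    using assms by (simp add: theta_def f_def q_def S_def phi_def)
qed

lemma eta_eq_euler_prod:
  "\<tau> \<in> uhp \<Longrightarrow> eta \<tau> = exp (2 * of_real pi * \<i> * \<tau> / 24) * euler_prod (exp (2 * of_real pi * \<i> * \<tau>))"
  by (simp add: eta_def euler_prod_def)

lemma uhp_scale: "2 * \<tau> \<in> uhp \<longleftrightarrow> \<tau> \<in> uhp" "4 * \<tau> \<in> uhp \<longleftrightarrow> \<tau> \<in> uhp"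
  by (auto simp: uhp_def)

lemma U_eq_phi: "\<tau> \<in> uhp \<Longrightarrow> form_U \<tau> = phi (exp (2 * of_real pi * \<i> * \<tau>) ^ 2) ^ 2"
  by (simp add: form_U_def th3_def mult_ac flip: exp_of_nat_mult)

lemma Z_eq_psi:
  assumes "\<tau> \<in> uhp"
  shows "form_Z \<tau> = exp (2 * of_real pi * \<i> * \<tau>) * psi (exp (2 * of_real pi * \<i> * \<tau>) ^ 4) ^ 2"
proof -
  have "exp (of_real pi * \<i> * (4 * \<tau>) / 4) ^ 2 = exp (2 * of_real pi * \<i> * \<tau>)"
    by (simp add: mult_ac flip: exp_of_nat_mult)
  moreover have "exp (2 * of_real pi * \<i> * (4 * \<tau>)) = exp (2 * of_real pi * \<i> * \<tau>) ^ 4"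
    by (simp add: mult_ac flip: exp_of_nat_mult)
  ultimately show ?thesis using assms by (simp add: form_Z_def th2_def power_mult_distrib)
qed

lemma theta2_sq: "theta2 \<tau> ^ 2 = form_U \<tau>"
proof (cases "\<tau> \<in> uhp")
  case True
  then have "theta2 \<tau> = phi (exp (2 * of_real pi * \<i> * (2 * \<tau>)))"
    unfolding theta2_def by (intro theta_eq_phi) (simp add: uhp_scale)
  also have "exp (2 * of_real pi * \<i> * (2 * \<tau>)) = exp (2 * of_real pi * \<i> * \<tau>) ^ 2"
    by (simp add: mult_ac flip: exp_of_nat_mult)
  finally show ?thesis by (simp add: U_eq_phi[OF True])
qed (simp add: theta2_def theta_def form_U_def uhp_scale)

lemma F_product:
  assumes "\<tau> \<in> uhp"
  defines "q \<equiv> exp (2 * of_real pi * \<i> * \<tau>)"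
  shows "F \<tau> = q * euler_prod (q ^ 4) ^ 8 / euler_prod (q ^ 2) ^ 4"
proof -
  have t: "2 * \<tau> \<in> uhp" "4 * \<tau> \<in> uhp" using assms by (simp_all add: uhp_scale)
  have e: "exp (2 * of_real pi * \<i> * (2 * \<tau>)) = q ^ 2" "exp (2 * of_real pi * \<i> * (4 * \<tau>)) = q ^ 4"
    by (simp_all add: q_def mult_ac flip: exp_of_nat_mult)
  \<comment> \<open>The fractional exponents of eta leave exactly one q: 8 * 4/24 - 4 * 2/24 =
    1.\<close>
  have x: "exp (2 * of_real pi * \<i> * (4 * \<tau>) / 24) ^ 8 = q * exp (2 * of_real pi * \<i> * (2 * \<tau>) / 24) ^ 4"
    by (simp add: q_def mult_ac flip: exp_of_nat_mult exp_add)
  show ?thesis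
    unfolding F_def eta_eq_euler_prod[OF t(1)] eta_eq_euler_prod[OF t(2)] e power_mult_distrib x by simp
qed

text \<open>With E = \<open>euler_prod\<close>, U is E(q^4)^10 / (E(q^2)^4 E(q^8)^4) and Z is q
  E(q^8)^4 / E(q^4)^2; the factors E(q^8) cancel in the product.\<close>

lemma F_eq_UZ: "F \<tau> = form_U \<tau> * form_Z \<tau>"
proof (cases "\<tau> \<in> uhp")
  case True
  define q where "q = exp (2 * of_real pi * \<i> * \<tau>)"
  have q0: "q \<noteq> 0" and q: "norm q < 1"
    unfolding q_def using norm_exp_2pi_i_less_1[OF True] by auto
  have nq: "norm (q ^ n) < 1" if "n > 0" for n
    using q that by (simp add: norm_power power_less_one_iff)
  have E: "euler_prod (q ^ n) \<noteq> 0" if "n > 0" for n by (rule euler_prod_nonzero[OF nq[OF that]])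
  have phi2: "phi (q ^ 2) = euler_prod (q ^ 4) ^ 5 / (euler_prod (q ^ 2) ^ 2 * euler_prod (q ^ 8) ^ 2)"
    using phi_product[OF power_not_zero[OF q0, of 2] nq[of 2]] by (simp flip: power_mult)
  have psi4: "psi (q ^ 4) = euler_prod (q ^ 8) ^ 2 / euler_prod (q ^ 4)"
    using psi_product[OF power_not_zero[OF q0, of 4] nq[of 4]] by (simp flip: power_mult)
  have "F \<tau> = q * euler_prod (q ^ 4) ^ 8 / euler_prod (q ^ 2) ^ 4"
    unfolding q_def by (rule F_product[OF True])
  also have "\<dots> = phi (q ^ 2) ^ 2 * (q * psi (q ^ 4) ^ 2)"
    unfolding phi2 psi4
    using E[of 2] E[of 4] E[of 8] by (simp add: divide_simps)
  finally show ?thesis using True by (simp add: U_eq_phi Z_eq_psi q_def)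
next
  case False
  then show ?thesis by (simp add: F_def eta_def form_U_def uhp_scale)
qed

lemma F2_eq_Z: "F2 \<tau> = form_Z \<tau> ^ 2"
proof (cases "\<tau> \<in> uhp")
  case True
  define q where "q = exp (2 * of_real pi * \<i> * \<tau>)"
  have q0: "q \<noteq> 0" and q: "norm q < 1"
    unfolding q_def using norm_exp_2pi_i_less_1[OF True] by auto
  have q4: "norm (q ^ 4) < 1"
    using q by (simp add: norm_power power_less_one_iff)
  have psi4: "psi (q ^ 4) = euler_prod (q ^ 8) ^ 2 / euler_prod (q ^ 4)"
    using psi_product[OF power_not_zero[OF q0, of 4] q4] by (simp flip: power_mult)
  have e: "exp (2 * of_real pi * \<i> * (2 * \<tau>)) = q ^ 2"
    by (simp add: q_def mult_ac flip: exp_of_nat_mult)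
  have "F2 \<tau> = q ^ 2 * euler_prod (q ^ 8) ^ 8 / euler_prod (q ^ 4) ^ 4"
    using F_product[of "2 * \<tau>"] True unfolding F2_def e by (simp add: uhp_scale flip: power_mult)
  also have "\<dots> = (q * psi (q ^ 4) ^ 2) ^ 2"
    unfolding psi4 by (simp add: power_divide power_mult_distrib flip: power_mult)
  finally show ?thesis using True by (simp add: Z_eq_psi q_def)
next
  case False
  then show ?thesis by (simp add: F2_def F_def eta_def form_Z_def uhp_scale)
qed

lemma U_nonzero: "\<tau> \<in> uhp \<Longrightarrow> form_U \<tau> \<noteq> 0"
  unfolding U_eq_phi using phi_nonzero norm_exp_2pi_i_less_1 by (simp add: norm_power power_less_one_iff)

lemma Z_nonzero: "\<tau> \<in> uhp \<Longrightarrow> form_Z \<tau> \<noteq> 0"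
  unfolding Z_eq_psi using psi_nonzero norm_exp_2pi_i_less_1 by (simp add: norm_power power_less_one_iff)

lemma U_holomorphic: "form_U holomorphic_on uhp"
proof -
  have "(\<lambda>\<tau>. th3 (4 * \<tau>) ^ 2) holomorphic_on uhp"
    by (intro holomorphic_intros holomorphic_on_compose_gen[OF _ th3_holomorphic, unfolded o_def])
       (auto simp: uhp_scale)
  then show ?thesis by (rule holomorphic_transform) (simp add: form_U_def)
qed

lemma Z_holomorphic: "form_Z holomorphic_on uhp"
proof -
  have "(\<lambda>\<tau>. th2 (4 * \<tau>) ^ 2 / 4) holomorphic_on uhp"
    by (intro holomorphic_intros holomorphic_on_compose_gen[OF _ th2_holomorphic, unfolded o_def])
       (auto simp: uhp_scale)
  then show ?thesis by (rule holomorphic_transform) (simp add: form_Z_def)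
qed

section \<open>Fourier expansions at a cusp\<close>

definition qexp :: "nat \<Rightarrow> complex \<Rightarrow> complex"
  where "qexp h \<tau> = exp (2 * of_real pi * \<i> * \<tau> / of_nat h)"

text \<open>An expansion is encoded by a holomorphic function on the disc instead of a coefficient
  sequence, so that sums, products and quotients of expansions need no coefficient formulas.\<close>

definition fourier_at :: "(complex \<Rightarrow> complex) \<Rightarrow> nat \<Rightarrow> (complex \<Rightarrow> complex) \<Rightarrow> bool"
  where "fourier_at f h p \<longleftrightarrow> h > 0 \<and> p holomorphic_on ball 0 1 \<and> (\<forall>\<tau>\<in>uhp. f \<tau> = p (qexp h \<tau>))"

text \<open>The constant term of the expansion. The width stays existential, as in the definition of
  modular forms; \<open>cuspval_unique\<close> shows that the value does not depend on it.\<close>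

definition cuspval :: "(complex \<Rightarrow> complex) \<Rightarrow> complex \<Rightarrow> bool"
  where "cuspval f c \<longleftrightarrow> (\<exists>h p. fourier_at f h p \<and> p 0 = c)"

lemma norm_qexp: "norm (qexp h \<tau>) = exp (- (2 * pi * Im \<tau> / h))"
  by (simp add: qexp_def norm_exp_eq_Re)

lemma qexp_in_ball: "h > 0 \<Longrightarrow> \<tau> \<in> uhp \<Longrightarrow> qexp h \<tau> \<in> ball 0 1"
  by (simp add: norm_qexp uhp_def)

lemma qexp_nonzero [simp]: "qexp h \<tau> \<noteq> 0"
  by (simp add: qexp_def)

lemma qexp_surj:
  assumes "h > 0" "norm q < 1" "q \<noteq> 0"
  obtains \<tau> where "\<tau> \<in> uhp" "qexp h \<tau> = q"
proof -
  define \<tau> where "\<tau> = of_nat h * Ln q / (2 * of_real pi * \<i>)"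
  have q: "qexp h \<tau> = q" using assms by (simp add: qexp_def \<tau>_def)
  have "exp (- (2 * pi * Im \<tau> / h)) < 1" using assms(2) norm_qexp[of h \<tau>] by (simp add: q)
  then have "\<tau> \<in> uhp" using assms(1) by (simp add: uhp_def zero_less_mult_iff zero_less_divide_iff)
  then show ?thesis using that q by blast
qed

lemma qexp_power: "qexp h \<tau> ^ n = exp (2 * of_real pi * \<i> * of_nat n * \<tau> / of_nat h)"
  by (simp add: qexp_def mult_ac flip: exp_of_nat_mult)

text \<open>Every nonzero point of the unit disc is some \<open>qexp h \<tau>\<close>, so
  convergence on the half-plane amounts to convergence of the power series in the whole
  disc.\<close>

lemma has_fourier_expansion_imp_fourier_at:
  assumes "has_fourier_expansion f h u"
  shows "\<exists>p. fourier_at f h p \<and> p 0 = u 0"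
proof -
  have h: "h > 0" and s: "\<And>\<tau>. \<tau> \<in> uhp \<Longrightarrow> (\<lambda>n. u n * qexp h \<tau> ^ n) sums f \<tau>"
    using assms by (auto simp: has_fourier_expansion_def qexp_power)
  define p where "p = (\<lambda>q. \<Sum>n. u n * q ^ n)"
  have sm: "(\<lambda>n. u n * q ^ n) sums p q" if q: "norm q < 1" for q
  proof (cases "q = 0")
    case True
    then show ?thesis unfolding p_def by (intro summable_sums) (use powser_sums_zero in \<open>auto simp: summable_def\<close>)
  next
    case False
    then obtain \<tau> where "\<tau> \<in> uhp" "qexp h \<tau> = q" using qexp_surj h q by metis
    then show ?thesis unfolding p_def using s[of \<tau>] by (intro summable_sums) (auto simp: summable_def)
  qed
  have "p holomorphic_on ball 0 1"
    using sm by (intro power_series_holomorphic[of 0 1 u]) auto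
  moreover have "f \<tau> = p (qexp h \<tau>)" if "\<tau> \<in> uhp" for \<tau>
    using s[OF that] sm[of "qexp h \<tau>"] qexp_in_ball[OF h that] sums_unique2 by auto
  moreover have "p 0 = u 0" using sm[of 0] by simp
  ultimately show ?thesis using h by (auto simp: fourier_at_def)
qed

lemma fourier_at_imp_has_fourier_expansion:
  assumes "fourier_at f h p"
  shows "has_fourier_expansion f h (\<lambda>n. (deriv ^^ n) p 0 / fact n)"
  unfolding has_fourier_expansion_def
proof (intro conjI ballI)
  show h: "h > 0" using assms by (simp add: fourier_at_def)
  fix \<tau> assume t: "\<tau> \<in> uhp"
  have "(\<lambda>n. (deriv ^^ n) p 0 / fact n * (qexp h \<tau> - 0) ^ n) sums p (qexp h \<tau>)"
    using assms qexp_in_ball[OF h t] by (intro holomorphic_power_series) (auto simp: fourier_at_def)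
  then show "(\<lambda>n. (deriv ^^ n) p 0 / fact n * exp (2 * of_real pi * \<i> * of_nat n * \<tau> / of_nat h)) sums f \<tau>"
    using assms t by (simp add: fourier_at_def qexp_power)
qed

lemma cuspval_iff: "cuspval f c \<longleftrightarrow> (\<exists>h u. has_fourier_expansion f h u \<and> u 0 = c)"
proof
  assume "cuspval f c"
  then obtain h p where p: "fourier_at f h p" "p 0 = c" by (auto simp: cuspval_def)
  show "\<exists>h u. has_fourier_expansion f h u \<and> u 0 = c"
    using fourier_at_imp_has_fourier_expansion[OF p(1)] p(2)
    by (intro exI[of _ h] exI[of _ "\<lambda>n. (deriv ^^ n) p 0 / fact n"]) simp
next
  assume "\<exists>h u. has_fourier_expansion f h u \<and> u 0 = c"
  then show "cuspval f c" unfolding cuspval_def by (metis has_fourier_expansion_imp_fourier_at)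
qed

lemma fourier_at_rescale:
  assumes "fourier_at f h p" "m > 0"
  shows "fourier_at f (h * m) (\<lambda>x. p (x ^ m))"
proof -
  have "(\<lambda>x. p (x ^ m)) holomorphic_on ball 0 1"
    using assms
    by (intro holomorphic_on_compose_gen[of "\<lambda>x. x ^ m" _ p "ball 0 1", unfolded o_def])
       (auto simp: fourier_at_def norm_power power_less_one_iff intro!: holomorphic_intros)
  moreover have "qexp (h * m) \<tau> ^ m = qexp h \<tau>" for \<tau>
    using assms(2) by (simp add: qexp_power mult_ac) (simp add: qexp_def mult_ac)
  ultimately show ?thesis using assms by (simp add: fourier_at_def)
qed

lemma fourier_at_common:
  assumes "cuspval f a" "cuspval g b"
  obtains h p r where "fourier_at f h p" "p 0 = a" "fourier_at g h r" "r 0 = b"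
proof -
  obtain h p h' r where 1: "fourier_at f h p" "p 0 = a" and 2: "fourier_at g h' r" "r 0 = b"
    using assms by (auto simp: cuspval_def)
  have "h > 0" "h' > 0" using 1 2 by (auto simp: fourier_at_def)
  then have "fourier_at f (h * h') (\<lambda>x. p (x ^ h'))" "fourier_at g (h * h') (\<lambda>x. r (x ^ h))"
    using fourier_at_rescale[OF 1(1), of h'] fourier_at_rescale[OF 2(1), of h] by (simp_all add: mult.commute)
  then show ?thesis
    using that[of "h * h'" "\<lambda>x. p (x ^ h')" "\<lambda>x. r (x ^ h)"] 1 2 \<open>h > 0\<close> \<open>h' > 0\<close>
    by (simp add: power_0_left)
qed

text \<open>After passage to a common width the two disc functions agree off the origin, and
  continuity forces the same value there.\<close>

lemma cuspval_unique:
  assumes "cuspval f a" "cuspval f b"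
  shows "a = b"
proof -
  from assms obtain h p r where p: "fourier_at f h p" "p 0 = a" and r: "fourier_at f h r" "r 0 = b"
    by (rule fourier_at_common)
  then have h: "h > 0" and hol: "p holomorphic_on ball 0 1" "r holomorphic_on ball 0 1"
    by (auto simp: fourier_at_def)
  have eq: "p q = r q" if "q \<in> ball 0 1 - {0}" for q
  proof -
    have "norm q < 1" "q \<noteq> 0" using that by auto
    then obtain \<tau> where "\<tau> \<in> uhp" "qexp h \<tau> = q" using qexp_surj h by metis
    then show ?thesis using p r by (auto simp: fourier_at_def)
  qed
  have "isCont p 0" "isCont r 0"
    using hol by (auto intro!: continuous_on_interior holomorphic_on_imp_continuous_on)
  then have "(p \<longlongrightarrow> a) (at 0)" "(r \<longlongrightarrow> b) (at 0)" using p r by (simp_all add: isCont_def)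
  moreover have "eventually (\<lambda>q. p q = r q) (at 0)"
    unfolding eventually_at using eq by (intro exI[of _ "1::real"]) auto
  ultimately show ?thesis
    using tendsto_unique[of "at (0::complex)" p a b] tendsto_cong[of p r "at 0"] by simp
qed

lemma cuspval_cong:
  assumes "cuspval f c" "\<And>\<tau>. \<tau> \<in> uhp \<Longrightarrow> g \<tau> = f \<tau>"
  shows "cuspval g c"
  using assms by (auto simp: cuspval_def fourier_at_def)

lemma cuspval_const: "cuspval (\<lambda>_. c) c"
  unfolding cuspval_def fourier_at_def by (intro exI[of _ "1::nat"] exI[of _ "\<lambda>_. c"]) auto

lemma cuspval_add:
  assumes "cuspval f a" "cuspval g b"
  shows "cuspval (\<lambda>\<tau>. f \<tau> + g \<tau>) (a + b)"
proof -
  from assms obtain h p r where "fourier_at f h p" "p 0 = a" "fourier_at g h r" "r 0 = b"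
    by (rule fourier_at_common)
  then show ?thesis unfolding cuspval_def fourier_at_def
    by (intro exI[of _ h] exI[of _ "\<lambda>x. p x + r x"]) (auto intro!: holomorphic_intros)
qed

lemma cuspval_mult:
  assumes "cuspval f a" "cuspval g b"
  shows "cuspval (\<lambda>\<tau>. f \<tau> * g \<tau>) (a * b)"
proof -
  from assms obtain h p r where "fourier_at f h p" "p 0 = a" "fourier_at g h r" "r 0 = b"
    by (rule fourier_at_common)
  then show ?thesis unfolding cuspval_def fourier_at_def
    by (intro exI[of _ h] exI[of _ "\<lambda>x. p x * r x"]) (auto intro!: holomorphic_intros)
qed

lemma cuspval_cmult: "cuspval f a \<Longrightarrow> cuspval (\<lambda>\<tau>. c * f \<tau>) (c * a)"
  by (rule cuspval_mult[OF cuspval_const])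

lemma cuspval_power: "cuspval f a \<Longrightarrow> cuspval (\<lambda>\<tau>. f \<tau> ^ n) (a ^ n)"
  by (induction n) (auto intro: cuspval_mult cuspval_const)

lemma cuspval_sum:
  "(\<And>i. i \<in> I \<Longrightarrow> cuspval (f i) (a i)) \<Longrightarrow> cuspval (\<lambda>\<tau>. \<Sum>i\<in>I. f i \<tau>) (\<Sum>i\<in>I. a i)"
  by (induction I rule: infinite_finite_induct) (auto intro: cuspval_add cuspval_const)

text \<open>The denominator must not vanish at the centre of the disc nor at points coming from the
  half-plane; together these make up the disc.\<close>

lemma cuspval_divide:
  assumes "cuspval f a" "cuspval g b" "b \<noteq> 0" "\<And>\<tau>. \<tau> \<in> uhp \<Longrightarrow> g \<tau> \<noteq> 0"
  shows "cuspval (\<lambda>\<tau>. f \<tau> / g \<tau>) (a / b)"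
proof -
  from assms(1,2) obtain h p r where p: "fourier_at f h p" "p 0 = a" and r: "fourier_at g h r" "r 0 = b"
    by (rule fourier_at_common)
  then have h: "h > 0" by (simp add: fourier_at_def)
  have "r q \<noteq> 0" if "q \<in> ball 0 1" for q
  proof (cases "q = 0")
    case False
    then obtain \<tau> where "\<tau> \<in> uhp" "qexp h \<tau> = q" using qexp_surj h \<open>q \<in> ball 0 1\<close> by auto
    then show ?thesis using r assms(4) by (auto simp: fourier_at_def)
  qed (use r assms in auto)
  then show ?thesis using p r unfolding cuspval_def fourier_at_def
    by (intro exI[of _ h] exI[of _ "\<lambda>x. p x / r x"]) (auto intro!: holomorphic_intros)
qed

text \<open>A real translation rotates the disc and fixes its centre.\<close>

lemma cuspval_shift:
  assumes "cuspval f c"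
  shows "cuspval (\<lambda>\<tau>. f (\<tau> + of_real x)) c"
proof -
  obtain h p where p: "fourier_at f h p" "p 0 = c" using assms by (auto simp: cuspval_def)
  have q: "qexp h (\<tau> + of_real x) = qexp h (of_real x) * qexp h \<tau>" for \<tau>
    by (simp add: qexp_def distrib_left add_divide_distrib exp_add mult_ac)
  have n: "norm (qexp h (of_real x)) = 1" by (simp add: norm_qexp)
  have "(\<lambda>y. p (qexp h (of_real x) * y)) holomorphic_on ball 0 1"
    using p n
    by (intro holomorphic_on_compose_gen[of "\<lambda>y. qexp h (of_real x) * y" _ p "ball 0 1", unfolded o_def])
       (auto simp: fourier_at_def norm_mult intro!: holomorphic_intros)
  then show ?thesis using p unfolding cuspval_def fourier_at_def
    by (intro exI[of _ h] exI[of _ "\<lambda>y. p (qexp h (of_real x) * y)"]) (auto simp: q uhp_def)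
qed

lemma cuspval_scale:
  assumes "cuspval f c" "m > 0"
  shows "cuspval (\<lambda>\<tau>. f (\<tau> / of_nat m)) c"
proof -
  obtain h p where p: "fourier_at f h p" "p 0 = c" using assms by (auto simp: cuspval_def)
  have "qexp h (\<tau> / of_nat m) = qexp (h * m) \<tau>" for \<tau>
    by (simp add: qexp_def mult.commute)
  then show ?thesis using p assms(2) unfolding cuspval_def fourier_at_def
    by (intro exI[of _ "h * m"] exI[of _ p]) (auto simp: uhp_def)
qed

lemma cuspval_th3: "cuspval th3 1"
  unfolding cuspval_def fourier_at_def
  by (intro exI[of _ "2::nat"] exI[of _ phi]) (simp add: phi_holomorphic th3_def qexp_def mult_ac)

lemma cuspval_th4: "cuspval th4 1"
proof -
  have "(\<lambda>x. phi (- x)) holomorphic_on ball 0 1"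
    by (rule holomorphic_on_compose_gen[OF _ phi_holomorphic, unfolded o_def]) (auto intro!: holomorphic_intros)
  then show ?thesis
    unfolding cuspval_def fourier_at_def
    by (intro exI[of _ "2::nat"] exI[of _ "\<lambda>x. phi (- x)"]) (simp add: th4_def qexp_def mult_ac)
qed

lemma holomorphic_on_unit_ball_power:
  assumes "p holomorphic_on ball 0 1" "m > 0"
  shows "(\<lambda>x::complex. p (x ^ m)) holomorphic_on ball 0 1"
  using assms
  by (intro holomorphic_on_compose_gen[of "\<lambda>x. x ^ m" _ p "ball 0 1", unfolded o_def])
     (auto simp: norm_power power_less_one_iff intro!: holomorphic_intros)

lemma fourier_at_U: "fourier_at form_U 1 (\<lambda>x. phi (x ^ 2) ^ 2)"
  unfolding fourier_at_def
  by (auto simp: U_eq_phi qexp_def intro!: holomorphic_intros holomorphic_on_unit_ball_power phi_holomorphic)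

lemma fourier_at_Z: "fourier_at form_Z 1 (\<lambda>x. x * psi (x ^ 4) ^ 2)"
  unfolding fourier_at_def
  by (auto simp: Z_eq_psi qexp_def intro!: holomorphic_intros holomorphic_on_unit_ball_power psi_holomorphic)

lemma cuspval_U: "cuspval form_U 1"
  using fourier_at_U unfolding cuspval_def by (intro exI[of _ "1::nat"] exI[of _ "\<lambda>x. phi (x ^ 2) ^ 2"]) simp

lemma cuspval_Z: "cuspval form_Z 0"
  using fourier_at_Z unfolding cuspval_def by (intro exI[of _ "1::nat"] exI[of _ "\<lambda>x. x * psi (x ^ 4) ^ 2"]) simp

text \<open>If h is the width at hand, period 1 gives u(n) = z^n u(n) for the Taylor coefficients,
  with z = exp(2 pi i/h). As z is a primitive h-th root of unity, only multiples of h
  survive.\<close>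

lemma fourier_at_period_1:
  assumes "cuspval f c" and per: "\<And>\<tau>. \<tau> \<in> uhp \<Longrightarrow> f (\<tau> + 1) = f \<tau>"
  shows "\<exists>p. fourier_at f 1 p"
proof -
  obtain h p where p: "fourier_at f h p" using assms by (auto simp: cuspval_def)
  then have h: "h > 0" and hol: "p holomorphic_on ball 0 1" by (auto simp: fourier_at_def)
  define z where "z = qexp h 1"
  define u where "u = (\<lambda>n. (deriv ^^ n) p 0 / fact n)"
  have z: "norm z = 1" by (simp add: z_def norm_qexp)
  have pz: "p (z * q) = p q" if q: "q \<in> ball 0 1" for q
  proof (cases "q = 0")
    case False
    then obtain \<tau> where t: "\<tau> \<in> uhp" "qexp h \<tau> = q" using qexp_surj h q by auto
    have "z * q = qexp h (\<tau> + 1)"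
      unfolding t(2)[symmetric] z_def by (simp add: qexp_def distrib_left add_divide_distrib exp_add mult_ac)
    moreover have "\<tau> + 1 \<in> uhp" using t by (simp add: uhp_def)
    ultimately show ?thesis using p per[OF t(1)] t by (auto simp: fourier_at_def)
  qed simp
  have "(deriv ^^ n) p 0 = z ^ n * (deriv ^^ n) p 0" for n
  proof -
    have "(deriv ^^ n) (\<lambda>w. p (z * w)) 0 = z ^ n * (deriv ^^ n) p (z * 0)"
      using z by (intro higher_deriv_compose_linear[OF hol, of "ball 0 1"]) (auto simp: norm_mult)
    moreover have "(deriv ^^ n) (\<lambda>w. p (z * w)) 0 = (deriv ^^ n) p 0"
    proof (rule higher_deriv_transform_within_open)
      show "(\<lambda>w. p (z * w)) holomorphic_on ball 0 1"
        using hol by (rule holomorphic_transform) (simp add: pz)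
    qed (use hol pz in auto)
    ultimately show ?thesis by simp
  qed
  then have u: "u n = z ^ n * u n" for n unfolding u_def by (metis times_divide_eq_right)
  have z1: "z ^ n = 1 \<Longrightarrow> h dvd n" for n
  proof -
    assume "z ^ n = 1"
    then have "exp (2 * of_real pi * \<i> * of_nat n / of_nat h) = 1" by (simp add: z_def qexp_power)
    then obtain m :: int where m: "2 * pi * real n / real h = of_int (2 * m) * pi"
      unfolding exp_eq_1 by auto
    then have "real n = of_int (m * int h)" using h by (simp add: field_simps)
    then have "int n = m * int h" by linarith
    then show "h dvd n" by (metis dvd_triv_right int_dvd_int_iff)
  qed
  have u0: "u n = 0" if "\<not> h dvd n" for n
    using u[of n] z1[of n] that by auto
  have "has_fourier_expansion f 1 (\<lambda>n. u (h * n))"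
    unfolding has_fourier_expansion_def
  proof (intro conjI ballI)
    fix \<tau> assume t: "\<tau> \<in> uhp"
    have "(\<lambda>n. u n * qexp h \<tau> ^ n) sums f \<tau>"
      using fourier_at_imp_has_fourier_expansion[OF p] t
      by (auto simp: has_fourier_expansion_def u_def qexp_power)
    moreover have "strict_mono (\<lambda>n. h * n)" using h by (simp add: strict_mono_def)
    ultimately have "(\<lambda>n. u (h * n) * qexp h \<tau> ^ (h * n)) sums f \<tau>"
      by (subst sums_mono_reindex[where f = "\<lambda>n. u n * qexp h \<tau> ^ n"]) (auto intro!: u0 simp: image_iff elim!: dvdE)
    moreover have "qexp h \<tau> ^ (h * n) = qexp 1 \<tau> ^ n" for n
      using h by (simp add: qexp_power mult_ac)
    ultimately show "(\<lambda>n. u (h * n) * exp (2 * of_real pi * \<i> * of_nat n * \<tau> / of_nat 1)) sums f \<tau>"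
      by (simp add: qexp_power)
  qed simp
  then show ?thesis using has_fourier_expansion_imp_fourier_at by blast
qed

section \<open>Reduction theory\<close>

fun mat_mul :: "mat2 \<Rightarrow> mat2 \<Rightarrow> mat2"
  where "mat_mul (a, b, c, d) (a', b', c', d') = (a * a' + b * c', a * b' + b * d', c * a' + d * c', c * b' + d * d')"

fun autf :: "mat2 \<Rightarrow> complex \<Rightarrow> complex"
  where "autf (a, b, c, d) \<tau> = of_int c * \<tau> + of_int d"

lemma slash_conv_autf: "slash k f \<gamma> \<tau> = autf \<gamma> \<tau> powi (- k) * f (moebius_act \<gamma> \<tau>)"
  by (cases \<gamma>) simp

lemma autf_nonzero: "\<gamma> \<in> SL2Z \<Longrightarrow> \<tau> \<in> uhp \<Longrightarrow> autf \<gamma> \<tau> \<noteq> 0"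
  using Im_moebius(1) by (auto simp: SL2Z_def)

lemma moebius_act_uhp: "\<gamma> \<in> SL2Z \<Longrightarrow> \<tau> \<in> uhp \<Longrightarrow> moebius_act \<gamma> \<tau> \<in> uhp"
  using Im_moebius(3) unfolding SL2Z_def by blast

lemma mat_mul_SL2Z:
  assumes "\<gamma> \<in> SL2Z" "\<delta> \<in> SL2Z"
  shows "mat_mul \<gamma> \<delta> \<in> SL2Z"
proof -
  obtain a b c d a' b' c' d' where e: "\<gamma> = (a, b, c, d)" "\<delta> = (a', b', c', d')"
    by (metis surj_pair)
  have "(a * a' + b * c') * (c * b' + d * d') - (a * b' + b * d') * (c * a' + d * c')
      = (a * d - b * c) * (a' * d' - b' * c')" by (simp add: algebra_simps)
  then show ?thesis using assms by (simp add: SL2Z_def e)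
qed

lemma
  assumes "\<delta> \<in> SL2Z" "\<tau> \<in> uhp"
  shows autf_mat_mul: "autf (mat_mul \<gamma> \<delta>) \<tau> = autf \<gamma> (moebius_act \<delta> \<tau>) * autf \<delta> \<tau>"
    and moebius_act_mat_mul: "moebius_act (mat_mul \<gamma> \<delta>) \<tau> = moebius_act \<gamma> (moebius_act \<delta> \<tau>)"
proof -
  obtain a b c d a' b' c' d' where e: "\<gamma> = (a, b, c, d)" "\<delta> = (a', b', c', d')"
    by (metis surj_pair)
  define j where "j = of_int c' * \<tau> + (of_int d' :: complex)"
  define t where "t = (of_int a' * \<tau> + of_int b') / j"
  have j: "j \<noteq> 0" using autf_nonzero[OF assms] by (simp add: e j_def)
  have tj: "t * j = of_int a' * \<tau> + of_int b'" using j by (simp add: t_def)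
  have m: "(of_int x * t + of_int y) * j = of_int (x * a' + y * c') * \<tau> + of_int (x * b' + y * d')" for x y
    unfolding distrib_right mult.assoc tj by (simp add: j_def algebra_simps)
  show "autf (mat_mul \<gamma> \<delta>) \<tau> = autf \<gamma> (moebius_act \<delta> \<tau>) * autf \<delta> \<tau>"
    by (simp only: e mat_mul.simps autf.simps moebius_act.simps j_def[symmetric] t_def[symmetric] m)
  show "moebius_act (mat_mul \<gamma> \<delta>) \<tau> = moebius_act \<gamma> (moebius_act \<delta> \<tau>)"
    by (simp only: e mat_mul.simps moebius_act.simps j_def[symmetric] t_def[symmetric] m[symmetric]) (simp add: j)
qed

text \<open>Every point of the upper half-plane is equivalent to one of imaginary part at least
  \<open>1/2\<close>: below that height, a translation to \<open>\<bar>Re \<tau>\<bar> \<le> 1/2\<close> followed by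
  \<open>\<tau> \<mapsto> -1/\<tau>\<close> at least doubles the imaginary part.\<close>

lemma SL2Z_reduction_aux:
  "\<tau> \<in> uhp \<Longrightarrow> Im \<tau> \<ge> (1 / 2) ^ Suc n \<Longrightarrow> \<exists>\<gamma>\<in>SL2Z. \<exists>\<tau>'\<in>uhp. \<tau> = moebius_act \<gamma> \<tau>' \<and> Im \<tau>' \<ge> 1 / 2"
proof (induction n arbitrary: \<tau>)
  case 0
  then show ?case by (intro bexI[of _ "(1, 0, 0, 1)"] bexI[of _ \<tau>]) (auto simp: SL2Z_def)
next
  case (Suc n)
  show ?case
  proof (cases "Im \<tau> \<ge> 1 / 2")
    case True
    then show ?thesis using Suc by (intro bexI[of _ "(1, 0, 0, 1)"] bexI[of _ \<tau>]) (auto simp: SL2Z_def)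
  next
    case False
    define m where "m = round (Re \<tau>)"
    define t where "t = \<tau> - of_int m"
    have t: "t \<in> uhp" "Im t = Im \<tau>" using Suc.prems by (simp_all add: t_def uhp_def)
    have "\<bar>Re t\<bar> \<le> 1 / 2" using of_int_round_abs_le[of "Re \<tau>"] by (simp add: t_def m_def abs_minus_commute)
    then have "(Re t)\<^sup>2 \<le> (1 / 2)\<^sup>2" by (metis abs_le_square_iff abs_of_nonneg divide_nonneg_nonneg zero_le_one zero_le_numeral)
    moreover have "(Im t)\<^sup>2 \<le> (1 / 2)\<^sup>2" using False t by (intro power_mono) (auto simp: uhp_def)
    ultimately have "(norm t)\<^sup>2 \<le> 1 / 2" unfolding cmod_power2 by (simp add: power2_eq_square)
    moreover have "(norm t)\<^sup>2 > 0" using t by (auto simp: uhp_def)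
    moreover have "Im (- 1 / t) = Im t / (norm t)\<^sup>2"
      using Im_moebius(2)[of 0 0 "-1" 1 t] t by simp
    moreover have "2 * Im \<tau> \<le> Im \<tau> / x" if "x \<le> 1 / 2" "0 < x" for x
      using that Suc.prems(1) mult_left_mono[of "2 * x" 1 "Im \<tau>"]
      by (simp add: pos_le_divide_eq uhp_def mult_ac)
    ultimately have "Im (- 1 / t) \<ge> 2 * Im \<tau>"
      using t(2) by metis
    then have "Im (- 1 / t) \<ge> (1 / 2) ^ Suc n" using Suc.prems by simp
    from Suc.IH[OF uhp_inversion[OF t(1)] this] obtain \<gamma> \<tau>'
      where g: "\<gamma> \<in> SL2Z" "\<tau>' \<in> uhp" "- 1 / t = moebius_act \<gamma> \<tau>'" "Im \<tau>' \<ge> 1 / 2" by blast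
    have "\<tau> = t + of_int m" by (simp add: t_def)
    also have "\<dots> = moebius_act (m, -1, 1, 0) (- 1 / t)"
      using t by (auto simp: field_simps)
    also have "\<dots> = moebius_act (mat_mul (m, -1, 1, 0) \<gamma>) \<tau>'"
      unfolding moebius_act_mat_mul[OF g(1,2)] g(3) ..
    finally show ?thesis
      using g by (intro bexI[of _ "mat_mul (m, -1, 1, 0) \<gamma>"] bexI[of _ \<tau>'] mat_mul_SL2Z) (auto simp: SL2Z_def)
  qed
qed

lemma SL2Z_reduction:
  assumes "\<tau> \<in> uhp"
  obtains \<gamma> \<tau>' where "\<gamma> \<in> SL2Z" "\<tau>' \<in> uhp" "\<tau> = moebius_act \<gamma> \<tau>'" "Im \<tau>' \<ge> 1 / 2"
proof -
  obtain n where "(1 / 2) ^ n < Im \<tau>"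
    using real_arch_pow_inv[of "Im \<tau>" "1 / 2"] assms by (auto simp: uhp_def)
  then have "(1 / 2) ^ Suc n \<le> Im \<tau>" by simp (use zero_le_power[of "1 / 2 :: real" n] in linarith)
  then show ?thesis using SL2Z_reduction_aux[OF assms] that by blast
qed

text \<open>The cusps of \<open>\<Gamma>\<^sub>0(8)\<close> are \<open>\<infinity>\<close>, \<open>0\<close>, \<open>1/2\<close> and \<open>1/4\<close>.\<close>

definition cusp_reps :: "mat2 set"
  where "cusp_reps = {(1, 0, 0, 1), (0, -1, 1, 0), (1, 0, 2, 1), (1, 0, 4, 1)}"

lemma cusp_reps_SL2Z: "\<rho> \<in> cusp_reps \<Longrightarrow> \<rho> \<in> SL2Z"
  by (auto simp: cusp_reps_def SL2Z_def)

lemma Gamma0_SL2Z: "\<delta> \<in> Gamma0 N \<Longrightarrow> \<delta> \<in> SL2Z"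
  by (auto simp: Gamma0_def SL2Z_def)

text \<open>The cusp is decided by gcd(c, 8). Odd squares are 1 modulo 8, so an odd number is its
  own inverse there, which yields explicit translations for gcd 1 and 2; for gcd 4 and 8 none is
  needed.\<close>

lemma cusp_decomposition:
  assumes "\<gamma> \<in> SL2Z"
  obtains \<delta> \<rho> j where "\<delta> \<in> Gamma0 8" "\<rho> \<in> cusp_reps" "\<gamma> = mat_mul (mat_mul \<delta> \<rho>) (1, j, 0, 1)"
proof -
  obtain a b c d where g: "\<gamma> = (a, b, c, d)" by (metis surj_pair)
  have det: "a * d - b * c = 1" using assms by (simp add: g SL2Z_def)
  have odd_d: "odd d" if "even c"
  proof
    assume "even d"
    then have "even (a * d - b * c)" using that by simp
    with det show False by (metis odd_one)
  qed
  have sq: "(8::int) dvd x * x - 1" if "odd x" for x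
  proof -
    from that obtain y where y: "x = 2 * y + 1" by (rule oddE)
    have "x * x - 1 = 4 * (y * (y + 1))" by (simp add: y algebra_simps)
    moreover obtain z where "y * (y + 1) = 2 * z"
      by (metis dvdE even_mult_iff even_plus_one_iff)
    ultimately show ?thesis by simp
  qed
  consider "odd c" | e where "c = 2 * e" "odd e" | e where "c = 4 * e" "odd e" | "8 dvd c"
  proof (cases "odd c")
    case False
    then obtain e where e: "c = 2 * e" by auto
    show ?thesis
    proof (cases "odd e")
      case False
      then obtain e' where e': "e = 2 * e'" by auto
      show ?thesis
      proof (cases "odd e'")
        case False
        then show ?thesis using e e' that(4) by auto
      qed (use e e' that(3) in auto)
    qed (use e that(2) in auto)
  qed (use that(1) in auto)
  then show ?thesis
  proof cases
    case 1
    \<comment> \<open>As c^2 is 1 modulo 8, j = dc solves d - jc = 0 modulo 8.\<close>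
    define j where "j = d * c"
    define b' where "b' = b - j * a"
    define d' where "d' = d - j * c"
    have "d' = - (d * (c * c - 1))" by (simp add: d'_def j_def algebra_simps)
    then have "8 dvd d'" using sq[OF 1] by simp
    moreover have "a * d' - b' * c = 1" using det by (simp add: b'_def d'_def algebra_simps)
    ultimately have "(- b', a, - d', c) \<in> Gamma0 8" by (simp add: Gamma0_def algebra_simps)
    moreover have "(0, -1, 1, 0) \<in> cusp_reps" by (simp add: cusp_reps_def)
    moreover have "\<gamma> = mat_mul (mat_mul (- b', a, - d', c) (0, -1, 1, 0)) (1, j, 0, 1)"
      by (simp add: g b'_def d'_def algebra_simps)
    ultimately show ?thesis by (rule that)
  next
    case (2 e)
    then have "odd d" using odd_d by simp
    then have "even (d - e)" using 2 by simp
    then obtain f where f: "d - e = 2 * f" by blast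
    \<comment> \<open>What must be divisible by 8 is c - 2(d - jc) = -4f + 4je, and j = fe turns
      this into 4f(e^2 - 1).\<close>
    define j where "j = f * e"
    define b' where "b' = b - j * a"
    define d' where "d' = d - j * c"
    have "c - 2 * d' = 4 * (f * (e * e - 1))"
      using f 2 by (simp add: d'_def j_def algebra_simps)
    then have "8 dvd c - 2 * d'" using sq[OF 2(2)] by simp
    moreover have "a * d' - b' * c = 1" using det by (simp add: b'_def d'_def algebra_simps)
    ultimately have "(a - 2 * b', b', c - 2 * d', d') \<in> Gamma0 8" by (simp add: Gamma0_def algebra_simps)
    moreover have "(1, 0, 2, 1) \<in> cusp_reps" by (simp add: cusp_reps_def)
    moreover have "\<gamma> = mat_mul (mat_mul (a - 2 * b', b', c - 2 * d', d') (1, 0, 2, 1)) (1, j, 0, 1)"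
      by (simp add: g b'_def d'_def algebra_simps)
    ultimately show ?thesis by (rule that)
  next
    case (3 e)
    then have "even (e - d)" using odd_d by simp
    then obtain f where "e - d = 2 * f" by blast
    then have "c - 4 * d = 8 * f" using 3 by simp
    then have "(a - 4 * b, b, c - 4 * d, d) \<in> Gamma0 8" using det by (simp add: Gamma0_def algebra_simps)
    moreover have "(1, 0, 4, 1) \<in> cusp_reps" by (simp add: cusp_reps_def)
    moreover have "\<gamma> = mat_mul (mat_mul (a - 4 * b, b, c - 4 * d, d) (1, 0, 4, 1)) (1, 0, 0, 1)"
      by (simp add: g algebra_simps)
    ultimately show ?thesis by (rule that)
  next
    case 4
    then have "\<gamma> \<in> Gamma0 8" using det by (simp add: Gamma0_def g)
    moreover have "(1, 0, 0, 1) \<in> cusp_reps" by (simp add: cusp_reps_def)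
    moreover have "\<gamma> = mat_mul (mat_mul \<gamma> (1, 0, 0, 1)) (1, 0, 0, 1)"
      by (simp add: g)
    ultimately show ?thesis by (rule that)
  qed
qed

lemma translation_SL2Z: "(1, j, 0, 1) \<in> SL2Z"
  by (simp add: SL2Z_def)

text \<open>Regularity at all cusps reduces to the four representatives: the factor from
  \<open>Gamma0 8\<close> contributes only a constant, and the translation a rotation of the
  disc.\<close>

lemma cuspval_slash:
  assumes law: "\<And>a b c d \<tau>. (a, b, c, d) \<in> Gamma0 8 \<Longrightarrow> \<tau> \<in> uhp \<Longrightarrow>
      f (moebius_act (a, b, c, d) \<tau>) = \<psi> d * (of_int c * \<tau> + of_int d) powi k * f \<tau>"
    and reps: "\<And>\<rho>. \<rho> \<in> cusp_reps \<Longrightarrow> \<exists>v. cuspval (slash k f \<rho>) v"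
    and \<gamma>: "\<gamma> \<in> SL2Z"
  shows "\<exists>v. cuspval (slash k f \<gamma>) v"
proof -
  obtain \<delta> \<rho> j where d: "\<delta> \<in> Gamma0 8" and \<rho>: "\<rho> \<in> cusp_reps" and g: "\<gamma> = mat_mul (mat_mul \<delta> \<rho>) (1, j, 0, 1)"
    using cusp_decomposition[OF \<gamma>] .
  obtain v where v: "cuspval (slash k f \<rho>) v" using reps[OF \<rho>] by blast
  obtain a b c d' where de: "\<delta> = (a, b, c, d')" by (metis surj_pair)
  have "slash k f \<gamma> \<tau> = \<psi> d' * slash k f \<rho> (\<tau> + of_real (of_int j))" if t: "\<tau> \<in> uhp" for \<tau>
  proof -
    define t' where "t' = \<tau> + of_int j"
    have t': "t' \<in> uhp" using t by (simp add: t'_def uhp_def)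
    have T: "moebius_act (1, j, 0, 1) \<tau> = t'" "autf (1, j, 0, 1) \<tau> = 1" by (simp_all add: t'_def)
    note \<rho>S = cusp_reps_SL2Z[OF \<rho>]
    define s where "s = moebius_act \<rho> t'"
    have s: "s \<in> uhp" unfolding s_def by (rule moebius_act_uhp[OF \<rho>S t'])
    have m: "moebius_act \<gamma> \<tau> = moebius_act \<delta> s"
      unfolding g moebius_act_mat_mul[OF translation_SL2Z t] T moebius_act_mat_mul[OF \<rho>S t'] s_def ..
    have j: "autf \<gamma> \<tau> = autf \<delta> s * autf \<rho> t'"
      unfolding g autf_mat_mul[OF translation_SL2Z t] T autf_mat_mul[OF \<rho>S t'] s_def by simp
    have nz: "autf \<delta> s \<noteq> 0" using autf_nonzero[OF Gamma0_SL2Z[OF d] s] .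
    have fl: "f (moebius_act \<delta> s) = \<psi> d' * autf \<delta> s powi k * f s"
      using law[OF d[unfolded de] s] by (simp add: de)
    have "slash k f \<gamma> \<tau> = autf \<delta> s powi (- k) * autf \<rho> t' powi (- k) * (\<psi> d' * autf \<delta> s powi k * f s)"
      unfolding slash_conv_autf m j fl power_int_mult_distrib ..
    also have "\<dots> = (autf \<delta> s powi (- k) * autf \<delta> s powi k) * (\<psi> d' * (autf \<rho> t' powi (- k) * f s))"
      by (simp only: mult_ac)
    also have "autf \<delta> s powi (- k) * autf \<delta> s powi k = 1"
      using nz by (simp add: power_int_minus)
    finally show ?thesis by (simp add: slash_conv_autf s_def t'_def)
  qed
  moreover have "cuspval (\<lambda>\<tau>. \<psi> d' * slash k f \<rho> (\<tau> + of_real (of_int j))) (\<psi> d' * v)"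
    by (intro cuspval_cmult cuspval_shift v)
  ultimately show ?thesis using cuspval_cong by blast
qed

lemma modular_forms_iff:
  "f \<in> modular_forms k N \<psi> \<longleftrightarrow> f holomorphic_on uhp \<and> (\<forall>\<tau>. \<tau> \<notin> uhp \<longrightarrow> f \<tau> = 0) \<and>
     (\<forall>(a, b, c, d) \<in> Gamma0 N. \<forall>\<tau>\<in>uhp.
        f (moebius_act (a, b, c, d) \<tau>) = \<psi> d * (of_int c * \<tau> + of_int d) powi k * f \<tau>) \<and>
     (\<forall>\<gamma>\<in>SL2Z. \<exists>v. cuspval (slash k f \<gamma>) v)"
proof -
  have "(\<exists>v. cuspval g v) \<longleftrightarrow> (\<exists>h u. has_fourier_expansion g h u)" for g
    unfolding cuspval_iff by blast
  then show ?thesis unfolding modular_forms_def by simp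
qed

lemma cusp_forms_iff:
  "f \<in> cusp_forms k N \<psi> \<longleftrightarrow> f \<in> modular_forms k N \<psi> \<and> (\<forall>\<gamma>\<in>SL2Z. cuspval (slash k f \<gamma>) 0)"
  unfolding cusp_forms_def cuspval_iff by auto

lemma subspace_modular_forms: "cfun.subspace (modular_forms k N \<psi>)"
proof (rule cfun.subspaceI)
  show "0 \<in> modular_forms k N \<psi>"
  proof -
    have "slash k 0 \<gamma> = (\<lambda>_. 0)" for \<gamma> by (auto simp: slash_conv_autf)
    then show ?thesis using cuspval_const[of 0] by (auto simp: modular_forms_iff zero_fun_def)
  qed
next
  fix f g assume f: "f \<in> modular_forms k N \<psi>" and g: "g \<in> modular_forms k N \<psi>"
  have "\<exists>v. cuspval (slash k (f + g) \<gamma>) v" if gS: "\<gamma> \<in> SL2Z" for \<gamma>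
  proof -
    have "slash k (f + g) \<gamma> = (\<lambda>\<tau>. slash k f \<gamma> \<tau> + slash k g \<gamma> \<tau>)"
      by (auto simp: slash_conv_autf algebra_simps)
    moreover obtain v where "cuspval (slash k f \<gamma>) v"
      using f gS by (auto simp: modular_forms_iff)
    moreover obtain w where "cuspval (slash k g \<gamma>) w"
      using g gS by (auto simp: modular_forms_iff)
    ultimately show ?thesis using cuspval_add by fastforce
  qed
  moreover have "(f + g) holomorphic_on uhp"
    using f g unfolding plus_fun_def by (auto simp: modular_forms_iff intro!: holomorphic_intros)
  ultimately show "f + g \<in> modular_forms k N \<psi>"
    using f g unfolding modular_forms_iff by (auto simp: algebra_simps split: prod.splits)
next
  fix x f assume f: "f \<in> modular_forms k N \<psi>"
  have "\<exists>v. cuspval (slash k (cfun_scale x f) \<gamma>) v" if gS: "\<gamma> \<in> SL2Z" for \<gamma>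
  proof -
    have "slash k (cfun_scale x f) \<gamma> = (\<lambda>\<tau>. x * slash k f \<gamma> \<tau>)"
      by (auto simp: slash_conv_autf cfun_scale_def)
    moreover obtain v where "cuspval (slash k f \<gamma>) v"
      using f gS by (auto simp: modular_forms_iff)
    ultimately show ?thesis using cuspval_cmult by fastforce
  qed
  moreover have "cfun_scale x f holomorphic_on uhp"
    using f unfolding cfun_scale_def by (auto simp: modular_forms_iff intro!: holomorphic_intros)
  ultimately show "cfun_scale x f \<in> modular_forms k N \<psi>"
    using f unfolding modular_forms_iff by (auto simp: cfun_scale_def)
qed

section \<open>Cusp values and the maximum principle\<close>

text \<open>The maximum of the modulus over the four cusps, on the closed discs corresponding to
  \<open>Im \<tau> \<ge> 1/2\<close>, is a global maximum by reduction theory, and it is attained at an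
  interior point of one of the unit discs.\<close>

lemma Gamma0_8_invariant_vanishes:
  assumes inv: "\<And>a b c d \<tau>. (a, b, c, d) \<in> Gamma0 8 \<Longrightarrow> \<tau> \<in> uhp \<Longrightarrow> f (moebius_act (a, b, c, d) \<tau>) = f \<tau>"
    and reps: "\<And>\<rho>. \<rho> \<in> cusp_reps \<Longrightarrow> \<exists>v. cuspval (\<lambda>\<tau>. f (moebius_act \<rho> \<tau>)) v"
    and zero: "cuspval f 0" and "\<tau> \<in> uhp"
  shows "f \<tau> = 0"
proof -
  have "\<forall>\<rho>\<in>cusp_reps. \<exists>h p. fourier_at (\<lambda>\<tau>. f (moebius_act \<rho> \<tau>)) h p"
    using reps unfolding cuspval_def by blast
  then obtain h p where hp: "\<And>\<rho>. \<rho> \<in> cusp_reps \<Longrightarrow> fourier_at (\<lambda>\<tau>. f (moebius_act \<rho> \<tau>)) (h \<rho>) (p \<rho>)"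
    by metis
  \<comment> \<open>The modulus of \<open>qexp h\<close> at height 1/2: points at that height or
    above land in the closed disc of this radius, which is smaller than 1.\<close>
  define r where "r = (\<lambda>\<rho>. exp (- (pi / h \<rho>)))"
  have h: "h \<rho> > 0" and hol: "p \<rho> holomorphic_on ball 0 1"
    and fp: "\<And>\<tau>. \<tau> \<in> uhp \<Longrightarrow> f (moebius_act \<rho> \<tau>) = p \<rho> (qexp (h \<rho>) \<tau>)" if "\<rho> \<in> cusp_reps" for \<rho>
    using hp[OF that] by (auto simp: fourier_at_def)
  have r: "0 < r \<rho>" "r \<rho> < 1" if "\<rho> \<in> cusp_reps" for \<rho>
    using h[OF that] by (simp_all add: r_def)
  have "\<exists>x\<in>cball 0 (r \<rho>). \<forall>y\<in>cball 0 (r \<rho>). norm (p \<rho> y) \<le> norm (p \<rho> x)" if "\<rho> \<in> cusp_reps" for \<rho>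
  proof (rule continuous_attains_sup)
    have "continuous_on (ball 0 1) (p \<rho>)" by (rule holomorphic_on_imp_continuous_on[OF hol[OF that]])
    then have "continuous_on (cball 0 (r \<rho>)) (p \<rho>)"
      by (rule continuous_on_subset) (use r[OF that] in auto)
    then show "continuous_on (cball 0 (r \<rho>)) (\<lambda>x. norm (p \<rho> x))" by (intro continuous_intros)
  qed (use r[OF that] in auto)
  then obtain x where x: "\<And>\<rho>. \<rho> \<in> cusp_reps \<Longrightarrow> x \<rho> \<in> cball 0 (r \<rho>)"
    "\<And>\<rho> y. \<rho> \<in> cusp_reps \<Longrightarrow> y \<in> cball 0 (r \<rho>) \<Longrightarrow> norm (p \<rho> y) \<le> norm (p \<rho> (x \<rho>))"
    by metis
  define g where "g = (\<lambda>\<rho>. norm (p \<rho> (x \<rho>)))"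
  have fin: "finite (g ` cusp_reps)" "g ` cusp_reps \<noteq> {}" by (simp_all add: cusp_reps_def)
  obtain \<rho> where \<rho>: "\<rho> \<in> cusp_reps" "g \<rho> = Max (g ` cusp_reps)"
    using Max_in[OF fin] by auto
  have max: "g \<rho>' \<le> g \<rho>" if "\<rho>' \<in> cusp_reps" for \<rho>'
    unfolding \<rho>(2) using fin that by (intro Max_ge) auto
  have bound: "norm (f \<tau>) \<le> g \<rho>" if t: "\<tau> \<in> uhp" for \<tau>
  proof -
    obtain \<gamma> \<tau>' where g: "\<gamma> \<in> SL2Z" "\<tau>' \<in> uhp" "\<tau> = moebius_act \<gamma> \<tau>'" "Im \<tau>' \<ge> 1 / 2"
      using SL2Z_reduction[OF t] .
    obtain \<delta> \<rho>' j where d: "\<delta> \<in> Gamma0 8" "\<rho>' \<in> cusp_reps" "\<gamma> = mat_mul (mat_mul \<delta> \<rho>') (1, j, 0, 1)"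
      using cusp_decomposition[OF g(1)] .
    define t where "t = moebius_act (1, j, 0, 1) \<tau>'"
    have t: "t \<in> uhp" unfolding t_def by (rule moebius_act_uhp[OF translation_SL2Z g(2)])
    have "Im t = Im \<tau>'" by (simp add: t_def)
    have "\<tau> = moebius_act \<delta> (moebius_act \<rho>' t)"
      unfolding g(3) d(3) moebius_act_mat_mul[OF translation_SL2Z g(2)] t_def[symmetric]
        moebius_act_mat_mul[OF cusp_reps_SL2Z[OF d(2)] t] ..
    moreover obtain a b c d' where "\<delta> = (a, b, c, d')" by (metis surj_pair)
    ultimately have "f \<tau> = f (moebius_act \<rho>' t)"
      using inv d(1) moebius_act_uhp[OF cusp_reps_SL2Z[OF d(2)] t] by metis
    also have "\<dots> = p \<rho>' (qexp (h \<rho>') t)" by (rule fp[OF d(2) t])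
    finally have "f \<tau> = p \<rho>' (qexp (h \<rho>') t)" .
    moreover have "pi / real (h \<rho>') \<le> 2 * pi * Im t / real (h \<rho>')"
      using g(4) \<open>Im t = Im \<tau>'\<close> h[OF d(2)] by (intro divide_right_mono) auto
    then have "qexp (h \<rho>') t \<in> cball 0 (r \<rho>')"
      by (simp add: norm_qexp r_def)
    ultimately show ?thesis using x(2)[OF d(2)] max[OF d(2)] by (fastforce simp: g_def)
  qed
  have "p \<rho> constant_on ball 0 1"
  proof (rule maximum_modulus_principle[OF hol[OF \<rho>(1)]])
    show "x \<rho> \<in> ball 0 1" using x(1)[OF \<rho>(1)] r[OF \<rho>(1)] by auto
    fix y :: complex assume y: "y \<in> ball 0 1"
    show "norm (p \<rho> y) \<le> norm (p \<rho> (x \<rho>))"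
    proof (cases "y = 0")
      case True
      then show ?thesis using x(2)[OF \<rho>(1), of 0] r[OF \<rho>(1)] by simp
    next
      case False
      then obtain \<tau> where t: "\<tau> \<in> uhp" "qexp (h \<rho>) \<tau> = y"
        using qexp_surj[OF h[OF \<rho>(1)], of y] y by auto
      then show ?thesis
        using bound[OF moebius_act_uhp[OF cusp_reps_SL2Z[OF \<rho>(1)] t(1)]] fp[OF \<rho>(1) t(1)] by (simp add: g_def)
    qed
  qed auto
  then obtain C where C: "\<And>y. y \<in> ball 0 1 \<Longrightarrow> p \<rho> y = C" by (auto simp: constant_on_def)
  \<comment> \<open>The matrix \<open>\<rho>\<close> is invertible on the half-plane, so constancy
    of f composed with it passes to f itself; the value is then read at infinity.\<close>
  have const: "f \<tau> = C" if t: "\<tau> \<in> uhp" for \<tau>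
  proof -
    obtain a b c d where r: "\<rho> = (a, b, c, d)" by (metis surj_pair)
    have det: "a * d - b * c = 1" using cusp_reps_SL2Z[OF \<rho>(1)] by (simp add: r SL2Z_def)
    then have inv: "(d, - b, - c, a) \<in> SL2Z" by (simp add: SL2Z_def mult.commute)
    define s where "s = moebius_act (d, - b, - c, a) \<tau>"
    have s: "s \<in> uhp" unfolding s_def by (rule moebius_act_uhp[OF inv t])
    have "mat_mul \<rho> (d, - b, - c, a) = (1, 0, 0, 1)" using det by (simp add: r algebra_simps)
    then have "moebius_act \<rho> s = \<tau>" using moebius_act_mat_mul[OF inv t, of \<rho>] by (simp add: s_def)
    then show ?thesis using fp[OF \<rho>(1) s] C qexp_in_ball[OF h[OF \<rho>(1)] s] by metis
  qed
  have "cuspval f C" by (rule cuspval_cong[OF cuspval_const const])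
  then have "C = 0" using zero by (rule cuspval_unique)
  then show ?thesis using const assms(4) by simp
qed

section \<open>Values of U and Z at the four cusps\<close>

lemma slash_1_eq:
  assumes "\<rho> \<in> SL2Z" "\<tau> \<in> uhp" "f (moebius_act \<rho> \<tau>) = autf \<rho> \<tau> * x"
  shows "slash 1 f \<rho> \<tau> = x"
  using assms autf_nonzero[OF assms(1,2)] by (simp add: slash_conv_autf power_int_minus)

lemma cuspval_slash_UZ_infinity:
  "cuspval (slash 1 form_U (1, 0, 0, 1)) 1" "cuspval (slash 1 form_Z (1, 0, 0, 1)) 0"
  using cuspval_cong[OF cuspval_U, of "slash 1 form_U (1, 0, 0, 1)"] cuspval_cong[OF cuspval_Z, of "slash 1 form_Z (1, 0, 0, 1)"]
  by simp_all

lemma cuspval_slash_UZ_0: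
  "cuspval (slash 1 form_U (0, -1, 1, 0)) (- \<i> / 4)" "cuspval (slash 1 form_Z (0, -1, 1, 0)) (- \<i> / 16)"
proof -
  have S: "(0, -1, 1, 0) \<in> SL2Z" by (simp add: SL2Z_def)
  have "cuspval (\<lambda>\<tau>. - \<i> / 4 * th3 (\<tau> / of_nat 4) ^ 2) (- \<i> / 4 * 1 ^ 2)"
    by (intro cuspval_cmult cuspval_power cuspval_scale[OF cuspval_th3]) simp
  then have "cuspval (slash 1 form_U (0, -1, 1, 0)) (- \<i> / 4 * 1 ^ 2)"
    by (rule cuspval_cong) (rule slash_1_eq[OF S], use UZ_S(1) in auto)
  then show "cuspval (slash 1 form_U (0, -1, 1, 0)) (- \<i> / 4)" by simp
  have "cuspval (\<lambda>\<tau>. - \<i> / 16 * th4 (\<tau> / of_nat 4) ^ 2) (- \<i> / 16 * 1 ^ 2)"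
    by (intro cuspval_cmult cuspval_power cuspval_scale[OF cuspval_th4]) simp
  then have "cuspval (slash 1 form_Z (0, -1, 1, 0)) (- \<i> / 16 * 1 ^ 2)"
    by (rule cuspval_cong) (rule slash_1_eq[OF S], use UZ_S(2) in auto)
  then show "cuspval (slash 1 form_Z (0, -1, 1, 0)) (- \<i> / 16)" by simp
qed

lemma cuspval_slash_UZ_half:
  "cuspval (slash 1 form_U (1, 0, 2, 1)) (- \<i> / 2)" "cuspval (slash 1 form_Z (1, 0, 2, 1)) (\<i> / 8)"
proof -
  have S: "(1, 0, 2, 1) \<in> SL2Z" by (simp add: SL2Z_def)
  have "cuspval (\<lambda>\<tau>. - \<i> / 2 * th3 (\<tau> + of_real (1 / 2)) ^ 2) (- \<i> / 2 * 1 ^ 2)"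
    by (intro cuspval_cmult cuspval_power cuspval_shift[OF cuspval_th3])
  then have "cuspval (slash 1 form_U (1, 0, 2, 1)) (- \<i> / 2 * 1 ^ 2)"
    by (rule cuspval_cong) (rule slash_1_eq[OF S], use UZ_cusp_half(1) in auto)
  then show "cuspval (slash 1 form_U (1, 0, 2, 1)) (- \<i> / 2)" by simp
  have "cuspval (\<lambda>\<tau>. \<i> / 8 * th4 (\<tau> + of_real (1 / 2)) ^ 2) (\<i> / 8 * 1 ^ 2)"
    by (intro cuspval_cmult cuspval_power cuspval_shift[OF cuspval_th4])
  then have "cuspval (slash 1 form_Z (1, 0, 2, 1)) (\<i> / 8 * 1 ^ 2)"
    by (rule cuspval_cong) (rule slash_1_eq[OF S], use UZ_cusp_half(2) in auto)
  then show "cuspval (slash 1 form_Z (1, 0, 2, 1)) (\<i> / 8)" by simp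
qed

lemma cuspval_slash_UZ_quarter:
  "cuspval (slash 1 form_U (1, 0, 4, 1)) 0" "cuspval (slash 1 form_Z (1, 0, 4, 1)) (1 / 4)"
proof -
  have S: "(1, 0, 4, 1) \<in> SL2Z" by (simp add: SL2Z_def)
  have "cuspval (\<lambda>\<tau>. 4 * form_Z \<tau>) (4 * 0)" by (intro cuspval_cmult cuspval_Z)
  then have "cuspval (slash 1 form_U (1, 0, 4, 1)) (4 * 0)"
    by (rule cuspval_cong) (rule slash_1_eq[OF S], use UZ_cusp_quarter(1) in auto)
  then show "cuspval (slash 1 form_U (1, 0, 4, 1)) 0" by simp
  have "cuspval (\<lambda>\<tau>. 1 / 4 * form_U \<tau>) (1 / 4 * 1)" by (intro cuspval_cmult cuspval_U)
  then have "cuspval (slash 1 form_Z (1, 0, 4, 1)) (1 / 4 * 1)"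
    by (rule cuspval_cong) (rule slash_1_eq[OF S], use UZ_cusp_quarter(2) in auto)
  then show "cuspval (slash 1 form_Z (1, 0, 4, 1)) (1 / 4)" by simp
qed

lemmas cuspval_slash_UZ = cuspval_slash_UZ_infinity cuspval_slash_UZ_0 cuspval_slash_UZ_half cuspval_slash_UZ_quarter

lemma cuspval_slash_U: "\<rho> \<in> cusp_reps \<Longrightarrow> \<exists>v. cuspval (slash 1 form_U \<rho>) v"
  using cuspval_slash_UZ unfolding cusp_reps_def by blast

lemma cuspval_slash_Z: "\<rho> \<in> cusp_reps \<Longrightarrow> \<exists>v. cuspval (slash 1 form_Z \<rho>) v"
  using cuspval_slash_UZ unfolding cusp_reps_def by blast

text \<open>This permits division by powers of Z at every cusp other than infinity.\<close>

lemma cuspval_slash_Z_nonzero: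
  assumes "\<rho> \<in> cusp_reps" "\<rho> \<noteq> (1, 0, 0, 1)"
  obtains z where "cuspval (slash 1 form_Z \<rho>) z" "z \<noteq> 0"
proof -
  consider "\<rho> = (0, -1, 1, 0)" | "\<rho> = (1, 0, 2, 1)" | "\<rho> = (1, 0, 4, 1)"
    using assms by (auto simp: cusp_reps_def)
  then show ?thesis
  proof cases
    case 1
    then show ?thesis using that[of "- \<i> / 16"] cuspval_slash_UZ_0(2) by simp
  next
    case 2
    then show ?thesis using that[of "\<i> / 8"] cuspval_slash_UZ_half(2) by simp
  next
    case 3
    then show ?thesis using that[of "1 / 4"] cuspval_slash_UZ_quarter(2) by simp
  qed
qed

section \<open>Monomials in U and Z\<close>

definition UZ_monomial :: "nat \<Rightarrow> nat \<Rightarrow> complex \<Rightarrow> complex"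
  where "UZ_monomial n l \<tau> = form_U \<tau> ^ (n - l) * form_Z \<tau> ^ l"

lemma slash_monomial:
  assumes "\<rho> \<in> SL2Z" "\<tau> \<in> uhp" "l \<le> n"
  shows "slash (int n) (UZ_monomial n l) \<rho> \<tau> = slash 1 form_U \<rho> \<tau> ^ (n - l) * slash 1 form_Z \<rho> \<tau> ^ l"
proof -
  have "autf \<rho> \<tau> powi (- int n) = inverse (autf \<rho> \<tau>) ^ (n - l) * inverse (autf \<rho> \<tau>) ^ l"
    by (subst power_add[symmetric]) (simp add: assms(3) power_int_minus power_inverse)
  then show ?thesis
    by (simp add: slash_conv_autf UZ_monomial_def power_mult_distrib power_int_minus)
qed

text \<open>The values are 0, 1 and -1. Here the oddness of the weight enters: it gives all
  monomials the Nebentypus of U and Z themselves.\<close>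

lemma chi_minus4_odd_power: "odd n \<Longrightarrow> chi_minus4 d ^ n = chi_minus4 d"
  by (auto simp: chi_minus4_def odd_pos)

lemma UZ_monomial_law:
  assumes "(a, b, c, d) \<in> Gamma0 8" "\<tau> \<in> uhp" "l \<le> n" "odd n"
  shows "UZ_monomial n l (moebius_act (a, b, c, d) \<tau>)
     = chi_minus4 d * (of_int c * \<tau> + of_int d) powi int n * UZ_monomial n l \<tau>"
proof -
  have "(chi_minus4 d * (of_int c * \<tau> + of_int d)) ^ (n - l) * (chi_minus4 d * (of_int c * \<tau> + of_int d)) ^ l
     = chi_minus4 d ^ n * (of_int c * \<tau> + of_int d) ^ n"
    by (subst power_add[symmetric]) (simp add: assms(3) power_mult_distrib)
  then show ?thesis
    unfolding UZ_monomial_def UZ_Gamma0_8[OF assms(1,2)]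
    by (simp add: chi_minus4_odd_power[OF assms(4)] power_mult_distrib mult_ac del: moebius_act.simps)
qed

lemma UZ_monomial_modular:
  assumes "l \<le> n" "odd n"
  shows "UZ_monomial n l \<in> modular_forms (int n) 8 chi_minus4"
  unfolding modular_forms_iff
proof (intro conjI ballI)
  show "UZ_monomial n l holomorphic_on uhp"
    unfolding UZ_monomial_def by (intro holomorphic_intros U_holomorphic Z_holomorphic)
  \<comment> \<open>Off the half-plane the monomial is 0^(n-l) * 0^l, which would be 1 for n =
    0.\<close>
  have "n > 0" using assms by (auto intro: Nat.gr0I)
  then show "\<forall>\<tau>. \<tau> \<notin> uhp \<longrightarrow> UZ_monomial n l \<tau> = 0"
    using assms by (auto simp: UZ_monomial_def form_U_def form_Z_def power_0_left)
  show "case x of (a, b, c, d) \<Rightarrow> \<forall>\<tau>\<in>uhp. UZ_monomial n l (moebius_act (a, b, c, d) \<tau>)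
     = chi_minus4 d * (of_int c * \<tau> + of_int d) powi int n * UZ_monomial n l \<tau>" if "x \<in> Gamma0 8" for x
    using UZ_monomial_law[OF _ _ assms] that by (auto simp del: moebius_act.simps split: prod.splits)
  show "\<exists>v. cuspval (slash (int n) (UZ_monomial n l) \<gamma>) v" if "\<gamma> \<in> SL2Z" for \<gamma>
  proof (rule cuspval_slash[OF _ _ that])
    fix \<rho> assume \<rho>: "\<rho> \<in> cusp_reps"
    obtain u z where "cuspval (slash 1 form_U \<rho>) u" "cuspval (slash 1 form_Z \<rho>) z"
      using cuspval_slash_U[OF \<rho>] cuspval_slash_Z[OF \<rho>] by blast
    then have "cuspval (\<lambda>\<tau>. slash 1 form_U \<rho> \<tau> ^ (n - l) * slash 1 form_Z \<rho> \<tau> ^ l) (u ^ (n - l) * z ^ l)"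
      by (intro cuspval_mult cuspval_power)
    then have "cuspval (slash (int n) (UZ_monomial n l) \<rho>) (u ^ (n - l) * z ^ l)"
      by (rule cuspval_cong) (rule slash_monomial[OF cusp_reps_SL2Z[OF \<rho>] _ assms(1)])
    then show "\<exists>v. cuspval (slash (int n) (UZ_monomial n l) \<rho>) v" by blast
  qed (rule UZ_monomial_law[OF _ _ assms])
qed

section \<open>Modular forms as homogeneous polynomials\<close>

text \<open>Once the coefficients below l are known to vanish, Z^l can be divided out since Z has no
  zeros; the value at infinity, where U is 1 and Z is 0, is then c(l).\<close>

lemma UZ_monomials_independent:
  assumes zero: "\<And>\<tau>. \<tau> \<in> uhp \<Longrightarrow> (\<Sum>l\<le>n. c l * UZ_monomial n l \<tau>) = 0"
  shows "l \<le> n \<Longrightarrow> c l = 0"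
proof (induction l rule: less_induct)
  case (less l)
  define S where "S = (\<lambda>\<tau>. \<Sum>j\<in>{l..n}. c j * (form_U \<tau> ^ (n - j) * form_Z \<tau> ^ (j - l)))"
  have "cuspval S (\<Sum>j\<in>{l..n}. c j * (1 ^ (n - j) * 0 ^ (j - l)))"
    unfolding S_def by (intro cuspval_sum cuspval_cmult cuspval_mult cuspval_power cuspval_U cuspval_Z)
  also have "(\<Sum>j\<in>{l..n}. c j * (1 ^ (n - j) * 0 ^ (j - l))) = (\<Sum>j\<in>{l..n}. if j = l then c l else 0)"
    by (intro sum.cong) (auto simp: power_0_left)
  also have "\<dots> = c l" using less.prems by simp
  finally have 1: "cuspval S (c l)" .
  have "S \<tau> = 0" if t: "\<tau> \<in> uhp" for \<tau>
  proof -
    have "form_Z \<tau> ^ l * S \<tau> = (\<Sum>j\<in>{l..n}. c j * UZ_monomial n j \<tau>)"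
      unfolding S_def sum_distrib_left
    proof (intro sum.cong refl)
      fix j assume "j \<in> {l..n}"
      then have "form_Z \<tau> ^ j = form_Z \<tau> ^ l * form_Z \<tau> ^ (j - l)" by (simp flip: power_add)
      then show "form_Z \<tau> ^ l * (c j * (form_U \<tau> ^ (n - j) * form_Z \<tau> ^ (j - l))) = c j * UZ_monomial n j \<tau>"
        by (simp add: UZ_monomial_def)
    qed
    also have "\<dots> = (\<Sum>j\<le>n. c j * UZ_monomial n j \<tau>)"
      by (rule sum.mono_neutral_left) (use less.IH in \<open>auto simp: not_le\<close>)
    also have "\<dots> = 0" by (rule zero[OF t])
    finally show ?thesis using Z_nonzero[OF t] by simp
  qed
  then have "cuspval S 0" by (intro cuspval_cong[OF cuspval_const])
  with 1 show ?case by (rule cuspval_unique)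
qed

lemma holomorphic_factor_zero:
  assumes "p holomorphic_on ball 0 1" "p 0 = (0::complex)"
  obtains r where "r holomorphic_on ball 0 1" "\<And>x. p x = x * r x"
proof
  show "(\<lambda>z. if z = 0 then deriv p 0 else (p z - p 0) / (z - 0)) holomorphic_on ball 0 1"
    using assms by (intro pole_lemma_open) auto
qed (use assms in auto)

text \<open>The monomial with index N begins with q^N and leading coefficient 1, so the coefficients
  are found successively from a triangular system. The next one is \<open>r 0\<close>, and the
  difference gains a factor q.\<close>

lemma subtract_monomials:
  assumes "fourier_at g 1 p" "N \<le> Suc n"
  shows "\<exists>c r. r holomorphic_on ball 0 1 \<and>
    (\<forall>\<tau>\<in>uhp. g \<tau> - (\<Sum>l<N. c l * UZ_monomial n l \<tau>) = qexp 1 \<tau> ^ N * r (qexp 1 \<tau>))"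
  using assms(2)
proof (induction N)
  case 0
  then show ?case using assms(1) by (intro exI[of _ "\<lambda>_. 0"] exI[of _ p]) (auto simp: fourier_at_def)
next
  case (Suc N)
  then obtain c r where r: "r holomorphic_on ball 0 1"
    and eq: "\<And>\<tau>. \<tau> \<in> uhp \<Longrightarrow> g \<tau> - (\<Sum>l<N. c l * UZ_monomial n l \<tau>) = qexp 1 \<tau> ^ N * r (qexp 1 \<tau>)"
    by auto
  define m where "m = (\<lambda>x::complex. (phi (x ^ 2) ^ 2) ^ (n - N) * (psi (x ^ 4) ^ 2) ^ N)"
  have m: "m holomorphic_on ball 0 1" unfolding m_def
    by (intro holomorphic_intros holomorphic_on_unit_ball_power phi_holomorphic psi_holomorphic) auto
  have m0: "m 0 = 1" by (simp add: m_def)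
  have um: "UZ_monomial n N \<tau> = qexp 1 \<tau> ^ N * m (qexp 1 \<tau>)" if "\<tau> \<in> uhp" for \<tau>
    using fourier_at_U fourier_at_Z that
    by (simp add: fourier_at_def UZ_monomial_def m_def power_mult_distrib)
  have "(\<lambda>x. r x - r 0 * m x) holomorphic_on ball 0 1" using r m by (intro holomorphic_intros)
  then obtain s where s: "s holomorphic_on ball 0 1" "\<And>x. r x - r 0 * m x = x * s x"
    by (rule holomorphic_factor_zero) (use m0 in auto)
  have "g \<tau> - (\<Sum>l<Suc N. (c(N := r 0)) l * UZ_monomial n l \<tau>) = qexp 1 \<tau> ^ Suc N * s (qexp 1 \<tau>)"
    if t: "\<tau> \<in> uhp" for \<tau>
  proof -
    have "(\<Sum>l<Suc N. (c(N := r 0)) l * UZ_monomial n l \<tau>) = (\<Sum>l<N. c l * UZ_monomial n l \<tau>) + r 0 * UZ_monomial n N \<tau>"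
      by simp
    then have "g \<tau> - (\<Sum>l<Suc N. (c(N := r 0)) l * UZ_monomial n l \<tau>) = qexp 1 \<tau> ^ N * (r (qexp 1 \<tau>) - r 0 * m (qexp 1 \<tau>))"
      using eq[OF t] um[OF t] by (simp add: algebra_simps)
    then show ?thesis by (simp add: s(2))
  qed
  then show ?case using s(1) by blast
qed

lemma fun_sum_apply: "(\<Sum>i\<in>I. f i) x = (\<Sum>i\<in>I. f i (x :: complex) :: complex)"
  by (induction I rule: infinite_finite_induct) auto

theorem modular_form_eq_UZ_polynomial:
  assumes g: "g \<in> modular_forms (int n) 8 chi_minus4" and "odd n"
  obtains c where "\<And>\<tau>. g \<tau> = (\<Sum>l\<le>n. c l * UZ_monomial n l \<tau>)"
proof -
  \<comment> \<open>Translation by 1 lies in \<open>Gamma0 8\<close> and has d = 1, so g has period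
    1 and expands in q itself.\<close>
  have one: "(1, 1, 0, 1) \<in> Gamma0 8" and SI: "(1, 0, 0, 1) \<in> SL2Z"
    by (simp_all add: Gamma0_def SL2Z_def)
  obtain v where "cuspval (slash (int n) g (1, 0, 0, 1)) v"
    using g SI by (auto simp: modular_forms_iff)
  then have "cuspval g v" by (rule cuspval_cong) simp
  moreover have "g (\<tau> + 1) = g \<tau>" if "\<tau> \<in> uhp" for \<tau>
    using g one that by (fastforce simp: modular_forms_iff chi_minus4_def)
  ultimately obtain p where "fourier_at g 1 p" using fourier_at_period_1 by blast
  then obtain c r where r: "r holomorphic_on ball 0 1"
    and eq: "\<And>\<tau>. \<tau> \<in> uhp \<Longrightarrow> g \<tau> - (\<Sum>l<Suc n. c l * UZ_monomial n l \<tau>) = qexp 1 \<tau> ^ Suc n * r (qexp 1 \<tau>)"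
    using subtract_monomials[of g p "Suc n" n] by auto
  define G where "G = g - (\<Sum>l\<in>{..n}. cfun_scale (c l) (UZ_monomial n l))"
  have G_eq: "G \<tau> = g \<tau> - (\<Sum>l\<le>n. c l * UZ_monomial n l \<tau>)" for \<tau>
    by (simp add: G_def fun_sum_apply cfun_scale_def)
  have G: "G \<in> modular_forms (int n) 8 chi_minus4"
    unfolding G_def using \<open>odd n\<close>
    by (intro cfun.subspace_diff[OF subspace_modular_forms] cfun.subspace_sum[OF subspace_modular_forms]
          cfun.subspace_scale[OF subspace_modular_forms] g UZ_monomial_modular) auto
  define f where "f = (\<lambda>\<tau>. G \<tau> / form_Z \<tau> ^ n)"
  \<comment> \<open>The numerator is divisible by q^(n+1), while Z^n has exact order n; the surplus
    factor q makes the value 0.\<close>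
  have f0: "cuspval f 0"
  proof -
    have ps: "psi (x ^ 4) \<noteq> 0" if "x \<in> ball 0 1" for x
      using that by (intro psi_nonzero) (simp add: norm_power power_less_one_iff)
    have "(\<lambda>x. x * r x / (psi (x ^ 4) ^ 2) ^ n) holomorphic_on ball 0 1"
      using ps by (intro holomorphic_intros r holomorphic_on_unit_ball_power psi_holomorphic) auto
    moreover have "f \<tau> = qexp 1 \<tau> * r (qexp 1 \<tau>) / (psi (qexp 1 \<tau> ^ 4) ^ 2) ^ n" if t: "\<tau> \<in> uhp" for \<tau>
    proof -
      have "form_Z \<tau> = qexp 1 \<tau> * psi (qexp 1 \<tau> ^ 4) ^ 2" using fourier_at_Z t by (simp add: fourier_at_def)
      moreover have "G \<tau> = qexp 1 \<tau> ^ Suc n * r (qexp 1 \<tau>)"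
        using eq[OF t] by (simp add: G_eq lessThan_Suc_atMost)
      ultimately show ?thesis by (simp add: f_def power_mult_distrib)
    qed
    ultimately show ?thesis unfolding cuspval_def fourier_at_def
      by (intro exI[of _ "1::nat"] exI[of _ "\<lambda>x. x * r x / (psi (x ^ 4) ^ 2) ^ n"]) auto
  qed
  have fz: "f \<tau> = 0" if "\<tau> \<in> uhp" for \<tau>
  proof (rule Gamma0_8_invariant_vanishes[OF _ _ f0 that])
    fix a b c d \<tau> assume m: "(a, b, c, d) \<in> Gamma0 8" and t: "\<tau> \<in> uhp"
    define j where "j = of_int c * \<tau> + (of_int d :: complex)"
    have j0: "j \<noteq> 0" using autf_nonzero[OF Gamma0_SL2Z[OF m] t] by (simp add: j_def)
    have "odd d"
    proof
      assume "even d"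
      moreover have "even c" using m by (auto simp: Gamma0_def elim!: dvdE)
      ultimately have "even (a * d - b * c)" by simp
      moreover have "a * d - b * c = 1" using m by (simp add: Gamma0_def)
      ultimately show False by (metis odd_one)
    qed
    then have chi: "chi_minus4 d \<noteq> 0" by (simp add: chi_minus4_def)
    have "G (moebius_act (a, b, c, d) \<tau>) = chi_minus4 d * j ^ n * G \<tau>"
      using G m t by (fastforce simp: modular_forms_iff j_def simp del: moebius_act.simps)
    \<comment> \<open>For odd n the power Z^n carries the same character and weight as G, so both
      cancel in the quotient.\<close>
    moreover have "form_Z (moebius_act (a, b, c, d) \<tau>) ^ n = chi_minus4 d * j ^ n * form_Z \<tau> ^ n"
      unfolding UZ_Gamma0_8(2)[OF m t] power_mult_distrib chi_minus4_odd_power[OF \<open>odd n\<close>] j_def ..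
    ultimately show "f (moebius_act (a, b, c, d) \<tau>) = f \<tau>"
      using chi j0 by (simp add: f_def del: moebius_act.simps)
  next
    fix \<rho> assume \<rho>: "\<rho> \<in> cusp_reps"
    note S = cusp_reps_SL2Z[OF \<rho>]
    show "\<exists>v. cuspval (\<lambda>\<tau>. f (moebius_act \<rho> \<tau>)) v"
    proof (cases "\<rho> = (1, 0, 0, 1)")
      case True
      then show ?thesis using f0 by auto
    next
      case False
      then obtain z where z: "cuspval (slash 1 form_Z \<rho>) z" "z \<noteq> 0"
        using cuspval_slash_Z_nonzero[OF \<rho>] by blast
      obtain v where v: "cuspval (slash (int n) G \<rho>) v" using G S by (auto simp: modular_forms_iff)
      have "cuspval (\<lambda>\<tau>. slash (int n) G \<rho> \<tau> / slash 1 form_Z \<rho> \<tau> ^ n) (v / z ^ n)"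
      proof (intro cuspval_divide cuspval_power v z)
        show "slash 1 form_Z \<rho> \<tau> ^ n \<noteq> 0" if "\<tau> \<in> uhp" for \<tau>
          using Z_nonzero[OF moebius_act_uhp[OF S that]] autf_nonzero[OF S that] by (simp add: slash_conv_autf)
      qed (use z in auto)
      then have "cuspval (\<lambda>\<tau>. f (moebius_act \<rho> \<tau>)) (v / z ^ n)"
      proof (rule cuspval_cong)
        fix \<tau> assume "\<tau> \<in> uhp"
        then show "f (moebius_act \<rho> \<tau>) = slash (int n) G \<rho> \<tau> / slash 1 form_Z \<rho> \<tau> ^ n"
          using autf_nonzero[OF S] by (simp add: f_def slash_conv_autf power_int_minus power_mult_distrib power_inverse)
      qed
      then show ?thesis by blast
    qed
  qed
  have "G \<tau> = 0" if "\<tau> \<in> uhp" for \<tau>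
    using fz[OF that] Z_nonzero[OF that] by (simp add: f_def)
  moreover have "G \<tau> = 0" if "\<tau> \<notin> uhp" for \<tau> using G that by (simp add: modular_forms_iff)
  ultimately have "G \<tau> = 0" for \<tau> by blast
  then show ?thesis using that[of c] by (simp add: G_eq)
qed

text \<open>Cusp values respect sums and products, so the value of the form is its polynomial
  evaluated at the values of U and Z.\<close>

lemma cusp_form_relation:
  assumes g: "g \<in> cusp_forms (int n) 8 chi_minus4"
    and eq: "\<And>\<tau>. \<tau> \<in> uhp \<Longrightarrow> g \<tau> = (\<Sum>l\<le>n. c l * UZ_monomial n l \<tau>)"
    and \<rho>: "\<rho> \<in> SL2Z" and u: "cuspval (slash 1 form_U \<rho>) u" and z: "cuspval (slash 1 form_Z \<rho>) z"
  shows "(\<Sum>l\<le>n. c l * (u ^ (n - l) * z ^ l)) = 0"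
proof -
  have "cuspval (\<lambda>\<tau>. \<Sum>l\<le>n. c l * (slash 1 form_U \<rho> \<tau> ^ (n - l) * slash 1 form_Z \<rho> \<tau> ^ l)) (\<Sum>l\<le>n. c l * (u ^ (n - l) * z ^ l))"
    by (intro cuspval_sum cuspval_cmult cuspval_mult cuspval_power u z)
  then have "cuspval (slash (int n) g \<rho>) (\<Sum>l\<le>n. c l * (u ^ (n - l) * z ^ l))"
  proof (rule cuspval_cong)
    fix \<tau> assume t: "\<tau> \<in> uhp"
    have "slash (int n) g \<rho> \<tau> = (\<Sum>l\<le>n. c l * slash (int n) (UZ_monomial n l) \<rho> \<tau>)"
      using eq[OF moebius_act_uhp[OF \<rho> t]] by (simp add: slash_conv_autf sum_distrib_left mult_ac)
    also have "\<dots> = (\<Sum>l\<le>n. c l * (slash 1 form_U \<rho> \<tau> ^ (n - l) * slash 1 form_Z \<rho> \<tau> ^ l))"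
      by (intro sum.cong refl) (simp add: slash_monomial[OF \<rho> t])
    finally show "slash (int n) g \<rho> \<tau> = (\<Sum>l\<le>n. c l * (slash 1 form_U \<rho> \<tau> ^ (n - l) * slash 1 form_Z \<rho> \<tau> ^ l))" .
  qed
  moreover have "cuspval (slash (int n) g \<rho>) 0" using g \<rho> by (simp add: cusp_forms_iff)
  ultimately show ?thesis by (rule cuspval_unique)
qed

lemma cusp_form_relations:
  assumes g: "g \<in> cusp_forms (int n) 8 chi_minus4"
    and eq: "\<And>\<tau>. \<tau> \<in> uhp \<Longrightarrow> g \<tau> = (\<Sum>l\<le>n. c l * UZ_monomial n l \<tau>)"
  shows "c 0 = 0" "c n = 0" "(\<Sum>l\<le>n. c l / 4 ^ l) = 0" "(\<Sum>l\<le>n. (- 1) ^ l * (c l / 4 ^ l)) = 0"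
proof -
  note R = cusp_form_relation[OF g eq]
  have S: "(1, 0, 0, 1) \<in> SL2Z" "(0, -1, 1, 0) \<in> SL2Z" "(1, 0, 2, 1) \<in> SL2Z" "(1, 0, 4, 1) \<in> SL2Z"
    by (simp_all add: SL2Z_def)
  have "0 = (\<Sum>l\<le>n. c l * (1 ^ (n - l) * 0 ^ l))" using R[OF _ S(1) cuspval_slash_UZ_infinity] by simp
  also have "\<dots> = (\<Sum>l\<le>n. if l = 0 then c 0 else 0)" by (intro sum.cong) (auto simp: power_0_left)
  finally show "c 0 = 0" by simp
  have "0 = (\<Sum>l\<le>n. c l * (0 ^ (n - l) * (1 / 4) ^ l))" using R[OF _ S(4) cuspval_slash_UZ_quarter] by simp
  also have "\<dots> = (\<Sum>l\<le>n. if l = n then c n * (1 / 4) ^ n else 0)" by (intro sum.cong) (auto simp: power_0_left)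
  finally show "c n = 0" by simp
  \<comment> \<open>Homogeneity leaves only the ratio x = z/u: it is 1/4 at the cusp 0, from -i/4
    and -i/16, and -1/4 at the cusp 1/2, from -i/2 and i/8.\<close>
  have *: "(\<Sum>l\<le>n. c l * (u ^ (n - l) * (u * x) ^ l)) = u ^ n * (\<Sum>l\<le>n. c l * x ^ l)" for u x
    unfolding sum_distrib_left
  proof (intro sum.cong refl)
    fix l assume "l \<in> {..n}"
    then have "u ^ n = u ^ (n - l) * u ^ l" by (simp flip: power_add)
    then show "c l * (u ^ (n - l) * (u * x) ^ l) = u ^ n * (c l * x ^ l)" by (simp add: power_mult_distrib)
  qed
  have "(- \<i> / 4) ^ n * (\<Sum>l\<le>n. c l * (1 / 4) ^ l) = 0"
    using R[OF _ S(2) cuspval_slash_UZ_0] *[of "- \<i> / 4" "1 / 4"] by simp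
  then show "(\<Sum>l\<le>n. c l / 4 ^ l) = 0" by (simp add: power_divide)
  have "(- \<i> / 2) ^ n * (\<Sum>l\<le>n. c l * (- 1 / 4) ^ l) = 0"
    using R[OF _ S(3) cuspval_slash_UZ_half] *[of "- \<i> / 2" "- 1 / 4"] by simp
  then have "(\<Sum>l\<le>n. c l * (- 1 / 4) ^ l) = 0" by simp
  moreover have "c l * (- 1 / 4) ^ l = (- 1) ^ l * (c l / 4 ^ l)" for l
    using power_minus[of "1 / 4 :: complex" l] by (simp add: power_divide)
  ultimately show "(\<Sum>l\<le>n. (- 1) ^ l * (c l / 4 ^ l)) = 0" by simp
qed

section \<open>From the monomials to the basis of the theorem\<close>

lemma basis_eq_monomials:
  assumes "k \<ge> 1"
  shows "l \<le> k - 1 \<Longrightarrow> F \<tau> ^ l * theta2 \<tau> ^ (4 * (k - l) + 2) = UZ_monomial (2 * k + 1) l \<tau>"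
    and "k \<le> l \<Longrightarrow> l \<le> 2 * k \<Longrightarrow> F \<tau> ^ (2 * k - l) * F2 \<tau> ^ (l - k) * theta2 \<tau> ^ 2 = UZ_monomial (2 * k + 1) l \<tau>"
    and "F \<tau> * F2 \<tau> ^ k / theta2 \<tau> ^ 2 = UZ_monomial (2 * k + 1) (2 * k + 1) \<tau>"
proof -
  assume l: "l \<le> k - 1"
  \<comment> \<open>The exponent of \<open>theta2\<close> is even, so it becomes the power 2(k-l) +
    1 of U; the l factors U from F complete the degree 2k+1-l.\<close>
  have "theta2 \<tau> ^ (4 * (k - l) + 2) = (theta2 \<tau> ^ 2) ^ (2 * (k - l) + 1)"
    by (simp only: power_mult[symmetric]) (simp add: algebra_simps)
  also have "F \<tau> ^ l * \<dots> = form_U \<tau> ^ (l + (2 * (k - l) + 1)) * form_Z \<tau> ^ l"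
    unfolding theta2_sq F_eq_UZ power_add power_mult_distrib by (simp only: mult_ac)
  also have "l + (2 * (k - l) + 1) = 2 * k + 1 - l" using l assms by simp
  finally show "F \<tau> ^ l * theta2 \<tau> ^ (4 * (k - l) + 2) = UZ_monomial (2 * k + 1) l \<tau>"
    by (simp add: UZ_monomial_def)
next
  assume l: "k \<le> l" "l \<le> 2 * k"
  have "F \<tau> ^ (2 * k - l) * F2 \<tau> ^ (l - k) * theta2 \<tau> ^ 2
      = form_U \<tau> ^ (2 * k - l + 1) * form_Z \<tau> ^ (2 * k - l + 2 * (l - k))"
    unfolding theta2_sq F_eq_UZ F2_eq_Z power_add power_mult_distrib power_mult by simp
  also have "2 * k - l + 1 = 2 * k + 1 - l" using l by simp
  also have "2 * k - l + 2 * (l - k) = l" using l by simp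
  finally show "F \<tau> ^ (2 * k - l) * F2 \<tau> ^ (l - k) * theta2 \<tau> ^ 2 = UZ_monomial (2 * k + 1) l \<tau>"
    by (simp add: UZ_monomial_def)
next
  \<comment> \<open>U vanishes only off the half-plane. There the quotient is 0/0, whose value 0
    agrees with the monomial; elsewhere U cancels and Z^(2k+1) remains.\<close>
  have "form_Z \<tau> = 0" if "form_U \<tau> = 0" using that U_nonzero[of \<tau>] by (auto simp: form_Z_def)
  then show "F \<tau> * F2 \<tau> ^ k / theta2 \<tau> ^ 2 = UZ_monomial (2 * k + 1) (2 * k + 1) \<tau>"
    by (cases "form_U \<tau> = 0") (simp_all add: theta2_sq F_eq_UZ F2_eq_Z UZ_monomial_def power_mult)
qed

text \<open>The three families of coefficients form a single sequence indexed by the power of Z,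
  from 0 to 2k+1.\<close>

definition joint_coeff :: "nat \<Rightarrow> (nat \<Rightarrow> complex) \<Rightarrow> (nat \<Rightarrow> complex) \<Rightarrow> complex \<Rightarrow> nat \<Rightarrow> complex"
  where "joint_coeff k \<alpha> \<beta> \<gamma> l = (if l < k then \<alpha> l else if l \<le> 2 * k then \<beta> l else \<gamma>)"

lemma sum_joint_coeff:
  fixes w :: "nat \<Rightarrow> complex"
  assumes "k \<ge> 1"
  shows "(\<Sum>l\<le>2 * k + 1. joint_coeff k \<alpha> \<beta> \<gamma> l * w l)
     = (\<Sum>l = 0..k - 1. \<alpha> l * w l) + (\<Sum>l = k..2 * k. \<beta> l * w l) + \<gamma> * w (2 * k + 1)"
proof -
  have "{..2 * k + 1} = {0..k - 1} \<union> {k..2 * k} \<union> {2 * k + 1}" using assms by auto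
  then have "(\<Sum>l\<le>2 * k + 1. joint_coeff k \<alpha> \<beta> \<gamma> l * w l)
      = (\<Sum>l = 0..k - 1. joint_coeff k \<alpha> \<beta> \<gamma> l * w l) + (\<Sum>l = k..2 * k. joint_coeff k \<alpha> \<beta> \<gamma> l * w l)
        + (\<Sum>l\<in>{2 * k + 1}. joint_coeff k \<alpha> \<beta> \<gamma> l * w l)"
    using assms by (simp only:) (subst sum.union_disjoint; auto)+
  also have "(\<Sum>l = 0..k - 1. joint_coeff k \<alpha> \<beta> \<gamma> l * w l) = (\<Sum>l = 0..k - 1. \<alpha> l * w l)"
    using assms by (intro sum.cong) (auto simp: joint_coeff_def)
  also have "(\<Sum>l = k..2 * k. joint_coeff k \<alpha> \<beta> \<gamma> l * w l) = (\<Sum>l = k..2 * k. \<beta> l * w l)"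
    by (intro sum.cong) (auto simp: joint_coeff_def)
  finally show ?thesis by (simp add: joint_coeff_def)
qed

lemma basis_expansion_eq:
  assumes "k \<ge> 1"
  shows "basis_expansion k \<alpha> \<beta> \<gamma> \<tau> = (\<Sum>l\<le>2 * k + 1. joint_coeff k \<alpha> \<beta> \<gamma> l * UZ_monomial (2 * k + 1) l \<tau>)"
  unfolding sum_joint_coeff[OF assms] basis_expansion_def theta2_def[symmetric] F2_def[symmetric]
proof (intro arg_cong2[where f = "(+)"] sum.cong refl)
  fix l assume "l \<in> {0..k - 1}"
  then show "\<alpha> l * F \<tau> ^ l * theta2 \<tau> ^ (4 * (k - l) + 2) = \<alpha> l * UZ_monomial (2 * k + 1) l \<tau>"
    using basis_eq_monomials(1)[OF assms, of l \<tau>] by (simp only: mult.assoc) simp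
next
  fix l assume "l \<in> {k..2 * k}"
  then show "\<beta> l * F \<tau> ^ (2 * k - l) * F2 \<tau> ^ (l - k) * theta2 \<tau> ^ 2 = \<beta> l * UZ_monomial (2 * k + 1) l \<tau>"
    using basis_eq_monomials(2)[OF assms, of l \<tau>] by (simp only: mult.assoc) simp
next
  show "\<gamma> * (F \<tau> * F2 \<tau> ^ k / theta2 \<tau> ^ 2) = \<gamma> * UZ_monomial (2 * k + 1) (2 * k + 1) \<tau>"
    unfolding basis_eq_monomials(3)[OF assms] ..
qed

lemma monomials_basis:
  assumes "odd n"
  shows "is_basis_of (UZ_monomial n ` {..n}) (modular_forms (int n) 8 chi_minus4)"
  unfolding is_basis_of_def
proof
  have ind: "c l = 0" if "(\<Sum>l\<le>n. cfun_scale (c l) (UZ_monomial n l)) = 0" "l \<le> n" for c l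
  proof (rule UZ_monomials_independent[OF _ that(2)])
    fix \<tau>
    show "(\<Sum>l\<le>n. c l * UZ_monomial n l \<tau>) = 0"
      using fun_cong[OF that(1), of \<tau>] by (simp add: fun_sum_apply cfun_scale_def)
  qed
  \<comment> \<open>Independence concerns a set of functions, so different l must give different
    monomials before sums over the image can be reindexed by l.\<close>
  have inj: "inj_on (UZ_monomial n) {..n}"
  proof (rule inj_onI, rule ccontr)
    fix i j assume ij: "i \<in> {..n}" "j \<in> {..n}" "UZ_monomial n i = UZ_monomial n j" "i \<noteq> j"
    let ?c = "\<lambda>l. if l = i then 1 else if l = j then - 1 else (0::complex)"
    have "(\<Sum>l\<le>n. ?c l * UZ_monomial n l \<tau>) = (\<Sum>l\<in>{i, j}. ?c l * UZ_monomial n l \<tau>)" for \<tau>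
      using ij by (intro sum.mono_neutral_right) auto
    then have "(\<Sum>l\<le>n. ?c l * UZ_monomial n l \<tau>) = 0" for \<tau> using ij by simp
    then have "?c i = 0" using ij(1) by (intro UZ_monomials_independent[where c = ?c and n = n]) auto
    then show False by simp
  qed
  show "cfun.independent (UZ_monomial n ` {..n})"
  proof
    assume "cfun.dependent (UZ_monomial n ` {..n})"
    then obtain u v where u: "v \<in> UZ_monomial n ` {..n}" "u v \<noteq> 0"
      "(\<Sum>v\<in>UZ_monomial n ` {..n}. cfun_scale (u v) v) = 0"
      unfolding cfun.dependent_finite[OF finite_imageI[OF finite_atMost]] by blast
    from u(3) have "(\<Sum>l\<le>n. cfun_scale (u (UZ_monomial n l)) (UZ_monomial n l)) = 0"
      by (simp add: sum.reindex[OF inj])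
    from ind[OF this] u(1,2) show False by auto
  qed
  show "cfun.span (UZ_monomial n ` {..n}) = modular_forms (int n) 8 chi_minus4"
  proof
    show "cfun.span (UZ_monomial n ` {..n}) \<subseteq> modular_forms (int n) 8 chi_minus4"
      using UZ_monomial_modular[OF _ assms] by (intro cfun.span_minimal subspace_modular_forms) auto
    show "modular_forms (int n) 8 chi_minus4 \<subseteq> cfun.span (UZ_monomial n ` {..n})"
    proof
      fix g assume "g \<in> modular_forms (int n) 8 chi_minus4"
      then obtain c where "\<And>\<tau>. g \<tau> = (\<Sum>l\<le>n. c l * UZ_monomial n l \<tau>)"
        using modular_form_eq_UZ_polynomial assms by blast
      then have "g = (\<Sum>l\<le>n. cfun_scale (c l) (UZ_monomial n l))"
        by (simp add: fun_eq_iff fun_sum_apply cfun_scale_def)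
      also have "\<dots> \<in> cfun.span (UZ_monomial n ` {..n})"
        by (intro cfun.span_sum cfun.span_scale cfun.span_base imageI)
      finally show "g \<in> cfun.span (UZ_monomial n ` {..n})" .
    qed
  qed
qed

theorem theorem1p3:
  fixes k :: nat
  assumes "k \<ge> 1"
  shows
    "is_basis_of
       ({(\<lambda>\<tau>. F \<tau> ^ l * theta2 \<tau> ^ (4 * (k - l) + 2)) | l. 0 \<le> l \<and> l \<le> k - 1} \<union>
        {(\<lambda>\<tau>. F \<tau> ^ (2 * k - l) * F2 \<tau> ^ (l - k) * theta2 \<tau> ^ 2) | l. k \<le> l \<and> l \<le> 2 * k} \<union>
        {(\<lambda>\<tau>. F \<tau> * F2 \<tau> ^ k / theta2 \<tau> ^ 2)})
       (modular_forms (2 * int k + 1) 8 chi_minus4)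
     \<and> (\<forall>g \<in> modular_forms (2 * int k + 1) 8 chi_minus4.
          \<exists>!p. case p of (\<alpha>, \<beta>, \<gamma>) \<Rightarrow>
            \<alpha> \<in> extensional {0..k - 1} \<and> \<beta> \<in> extensional {k..2 * k} \<and>
            (\<forall>\<tau>\<in>uhp. g \<tau> = basis_expansion k \<alpha> \<beta> \<gamma> \<tau>))
     \<and> (\<forall>g \<in> cusp_forms (2 * int k + 1) 8 chi_minus4. \<forall>\<alpha> \<beta> \<gamma>.
          (\<forall>\<tau>\<in>uhp. g \<tau> = basis_expansion k \<alpha> \<beta> \<gamma> \<tau>) \<longrightarrow>
            (\<alpha> 0 = 0 \<and> \<gamma> = 0) \<and>
            (\<Sum>l = 0..k - 1. \<alpha> l / 4 ^ l) + (\<Sum>l = k..2 * k. \<beta> l / 4 ^ l) + \<gamma> / 2 ^ (4 * k + 3) = 0 \<and>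
            (\<Sum>l = 0..k - 1. (- 1) ^ l * (\<alpha> l / 4 ^ l)) + (\<Sum>l = k..2 * k. (- 1) ^ l * (\<beta> l / 4 ^ l))
              - \<gamma> / 2 ^ (4 * k + 2) = 0)"
proof (intro conjI ballI)
  let ?n = "2 * k + 1"
  have n: "int ?n = 2 * int k + 1" by simp
  have "{(\<lambda>\<tau>. F \<tau> ^ l * theta2 \<tau> ^ (4 * (k - l) + 2)) | l. 0 \<le> l \<and> l \<le> k - 1}
      = (\<lambda>l \<tau>. F \<tau> ^ l * theta2 \<tau> ^ (4 * (k - l) + 2)) ` {0..k - 1}" by auto
  also have "\<dots> = UZ_monomial ?n ` {0..k - 1}"
    by (intro image_cong refl ext basis_eq_monomials(1)[OF assms]) simp
  finally have 1: "{(\<lambda>\<tau>. F \<tau> ^ l * theta2 \<tau> ^ (4 * (k - l) + 2)) | l. 0 \<le> l \<and> l \<le> k - 1} = UZ_monomial ?n ` {0..k - 1}" .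
  have "{(\<lambda>\<tau>. F \<tau> ^ (2 * k - l) * F2 \<tau> ^ (l - k) * theta2 \<tau> ^ 2) | l. k \<le> l \<and> l \<le> 2 * k}
      = (\<lambda>l \<tau>. F \<tau> ^ (2 * k - l) * F2 \<tau> ^ (l - k) * theta2 \<tau> ^ 2) ` {k..2 * k}" by auto
  also have "\<dots> = UZ_monomial ?n ` {k..2 * k}"
    by (intro image_cong refl ext basis_eq_monomials(2)[OF assms]) simp_all
  finally have 2: "{(\<lambda>\<tau>. F \<tau> ^ (2 * k - l) * F2 \<tau> ^ (l - k) * theta2 \<tau> ^ 2) | l. k \<le> l \<and> l \<le> 2 * k} = UZ_monomial ?n ` {k..2 * k}" .
  have 3: "{(\<lambda>\<tau>. F \<tau> * F2 \<tau> ^ k / theta2 \<tau> ^ 2)} = UZ_monomial ?n ` {?n}"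
    using basis_eq_monomials(3)[OF assms] by (simp add: fun_eq_iff)
  have 4: "{0..k - 1} \<union> {k..2 * k} \<union> {?n} = {..?n}" using assms by auto
  show "is_basis_of
       ({(\<lambda>\<tau>. F \<tau> ^ l * theta2 \<tau> ^ (4 * (k - l) + 2)) | l. 0 \<le> l \<and> l \<le> k - 1} \<union>
        {(\<lambda>\<tau>. F \<tau> ^ (2 * k - l) * F2 \<tau> ^ (l - k) * theta2 \<tau> ^ 2) | l. k \<le> l \<and> l \<le> 2 * k} \<union>
        {(\<lambda>\<tau>. F \<tau> * F2 \<tau> ^ k / theta2 \<tau> ^ 2)})
       (modular_forms (2 * int k + 1) 8 chi_minus4)"
    unfolding 1 2 3 image_Un[symmetric] 4 n[symmetric] by (rule monomials_basis) simp
next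
  let ?n = "2 * k + 1"
  fix g assume g: "g \<in> modular_forms (2 * int k + 1) 8 chi_minus4"
  then have "g \<in> modular_forms (int ?n) 8 chi_minus4" by (simp add: add.commute)
  then obtain c where c: "\<And>\<tau>. g \<tau> = (\<Sum>l\<le>?n. c l * UZ_monomial ?n l \<tau>)"
    using modular_form_eq_UZ_polynomial[of g ?n] by auto
  show "\<exists>!p. case p of (\<alpha>, \<beta>, \<gamma>) \<Rightarrow>
            \<alpha> \<in> extensional {0..k - 1} \<and> \<beta> \<in> extensional {k..2 * k} \<and>
            (\<forall>\<tau>\<in>uhp. g \<tau> = basis_expansion k \<alpha> \<beta> \<gamma> \<tau>)"
  \<comment> \<open>The form determines coefficients only inside the summation ranges;
    \<open>restrict\<close> supplies the default outside them that \<open>extensional\<close>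
    prescribes, which makes the triple unique.\<close>
  proof (rule ex1I[of _ "(restrict c {0..k - 1}, restrict c {k..2 * k}, c ?n)"])
    have "joint_coeff k (restrict c {0..k - 1}) (restrict c {k..2 * k}) (c ?n) l = c l" if "l \<le> ?n" for l
      using that assms by (cases "l = ?n") (auto simp: joint_coeff_def)
    then have "g \<tau> = basis_expansion k (restrict c {0..k - 1}) (restrict c {k..2 * k}) (c ?n) \<tau>" for \<tau>
      unfolding basis_expansion_eq[OF assms] c by (intro sum.cong) auto
    then show "case (restrict c {0..k - 1}, restrict c {k..2 * k}, c ?n) of (\<alpha>, \<beta>, \<gamma>) \<Rightarrow>
            \<alpha> \<in> extensional {0..k - 1} \<and> \<beta> \<in> extensional {k..2 * k} \<and>
            (\<forall>\<tau>\<in>uhp. g \<tau> = basis_expansion k \<alpha> \<beta> \<gamma> \<tau>)" by simp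
  next
    fix p assume p: "case p of (\<alpha>, \<beta>, \<gamma>) \<Rightarrow>
            \<alpha> \<in> extensional {0..k - 1} \<and> \<beta> \<in> extensional {k..2 * k} \<and>
            (\<forall>\<tau>\<in>uhp. g \<tau> = basis_expansion k \<alpha> \<beta> \<gamma> \<tau>)"
    obtain \<alpha> \<beta> \<gamma> where abc: "p = (\<alpha>, \<beta>, \<gamma>)" by (cases p)
    then have ext: "\<alpha> \<in> extensional {0..k - 1}" "\<beta> \<in> extensional {k..2 * k}"
      and eq: "\<And>\<tau>. \<tau> \<in> uhp \<Longrightarrow> g \<tau> = basis_expansion k \<alpha> \<beta> \<gamma> \<tau>" using p by auto
    have *: "joint_coeff k \<alpha> \<beta> \<gamma> l - c l = 0" if "l \<le> ?n" for l
    proof (rule UZ_monomials_independent[OF _ that])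
      fix \<tau> assume "\<tau> \<in> uhp"
      then show "(\<Sum>l\<le>?n. (joint_coeff k \<alpha> \<beta> \<gamma> l - c l) * UZ_monomial ?n l \<tau>) = 0"
        using eq[of \<tau>] unfolding basis_expansion_eq[OF assms] c left_diff_distrib sum_subtractf by simp
    qed
    have "\<alpha> = restrict c {0..k - 1}"
    proof (rule extensionalityI[OF ext(1) restrict_extensional])
      fix l assume l: "l \<in> {0..k - 1}"
      then have "l < k" using assms by auto
      then show "\<alpha> l = restrict c {0..k - 1} l" using *[of l] l by (simp add: joint_coeff_def)
    qed
    moreover have "\<beta> = restrict c {k..2 * k}"
    proof (rule extensionalityI[OF ext(2) restrict_extensional])
      fix l assume "l \<in> {k..2 * k}"
      then show "\<beta> l = restrict c {k..2 * k} l" using *[of l] by (simp add: joint_coeff_def)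
    qed
    moreover have "\<gamma> = c ?n" using *[of ?n] by (simp add: joint_coeff_def)
    ultimately show "p = (restrict c {0..k - 1}, restrict c {k..2 * k}, c ?n)" by (simp add: abc)
  qed
next
  let ?n = "2 * k + 1"
  fix g assume g: "g \<in> cusp_forms (2 * int k + 1) 8 chi_minus4"
  show "\<forall>\<alpha> \<beta> \<gamma>. (\<forall>\<tau>\<in>uhp. g \<tau> = basis_expansion k \<alpha> \<beta> \<gamma> \<tau>) \<longrightarrow>
            (\<alpha> 0 = 0 \<and> \<gamma> = 0) \<and>
            (\<Sum>l = 0..k - 1. \<alpha> l / 4 ^ l) + (\<Sum>l = k..2 * k. \<beta> l / 4 ^ l) + \<gamma> / 2 ^ (4 * k + 3) = 0 \<and>
            (\<Sum>l = 0..k - 1. (- 1) ^ l * (\<alpha> l / 4 ^ l)) + (\<Sum>l = k..2 * k. (- 1) ^ l * (\<beta> l / 4 ^ l))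
              - \<gamma> / 2 ^ (4 * k + 2) = 0"
  proof (intro allI impI)
    fix \<alpha> \<beta> \<gamma> assume eq: "\<forall>\<tau>\<in>uhp. g \<tau> = basis_expansion k \<alpha> \<beta> \<gamma> \<tau>"
    let ?c = "joint_coeff k \<alpha> \<beta> \<gamma>"
    have g': "g \<in> cusp_forms (int ?n) 8 chi_minus4" using g by (simp add: add.commute)
    note R = cusp_form_relations[OF g', of ?c]
    have E: "\<And>\<tau>. \<tau> \<in> uhp \<Longrightarrow> g \<tau> = (\<Sum>l\<le>?n. ?c l * UZ_monomial ?n l \<tau>)"
      using eq by (simp only: basis_expansion_eq[OF assms])
    have \<alpha>0: "\<alpha> 0 = 0" using R(1)[OF E] assms by (simp add: joint_coeff_def)
    have \<gamma>0: "\<gamma> = 0" using R(2)[OF E] by (simp add: joint_coeff_def)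
    \<comment> \<open>Evaluation at the cusp 0 attaches to \<gamma> the factor 1/4^(2k+1) =
      1/2^(4k+2), whereas the statement has 1/2^(4k+3). Both terms are 0 because \<gamma> =
      0.\<close>
    have "(\<Sum>l\<le>?n. ?c l * (1 / 4 ^ l)) = 0" using R(3)[OF E] by simp
    then have 3: "(\<Sum>l = 0..k - 1. \<alpha> l / 4 ^ l) + (\<Sum>l = k..2 * k. \<beta> l / 4 ^ l) = 0"
      unfolding sum_joint_coeff[OF assms] by (simp add: \<gamma>0)
    have "(\<Sum>l\<le>?n. ?c l * ((- 1) ^ l / 4 ^ l)) = 0" using R(4)[OF E] by (simp add: mult.commute)
    then have 4: "(\<Sum>l = 0..k - 1. (- 1) ^ l * (\<alpha> l / 4 ^ l)) + (\<Sum>l = k..2 * k. (- 1) ^ l * (\<beta> l / 4 ^ l)) = 0"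
      unfolding sum_joint_coeff[OF assms] by (simp add: \<gamma>0 mult.commute)
    show "(\<alpha> 0 = 0 \<and> \<gamma> = 0) \<and>
            (\<Sum>l = 0..k - 1. \<alpha> l / 4 ^ l) + (\<Sum>l = k..2 * k. \<beta> l / 4 ^ l) + \<gamma> / 2 ^ (4 * k + 3) = 0 \<and>
            (\<Sum>l = 0..k - 1. (- 1) ^ l * (\<alpha> l / 4 ^ l)) + (\<Sum>l = k..2 * k. (- 1) ^ l * (\<beta> l / 4 ^ l))
              - \<gamma> / 2 ^ (4 * k + 2) = 0"
      using \<alpha>0 \<gamma>0 3 4 by simp
  qed
qed

end
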